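(* Let $p>1$ and $n>1$ be integers. Then the iterated torus knot $T((n,p),(n+1,1))$ satisfies $\operatorname{ar}(T((n,p),(n+1,1)))<np$, where $\operatorname{ar}$ denotes augmentation rank.
   Context: Braids. $B_n$ is the braid group on $n$ strands with Artin generators $\sigma_1,\dots,\sigma_{n-1}$. Braids are oriented left to right, strands numbered $1,\dots,n$ from top to bottom; in $\sigma_i$ only strands $i,i+1$ interact and cross once, the strand starting at position $i$ passing over (a positive crossing). $\hat\beta$ is the braid closure of $\beta$. The writhe $w(\beta)$ is the exponent sum of $\beta$ in the Artin generators. Braid satellite. For $\alpha\in B_k$, let $\imath_p(\alpha)\in B_{kp}$ be obtained by replacing each strand of $\alpha$ by $p$ parallel copies in the blackboard framing; equivalently $\imath_p:B_k\to B_{kp}$ is the homomorphism with $\imath_p(\sigma_n)=\tau_{m+p-1}\tau_{m+p-2}\cdots\tau_{m}$, where $m=(n-1)p+1$ and $\tau_s=\sigma_s\sigma_{s+1}\cdots\sigma_{s+p-1}$. For $\gamma\in B_p$ let $\bar\gamma\in B_{kp}$ be its image under $\sigma_i\mapsto\sigma_i$, $1\le i\le p-1$. Set $\gamma(\alpha)=\imath_p(\alpha)\bar\gamma$ and $K(\alpha,\gamma)=\widehat{\gamma(\alpha)}$. Iterated torus knots. Let $\mathbf p=(p_1,\dots,p_l)$, $\mathbf q=(q_1,\dots,q_l)$ be integral vectors with all $p_i>0$. $T(\emptyset,\emptyset)$ is the unknot. Inductively, let $\hat{\mathbf p},\hat{\mathbf q}$ be obtained from $\mathbf p,\mathbf q$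 by removing the last entry of each; if $\alpha$ is a braid of minimal index (number of strands) among braids with closure $T(\hat{\mathbf p},\hat{\mathbf q})$, then $T(\mathbf p,\mathbf q)=K(\alpha,(\sigma_1\cdots\sigma_{p_l-1})^{q_l})$, where $\sigma_1\cdots\sigma_{p_l-1}\in B_{p_l}$. (The result does not depend on the choice of minimal index $\alpha$.) Augmentation rank. $\mathcal A_n$ is the free noncommutative unital $\mathbb Z$-algebra on $a_{ij}$, $1\le i\neq j\le n$. Define the homomorphism $\phi:B_n\to\operatorname{Aut}\mathcal A_n$, $\beta\mapsto\phi_\beta$ (with $\phi_{\beta_1\beta_2}=\phi_{\beta_1}\circ\phi_{\beta_2}$) by: $\phi_{\sigma_k}$ sends $a_{ij}\mapsto a_{ij}$ for $i,j\ne k,k+1$; $a_{k,k+1}\mapsto -a_{k+1,k}$; $a_{k+1,k}\mapsto -a_{k,k+1}$; and for $i\neq k,k+1$: $a_{k+1,i}\mapsto a_{ki}$, $a_{i,k+1}\mapsto a_{ik}$, $a_{ki}\mapsto a_{k+1,i}-a_{k+1,k}a_{ki}$, $a_{ik}\mapsto a_{i,k+1}-a_{ik}a_{k,k+1}$. For $\beta\in B_n$ let $\phi_\beta^*\in\operatorname{Aut}\mathcal A_{n+1}$ be $\phi$ of the image of $\beta$ under $B_n\hookrightarrow B_{n+1}$, $\sigma_i\mapsto\sigma_i$. Define $n\times n$ matrices $\Phi_\beta^L,\Phi_\beta^R$ over $\mathcal A_n$ by $\phi^*_\beta(a_{i,n+1})=\sum_{j=1}^n(\Phi^L_\beta)_{ij}a_{j,n+1}$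 and $\phi^*_\beta(a_{n+1,i})=\sum_{j=1}^n a_{n+1,j}(\Phi^R_\beta)_{ji}$. Let $R_0=\mathbb Z[\lambda^{\pm1},\mu^{\pm1}]$, let $\mathbf A$ be the $n\times n$ matrix with $\mathbf A_{ij}=a_{ij}$ for $i<j$, $\mathbf A_{ij}=-\mu a_{ij}$ for $i>j$, $\mathbf A_{ii}=1-\mu$, and let $\mathbf\Lambda=\operatorname{diag}[\lambda\mu^{w(\beta)},1,\dots,1]$. If a knot $K$ is the closure of $\beta\in B_n$, let $\mathcal I\subset\mathcal A_n\otimes R_0$ be the two-sided ideal generated by the entries of $\mathbf A-\mathbf\Lambda\Phi^L_\beta\mathbf A$ and $\mathbf A-\mathbf A\Phi^R_\beta\mathbf\Lambda^{-1}$. An augmentation of $K$ is a (unital ring) homomorphism $\epsilon:\mathcal A_n\otimes R_0\to\mathbb C$ vanishing on $\mathcal I$. If $\epsilon(\mu)\ne1$, its rank is the rank of the complex matrix $\epsilon(\mathbf A)$. The augmentation rank $\operatorname{ar}(K)$ is the maximum rank among augmentations of $K$ with $\epsilon(\mu)\neq 1$; it is finite and does not depend on the braid $\beta$ representing $K$. *)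

theory Defs
  imports
    "HOL-Library.Poly_Mapping"
    "HOL-Library.Product_Plus"
    "HOL-Library.Extended_Nat"
    "HOL-Algebra.Ideal"
    "HOL-Algebra.Ring"
    "Jordan_Normal_Form.Matrix"
    "Jordan_Normal_Form.DL_Rank"
begin

section \<open>Braids and their closures\<close>

text \<open>
  Elements of the braid group on \<open>n\<close> strands are represented by words in the Artin generators
  and their inverses: \<open>Pos i\<close> stands for the generator $\sigma_i$ and \<open>Neg i\<close> for its inverse.
  A braid is a pair of its index (number of strands) and a word.
\<close>

datatype crossing = Pos nat | Neg nat

type_synonym word = "crossing list"
type_synonym braid = "nat \<times> word"

fun position :: "crossing \<Rightarrow> nat" where
  "position (Pos i) = i"
| "position (Neg i) = i"

fun flip :: "crossing \<Rightarrow> crossing" where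
  "flip (Pos i) = Neg i"
| "flip (Neg i) = Pos i"

fun crossing_sign :: "crossing \<Rightarrow> int" where
  "crossing_sign (Pos i) = 1"
| "crossing_sign (Neg i) = -1"

definition inverse_word :: "word \<Rightarrow> word" where
  "inverse_word w = rev (map flip w)"

definition writhe :: "word \<Rightarrow> int" where
  "writhe w = sum_list (map crossing_sign w)"

definition power_word :: "word \<Rightarrow> int \<Rightarrow> word" where
  "power_word w q =
     (if 0 \<le> q then concat (replicate (nat q) w)
      else concat (replicate (nat (- q)) (inverse_word w)))"

definition is_braid :: "braid \<Rightarrow> bool" where
  "is_braid b \<longleftrightarrow> 1 \<le> fst b \<and> (\<forall>c \<in> set (snd b). 1 \<le> position c \<and> position c < fst b)"

text \<open>The defining relations of the braid group, including free cancellation.\<close>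

inductive artin_relation :: "word \<Rightarrow> word \<Rightarrow> bool" where
  "artin_relation [Pos i, Neg i] []"
| "artin_relation [Neg i, Pos i] []"
| "i + 1 < j \<Longrightarrow> artin_relation [Pos i, Pos j] [Pos j, Pos i]"
| "artin_relation [Pos i, Pos (i + 1), Pos i] [Pos (i + 1), Pos i, Pos (i + 1)]"

text \<open>
  Oriented link types are encoded as Markov classes: by the theorems of Alexander and Markov,
  every oriented link is the closure of a braid, and two braids have isotopic closures if and
  only if they are related by equality in a braid group, conjugation, and positive or negative
  stabilization.  A link is thus identified with the set of all braids whose closure it is.
\<close>

inductive markov_move :: "braid \<Rightarrow> braid \<Rightarrow> bool" where
  relation: "artin_relation l r \<Longrightarrow> is_braid (n, u @ l @ v) \<Longrightarrow> is_braid (n, u @ r @ v)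
    \<Longrightarrow> markov_move (n, u @ l @ v) (n, u @ r @ v)"
| conjugation: "is_braid (n, w) \<Longrightarrow> is_braid (n, u)
    \<Longrightarrow> markov_move (n, w) (n, u @ w @ inverse_word u)"
| positive_stabilization: "is_braid (n, w) \<Longrightarrow> markov_move (n, w) (n + 1, w @ [Pos n])"
| negative_stabilization: "is_braid (n, w) \<Longrightarrow> markov_move (n, w) (n + 1, w @ [Neg n])"

type_synonym link = "braid set"

definition braid_closure :: "braid \<Rightarrow> link" where
  "braid_closure b = {c. equivclp markov_move b c}"

definition is_minimal_index :: "braid \<Rightarrow> link \<Rightarrow> bool" where
  "is_minimal_index b K \<longleftrightarrow> is_braid b \<and> braid_closure b = K
     \<and> (\<forall>c. is_braid c \<and> braid_closure c = K \<longrightarrow> fst b \<le> fst c)"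


section \<open>Braid satellites and iterated torus knots\<close>

definition sigma_run :: "nat \<Rightarrow> nat \<Rightarrow> word" where
  "sigma_run s p = map Pos [s..<s + p]"

text \<open>
  The image of $\sigma_i$ is $\tau_{m+p-1} \cdots \tau_{m+1} \tau_m$ with $m = (i-1)p+1$ and
  $\tau_s = \sigma_s \cdots \sigma_{s+p-1}$.
\<close>

definition cable_generator :: "nat \<Rightarrow> nat \<Rightarrow> word" where
  "cable_generator p i =
     (let m = (i - 1) * p + 1 in concat (map (\<lambda>s. sigma_run s p) (rev [m..<m + p])))"

fun cable_crossing :: "nat \<Rightarrow> crossing \<Rightarrow> word" where
  "cable_crossing p (Pos i) = cable_generator p i"
| "cable_crossing p (Neg i) = inverse_word (cable_generator p i)"

definition cable_word :: "nat \<Rightarrow> word \<Rightarrow> word" where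
  "cable_word p w = concat (map (cable_crossing p) w)"

fun satellite_braid :: "braid \<Rightarrow> braid \<Rightarrow> braid" where
  "satellite_braid (k, a) (p, g) = (k * p, cable_word p a @ g)"

definition satellite_link :: "braid \<Rightarrow> braid \<Rightarrow> link" where
  "satellite_link a g = braid_closure (satellite_braid a g)"

definition torus_braid :: "nat \<Rightarrow> int \<Rightarrow> braid" where
  "torus_braid p q = (p, power_word (sigma_run 1 (p - 1)) q)"

text \<open>
  \<open>iterated_torus ps qs K\<close> states that \<open>K\<close> is \<open>T(ps, qs)\<close>.  This is a relation since the
  inductive step involves an arbitrary choice of a braid of minimal index.
\<close>

inductive iterated_torus :: "nat list \<Rightarrow> int list \<Rightarrow> link \<Rightarrow> bool" where
  unknot: "iterated_torus [] [] (braid_closure (1, []))"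
| satellite: "iterated_torus ps qs K \<Longrightarrow> is_minimal_index a K \<Longrightarrow> 0 < p
    \<Longrightarrow> iterated_torus (ps @ [p]) (qs @ [q]) (satellite_link a (torus_braid p q))"

lemma inverse_word_positions:
  "position ` set (inverse_word w) = position ` set w"
proof -
  have "position (flip c) = position c" for c
    by (cases c) auto
  then show ?thesis
    by (simp add: inverse_word_def image_image)
qed

lemma is_braid_iff:
  "is_braid (n, w) \<longleftrightarrow> 1 \<le> n \<and> position ` set w \<subseteq> {1..<n}"
  by (auto simp: is_braid_def)

lemma cable_crossing_positions:
  assumes "1 \<le> position c" "position c < k"
  shows "position ` set (cable_crossing p c) \<subseteq> {1..<k * p}"
proof -
  have *: "position ` set (cable_generator p i) \<subseteq> {1..<k * p}" if "1 \<le> i" "i < k" for i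
  proof -
    have "(i - 1) * p + 2 * p = (i + 1) * p"
      using that by (cases i) simp_all
    also have "\<dots> \<le> k * p"
      using that by (intro mult_le_mono1) simp
    finally have "(i - 1) * p + 2 * p \<le> k * p" .
    then show ?thesis
      by (auto simp: cable_generator_def sigma_run_def Let_def)
  qed
  show ?thesis
    using assms * by (cases c) (simp_all add: inverse_word_positions)
qed

lemma is_braid_satellite:
  assumes "is_braid a" and "0 < p"
  shows "is_braid (satellite_braid a (torus_braid p q))"
proof -
  obtain k w where a: "a = (k, w)"
    by fastforce
  have k: "1 \<le> k" and w: "\<And>c. c \<in> set w \<Longrightarrow> 1 \<le> position c \<and> position c < k"
    using assms by (auto simp: a is_braid_def)
  have 1: "position ` set (cable_word p w) \<subseteq> {1..<k * p}"
  proof -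
    have "position ` set (cable_word p w) = (\<Union>c \<in> set w. position ` set (cable_crossing p c))"
      by (auto simp: cable_word_def)
    also have "\<dots> \<subseteq> {1..<k * p}"
      using cable_crossing_positions w by (intro UN_least) simp
    finally show ?thesis .
  qed
  have rep: "position ` set (concat (replicate m v)) \<subseteq> position ` set v" for m and v :: word
    by (induction m) auto
  have "position ` set (power_word v q) \<subseteq> position ` set v" for v
    using rep[of "nat q" v] rep[of "nat (- q)" "inverse_word v"]
    unfolding inverse_word_positions by (cases "0 \<le> q") (simp_all only: power_word_def if_True if_False)
  also have "position ` set (sigma_run 1 (p - 1)) \<subseteq> {1..<p}"
    by (auto simp: sigma_run_def)
  also have "{1..<p} \<subseteq> {1..<k * p}"
  proof -
    have "1 * p \<le> k * p"
      using k by (rule mult_le_mono1)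
    then show ?thesis
      by auto
  qed
  finally have 2: "position ` set (power_word (sigma_run 1 (p - 1)) q) \<subseteq> {1..<k * p}" .
  show ?thesis
    using 1 2 k \<open>0 < p\<close> by (simp add: a torus_braid_def is_braid_iff image_Un)
qed

lemma iterated_torus_closure:
  "iterated_torus ps qs K \<Longrightarrow> \<exists>b. is_braid b \<and> braid_closure b = K"
proof (induction rule: iterated_torus.induct)
  case unknot
  then show ?case
    by (intro exI[of _ "(1, [])"]) (simp add: is_braid_def)
next
  case (satellite ps qs K a p q)
  then show ?case
    by (metis is_braid_satellite is_minimal_index_def satellite_link_def)
qed

lemma minimal_index_exists:
  assumes "is_braid b" and "braid_closure b = K"
  shows "\<exists>a. is_minimal_index a K"
proof -
  let ?P = "\<lambda>b. is_braid b \<and> braid_closure b = K"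
  have "?P (ARG_MIN fst b. ?P b) \<and> (\<forall>c. ?P c \<longrightarrow> fst (ARG_MIN fst b. ?P b) \<le> fst c)"
    using arg_min_nat_lemma[of ?P b fst] assms by blast
  then show ?thesis
    unfolding is_minimal_index_def by blast
qed

lemma iterated_torus_exists:
  assumes "length ps = length qs" and "\<forall>p \<in> set ps. 0 < p"
  shows "\<exists>K. iterated_torus ps qs K"
  using assms
proof (induction ps arbitrary: qs rule: rev_induct)
  case Nil
  then show ?case
    by (auto intro: iterated_torus.unknot)
next
  case (snoc p ps)
  then obtain qs' q where qs: "qs = qs' @ [q]" "length ps = length qs'"
    by (cases qs rule: rev_cases) auto
  have "\<exists>K. iterated_torus ps qs' K"
    using snoc.prems qs by (intro snoc.IH) simp_all
  then obtain K where K: "iterated_torus ps qs' K"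
    by (elim exE)
  obtain b where "is_braid b" "braid_closure b = K"
    using iterated_torus_closure[OF K] by (elim exE conjE)
  then obtain a where a: "is_minimal_index a K"
    using minimal_index_exists by blast
  have "0 < p"
    using snoc.prems by simp
  from iterated_torus.satellite[OF K a this] show ?case
    unfolding qs by (rule exI)
qed


section \<open>The free algebra and the braid action\<close>

instantiation list :: (type) monoid_add
begin

definition zero_list :: "'a list" where
  "zero_list = []"

definition plus_list :: "'a list \<Rightarrow> 'a list \<Rightarrow> 'a list" where
  "plus_list u v = u @ v"

instance
  by standard (simp_all add: zero_list_def plus_list_def)

end

text \<open>
  The free noncommutative unital algebra over the commutative ring \<open>'r\<close> on letters \<open>a i j\<close> is the
  monoid algebra of the free monoid of words in pairs of natural numbers.  The type has letters
  for all pairs; the free algebra on the letters with \<open>1 \<le> i \<noteq> j \<le> n\<close> is the subset \<open>alg n\<close>.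
\<close>

type_synonym 'r free_alg = "(nat \<times> nat) list \<Rightarrow>\<^sub>0 'r"

definition gen :: "nat \<Rightarrow> nat \<Rightarrow> 'r::comm_ring_1 free_alg" where
  "gen i j = Poly_Mapping.single [(i, j)] 1"

definition alg :: "nat \<Rightarrow> 'r::comm_ring_1 free_alg set" where
  "alg n = {x. \<forall>w \<in> Poly_Mapping.keys x. \<forall>(i, j) \<in> set w.
                 i \<noteq> j \<and> 1 \<le> i \<and> i \<le> n \<and> 1 \<le> j \<and> j \<le> n}"

definition subst_alg :: "(nat \<times> nat \<Rightarrow> int free_alg) \<Rightarrow> int free_alg \<Rightarrow> int free_alg" where
  "subst_alg f x = (\<Sum>w \<in> Poly_Mapping.keys x.
     of_int (Poly_Mapping.lookup x w) * prod_list (map f w))"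

text \<open>
  The letters \<open>a i i\<close>, which do not belong to any \<open>alg n\<close>, are fixed.
\<close>

definition phi_letter :: "nat \<Rightarrow> nat \<times> nat \<Rightarrow> int free_alg" where
  "phi_letter k = (\<lambda>(i, j).
     if i = j then gen i j
     else if i = k \<and> j = k + 1 then - gen (k + 1) k
     else if i = k + 1 \<and> j = k then - gen k (k + 1)
     else if i = k + 1 then gen k j
     else if j = k + 1 then gen i k
     else if i = k then gen (k + 1) j - gen (k + 1) k * gen k j
     else if j = k then gen i (k + 1) - gen i k * gen k (k + 1)
     else gen i j)"

text \<open>
  The formulas do not depend on the number of strands, so for a word \<open>w\<close> on \<open>n\<close> strands the map
  \<open>phi w\<close> restricts to the automorphism $\phi_w$ of \<open>alg n\<close> and also to the automorphism
  $\phi^*_w$ of \<open>alg (n + 1)\<close>.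
\<close>

fun phi_crossing :: "crossing \<Rightarrow> int free_alg \<Rightarrow> int free_alg" where
  "phi_crossing (Pos k) = subst_alg (phi_letter k)"
| "phi_crossing (Neg k) = inv_into UNIV (subst_alg (phi_letter k))"

fun phi :: "word \<Rightarrow> int free_alg \<Rightarrow> int free_alg" where
  "phi [] = id"
| "phi (c # w) = phi_crossing c \<circ> phi w"

text \<open>
  Matrices are indexed from \<open>0\<close>, strands from \<open>1\<close>.  The matrices below are uniquely determined by
  the properties that define them.
\<close>

definition PhiL :: "braid \<Rightarrow> int free_alg mat" where
  "PhiL = (\<lambda>(n, w). SOME M. M \<in> carrier_mat n n
     \<and> (\<forall>i<n. \<forall>j<n. M $$ (i, j) \<in> alg n)
     \<and> (\<forall>i<n. phi w (gen (i + 1) (n + 1)) = (\<Sum>j<n. M $$ (i, j) * gen (j + 1) (n + 1))))"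

definition PhiR :: "braid \<Rightarrow> int free_alg mat" where
  "PhiR = (\<lambda>(n, w). SOME M. M \<in> carrier_mat n n
     \<and> (\<forall>i<n. \<forall>j<n. M $$ (i, j) \<in> alg n)
     \<and> (\<forall>i<n. phi w (gen (n + 1) (i + 1)) = (\<Sum>j<n. gen (n + 1) (j + 1) * M $$ (j, i))))"


section \<open>Augmentations and augmentation rank\<close>

text \<open>
  Laurent polynomials in $\lambda$ and $\mu$ are the integral group ring of \<open>int \<times> int\<close>, the pair
  \<open>(a, b)\<close> representing $\lambda^a \mu^b$.  The tensor product of \<open>alg n\<close> with this ring is the free
  algebra \<open>alg n\<close> over Laurent polynomials.
\<close>

type_synonym laurent = "(int \<times> int) \<Rightarrow>\<^sub>0 int"

definition monomial_lm :: "int \<Rightarrow> int \<Rightarrow> laurent free_alg" where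
  "monomial_lm a b = Poly_Mapping.single [] (Poly_Mapping.single (a, b) 1)"

abbreviation mu :: "laurent free_alg" where
  "mu \<equiv> monomial_lm 0 1"

definition extend_scalars :: "int free_alg \<Rightarrow> laurent free_alg" where
  "extend_scalars = Poly_Mapping.map of_int"

definition matA :: "nat \<Rightarrow> laurent free_alg mat" where
  "matA n = mat n n (\<lambda>(i, j).
     if i < j then gen (i + 1) (j + 1)
     else if j < i then - (mu * gen (i + 1) (j + 1))
     else 1 - mu)"

definition Lambda :: "braid \<Rightarrow> laurent free_alg mat" where
  "Lambda = (\<lambda>(n, w). mat n n (\<lambda>(i, j).
     if i \<noteq> j then 0 else if i = 0 then monomial_lm 1 (writhe w) else 1))"

definition Lambda_inverse :: "braid \<Rightarrow> laurent free_alg mat" where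
  "Lambda_inverse = (\<lambda>(n, w). mat n n (\<lambda>(i, j).
     if i \<noteq> j then 0 else if i = 0 then monomial_lm (-1) (- writhe w) else 1))"

definition ring_on :: "'a::ring_1 set \<Rightarrow> 'a ring" where
  "ring_on S = \<lparr>carrier = S, mult = (*), one = 1, zero = 0, add = (+)\<rparr>"

definition knot_ideal :: "braid \<Rightarrow> laurent free_alg set" where
  "knot_ideal b = genideal (ring_on (alg (fst b)))
     (elements_mat (matA (fst b) - Lambda b * map_mat extend_scalars (PhiL b) * matA (fst b))
      \<union> elements_mat (matA (fst b) - matA (fst b) * map_mat extend_scalars (PhiR b) * Lambda_inverse b))"

definition augmentations :: "braid \<Rightarrow> (laurent free_alg \<Rightarrow> complex) set" where
  "augmentations b = {e \<in> Ring.ring_hom (ring_on (alg (fst b))) (ring_on UNIV). \<forall>x \<in> knot_ideal b. e x = 0}"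

definition augmentation_rank :: "braid \<Rightarrow> (laurent free_alg \<Rightarrow> complex) \<Rightarrow> nat" where
  "augmentation_rank b e = vec_space.rank (fst b) (map_mat e (matA (fst b)))"

text \<open>
  The maximum is taken as a supremum in \<open>enat\<close>, over all braids whose closure is \<open>K\<close>, so that it
  makes sense before finiteness and independence of the braid are known.
\<close>

definition ar :: "link \<Rightarrow> enat" where
  "ar K = Sup {enat (augmentation_rank b e) | b e.
     is_braid b \<and> braid_closure b = K \<and> e \<in> augmentations b \<and> e mu \<noteq> 1}"

end

theory Submission
  imports Defs "HOL-Library.Function_Algebras"
begin

text \<open>
  An augmentation of rank \<open>r\<close> amounts to a tuple of complex reflections $t_i = 1 - e_i \otimes f_i$ on
  $\mathbb{C}^r$ whose vectors and covectors span and which the Hurwitz action of the braid preserves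
  up to scalars with prescribed product.  Tuples of this kind are colourings of the braid by a rack
  with twists, and colourability by such racks is a Markov invariant.

  Let \<open>a\<close> be a braid of minimal index with closure $T(n,n+1)$.  A rank \<open>np\<close> augmentation of the
  satellite gives \<open>np\<close> reflections with independent vectors, so \<open>a\<close> has exactly \<open>n\<close> strands.  The torus
  knot has a colouring of rank \<open>n\<close>, and a determinant argument shows that a full rank colouring
  determines the writhe, so the writhe of \<open>a\<close> is $n^2-1$.  Grouping the reflections into blocks of
  length \<open>p\<close> gives a colouring of \<open>a\<close> by the rack of blocks, which can therefore be moved to the
  standard braid $(\sigma_1\cdots\sigma_{n-1})^{n+1}$.

  There the product \<open>D\<close> of all blocks, the product \<open>X\<close> of the first block and \<open>g = DX\<close> satisfy
  $z = g^n = D^{n+1}$, and $y = X^{-(n+1)}z$ rotates the reflections of the first block cyclically.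
  Let \<open>V\<close> be the span of the vectors of the first block.  The whole space is the sum of the
  $D^{-j}V$ for \<open>j < n\<close>, and $D^{-1} = Xg^{-1}$ is in block companion form, which forces
  $z = \pm X^{n+1}$ on \<open>V\<close>.  Hence \<open>y\<close> is a scalar on \<open>V\<close>, but it permutes \<open>p > 1\<close> lines cyclically.
\<close>

section \<open>Rack colourings of braids\<close>

text \<open>The augmentation rank is a supremum over all braids with the given closure, and a braid
  \<open>a\<close> of minimal index is known only up to Markov moves, which pass through other
  indices. What is carried along must survive these moves: besides the existence of a colouring, the
  subracks that contain its colours, from which spans of vectors are recovered on the other side.

  The writhe of \<open>a\<close> matters because a cable follows the blackboard framing: a kink of
  \<open>a\<close> becomes a full twist of \<open>p\<close> strands, that is \<open>p\<close> cyclic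
  shifts of a block. If the writhe agrees with that of the standard braid, the total shift of the
  block colouring remains -1. This -1 comes from the single run in the pattern, hence from the entry
  1 of the second vector, and for \<open>p > 1\<close> a single shift moves the lines of a block.

  Twists of reflections are logarithms of scaling factors, so that they add up; their real parts
  record absolute values and ignore signs, which is what lets a determinant known only up to sign
  determine the writhe.\<close>

definition hurwitz :: "('s \<Rightarrow> 's \<Rightarrow> 's) \<Rightarrow> ('s \<Rightarrow> 's \<Rightarrow> 's) \<Rightarrow> crossing \<Rightarrow> (nat \<Rightarrow> 's) \<Rightarrow> nat \<Rightarrow> 's" where
  "hurwitz f g c s = (case c of
     Pos k \<Rightarrow> s(k := f (s k) (s (k + 1)), k + 1 := s k)
   | Neg k \<Rightarrow> s(k := s (k + 1), k + 1 := g (s (k + 1)) (s k)))"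

definition hurwitz_word :: "('s \<Rightarrow> 's \<Rightarrow> 's) \<Rightarrow> ('s \<Rightarrow> 's \<Rightarrow> 's) \<Rightarrow> word \<Rightarrow> (nat \<Rightarrow> 's) \<Rightarrow> nat \<Rightarrow> 's" where
  "hurwitz_word f g w s = fold (hurwitz f g) w s"

lemma hurwitz_word_Nil [simp]: "hurwitz_word f g [] s = s"
  by (simp add: hurwitz_word_def)

lemma hurwitz_word_Cons [simp]:
  "hurwitz_word f g (c # w) s = hurwitz_word f g w (hurwitz f g c s)"
  by (simp add: hurwitz_word_def)

lemma hurwitz_word_append [simp]:
  "hurwitz_word f g (u @ w) s = hurwitz_word f g w (hurwitz_word f g u s)"
  by (simp add: hurwitz_word_def)

lemma hurwitz_word_outside:
  assumes "position ` set w \<subseteq> {1..<n}" "i \<notin> {1..n}"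
  shows "hurwitz_word f g w s i = s i"
  using assms
proof (induction w arbitrary: s)
  case (Cons c w)
  then show ?case
    by (cases c) (auto simp: hurwitz_def)
qed simp

lemma hurwitz_word_cong:
  assumes "position ` set w \<subseteq> {1..<n}" "\<And>i. i \<in> {1..n} \<Longrightarrow> s i = t i" "i \<in> {1..n}"
  shows "hurwitz_word f g w s i = hurwitz_word f g w t i"
  using assms
proof (induction w arbitrary: s t)
  case (Cons c w)
  have "hurwitz f g c s j = hurwitz f g c t j" if "j \<in> {1..n}" for j
    using Cons.prems that by (cases c) (auto simp: hurwitz_def)
  moreover have "position ` set w \<subseteq> {1..<n}"
    using Cons.prems(1) by simp
  ultimately show ?case
    using Cons.IH Cons.prems(3) unfolding hurwitz_word_Cons by blast
qed simp

lemma hurwitz_word_mem: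
  assumes "position ` set w \<subseteq> {1..<n}" "s ` {1..n} \<subseteq> N"
    and "\<And>x y. x \<in> N \<Longrightarrow> y \<in> N \<Longrightarrow> f x y \<in> N"
    and "\<And>x y. x \<in> N \<Longrightarrow> y \<in> N \<Longrightarrow> g x y \<in> N"
  shows "hurwitz_word f g w s ` {1..n} \<subseteq> N"
  using assms(1,2)
proof (induction w arbitrary: s)
  case (Cons c w)
  have "hurwitz f g c s ` {1..n} \<subseteq> N"
  proof -
    have sN: "s i \<in> N" if "1 \<le> i" "i \<le> n" for i
      using Cons.prems that by auto
    show ?thesis
      using Cons.prems(1) sN assms(3,4) by (cases c) (auto simp: hurwitz_def)
  qed
  then show ?case
    using Cons by simp
qed simp

lemma hurwitz_word_mem_all:
  assumes "\<And>i. s i \<in> N"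
    and "\<And>x y. x \<in> N \<Longrightarrow> y \<in> N \<Longrightarrow> f x y \<in> N"
    and "\<And>x y. x \<in> N \<Longrightarrow> y \<in> N \<Longrightarrow> g x y \<in> N"
  shows "hurwitz_word f g w s i \<in> N"
  using assms(1)
proof (induction w arbitrary: s)
  case (Cons c w)
  have "hurwitz f g c s i \<in> N" for i
    using Cons.prems assms(2,3) by (cases c) (auto simp: hurwitz_def)
  then show ?case
    using Cons.IH by simp
qed simp

text \<open>With trivial operations only positions move, so this describes how labels such as twists
  travel with the strands.\<close>

abbreviation permute :: "word \<Rightarrow> (nat \<Rightarrow> 's) \<Rightarrow> nat \<Rightarrow> 's" where
  "permute \<equiv> hurwitz_word (\<lambda>x y. y) (\<lambda>x y. y)"

lemma sum_permute:
  fixes \<tau> :: "nat \<Rightarrow> 'g::comm_monoid_add"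
  assumes "position ` set w \<subseteq> {1..<n}"
  shows "sum (permute w \<tau>) {1..n} = sum \<tau> {1..n}"
  using assms
proof (induction w arbitrary: \<tau>)
  case (Cons c w)
  let ?k = "position c"
  have h: "hurwitz (\<lambda>x y. y) (\<lambda>x y. y) c \<tau> = \<tau> \<circ> transpose ?k (?k + 1)"
    by (cases c) (auto simp: hurwitz_def fun_eq_iff transpose_def)
  have "bij_betw (transpose ?k (?k + 1)) {1..n} {1..n}"
    using Cons.prems by (intro bij_betw_byWitness[of _ "transpose ?k (?k + 1)"])
      (auto simp: transpose_def)
  then have "sum (\<tau> \<circ> transpose ?k (?k + 1)) {1..n} = sum \<tau> {1..n}"
    using sum.reindex_bij_betw[of "transpose ?k (?k + 1)" "{1..n}" "{1..n}" \<tau>] by (simp add: o_def)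
  then show ?case
    using Cons h by simp
qed simp

lemma writhe_append [simp]: "writhe (u @ w) = writhe u + writhe w"
  by (simp add: writhe_def)

lemma writhe_inverse_word [simp]: "writhe (inverse_word w) = - writhe w"
proof -
  have "crossing_sign (flip c) = - crossing_sign c" for c
    by (cases c) auto
  then have "writhe (map flip w) = - writhe w"
    by (induction w) (simp_all add: writhe_def)
  then show ?thesis
    by (simp add: inverse_word_def writhe_def rev_map[symmetric] del: map_map)
qed

lemma writhe_artin: "artin_relation l r \<Longrightarrow> writhe l = writhe r"
  by (induction rule: artin_relation.induct) (simp_all add: writhe_def)

text \<open>
  \<open>tw \<theta>\<close> is the twist created by a kink.  The twists of a colouring are spread over all positions and
  only their total is prescribed, so that no base point has to be moved along the closure and
  connectedness of the closure plays no role.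
\<close>

locale twisted_rack =
  fixes S :: "'s set"
    and op :: "'s \<Rightarrow> 's \<Rightarrow> 's"
    and opi :: "'s \<Rightarrow> 's \<Rightarrow> 's"
    and tw :: "'g::comm_ring_1 \<Rightarrow> 's \<Rightarrow> 's"
    and \<theta> :: 'g
  assumes op_closed: "x \<in> S \<Longrightarrow> y \<in> S \<Longrightarrow> op x y \<in> S"
    and opi_closed: "x \<in> S \<Longrightarrow> y \<in> S \<Longrightarrow> opi x y \<in> S"
    and tw_closed: "x \<in> S \<Longrightarrow> tw a x \<in> S"
    and op_opi: "x \<in> S \<Longrightarrow> y \<in> S \<Longrightarrow> op x (opi x y) = y"
    and opi_op: "x \<in> S \<Longrightarrow> y \<in> S \<Longrightarrow> opi x (op x y) = y"
    and op_op: "x \<in> S \<Longrightarrow> y \<in> S \<Longrightarrow> z \<in> S \<Longrightarrow> op x (op y z) = op (op x y) (op x z)"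
    and tw_zero: "x \<in> S \<Longrightarrow> tw 0 x = x"
    and tw_add: "x \<in> S \<Longrightarrow> tw (a + b) x = tw a (tw b x)"
    and op_tw_left: "x \<in> S \<Longrightarrow> y \<in> S \<Longrightarrow> op (tw a x) y = op x y"
    and op_tw_right: "x \<in> S \<Longrightarrow> y \<in> S \<Longrightarrow> op x (tw a y) = tw a (op x y)"
    and op_self: "x \<in> S \<Longrightarrow> op x x = tw \<theta> x"
begin

abbreviation act :: "word \<Rightarrow> (nat \<Rightarrow> 's) \<Rightarrow> nat \<Rightarrow> 's" where
  "act \<equiv> hurwitz_word op opi"

definition subrack :: "'s set \<Rightarrow> bool" where
  "subrack N \<longleftrightarrow> N \<subseteq> S \<and> (\<forall>x\<in>N. \<forall>y\<in>N. op x y \<in> N \<and> opi x y \<in> N) \<and> (\<forall>x\<in>N. \<forall>a. tw a x \<in> N)"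

text \<open>The number \<open>\<kappa>\<close> is the total twist with the contribution of the kinks
  removed, which is the part preserved by stabilization. Positions beyond the braid must also carry
  elements of \<open>S\<close>, so that rack identities hold as equations between functions.\<close>

definition colouring :: "braid \<Rightarrow> 'g \<Rightarrow> (nat \<Rightarrow> 's) \<Rightarrow> (nat \<Rightarrow> 'g) \<Rightarrow> bool" where
  "colouring b \<kappa> s \<tau> \<longleftrightarrow> (\<forall>i. s i \<in> S)
     \<and> (\<forall>i\<in>{1..fst b}. act (snd b) s i = tw (\<tau> i) (s i))
     \<and> sum \<tau> {1..fst b} = \<kappa> + of_int (writhe (snd b)) * \<theta>"

text \<open>The predicate \<open>F\<close> encodes the subrack generated by the colours. Unlike the
  colours, it can be compared between braids of different index.\<close>

definition colourable :: "braid \<Rightarrow> 'g \<Rightarrow> ('s set \<Rightarrow> bool) \<Rightarrow> bool" where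
  "colourable b \<kappa> F \<longleftrightarrow> (\<exists>s \<tau>. colouring b \<kappa> s \<tau>
     \<and> (\<forall>N. subrack N \<longrightarrow> (s ` {1..fst b} \<subseteq> N \<longleftrightarrow> F N)))"

lemma tw_cancel: "x \<in> S \<Longrightarrow> tw a x = y \<Longrightarrow> x = tw (- a) y"
  using tw_add[of x "- a" a] by (auto simp: tw_zero)

lemma opi_tw_left: "x \<in> S \<Longrightarrow> y \<in> S \<Longrightarrow> opi (tw a x) y = opi x y"
  by (metis op_opi op_tw_left opi_closed opi_op tw_closed)

lemma opi_tw_right: "x \<in> S \<Longrightarrow> y \<in> S \<Longrightarrow> opi x (tw a y) = tw a (opi x y)"
  by (metis op_opi op_tw_right opi_closed opi_op tw_closed)

lemma opi_self: "x \<in> S \<Longrightarrow> opi x x = tw (- \<theta>) x"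
  by (metis op_self opi_closed op_opi op_tw_right opi_op tw_cancel tw_closed)

lemma act_in: "(\<And>i. s i \<in> S) \<Longrightarrow> act w s i \<in> S"
  by (rule hurwitz_word_mem_all) (auto intro: op_closed opi_closed)

lemma act_flip:
  assumes "\<And>i. s i \<in> S"
  shows "hurwitz op opi (flip c) (hurwitz op opi c s) = s"
  using assms by (cases c) (auto simp: hurwitz_def fun_eq_iff op_opi opi_op)

lemma hurwitz_in: "(\<And>i. s i \<in> S) \<Longrightarrow> hurwitz op opi c s i \<in> S"
  using act_in[of s "[c]"] by simp

lemma act_inverse:
  assumes "\<And>i. s i \<in> S"
  shows "act (inverse_word w) (act w s) = s"
  using assms
proof (induction w arbitrary: s)
  case (Cons c w)
  then show ?case
    by (simp add: inverse_word_def act_flip hurwitz_in)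
qed (simp add: inverse_word_def)

lemma inverse_inverse_word: "inverse_word (inverse_word w) = w"
proof -
  have "flip (flip c) = c" for c
    by (cases c) auto
  then show ?thesis
    by (simp add: inverse_word_def rev_map o_def)
qed

lemma act_inverse':
  "(\<And>i. s i \<in> S) \<Longrightarrow> act w (act (inverse_word w) s) = s"
  using act_inverse[of s "inverse_word w"] by (simp add: inverse_inverse_word)

text \<open>A twist of the acting strand has no effect and a twist of the other strand commutes with
  the operation, so twists are merely carried along.\<close>

lemma act_tw:
  assumes "\<And>i. s i \<in> S"
  shows "act w (\<lambda>i. tw (\<tau> i) (s i)) = (\<lambda>i. tw (permute w \<tau> i) (act w s i))"
  using assms
proof (induction w arbitrary: s \<tau>)
  case (Cons c w)
  have "hurwitz op opi c (\<lambda>i. tw (\<tau> i) (s i))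
      = (\<lambda>i. tw (hurwitz (\<lambda>x y. y) (\<lambda>x y. y) c \<tau> i) (hurwitz op opi c s i))"
    using Cons.prems
    by (cases c) (auto simp: hurwitz_def fun_eq_iff op_tw_left op_tw_right opi_tw_left opi_tw_right
        op_closed opi_closed tw_closed)
  then show ?case
    using Cons hurwitz_in by simp
qed simp

lemma act_artin:
  assumes "artin_relation l r" "\<And>i. s i \<in> S"
  shows "act l s = act r s"
  using assms
proof (induction rule: artin_relation.induct)
  case (1 i)
  then show ?case
    by (auto simp: hurwitz_def fun_eq_iff op_opi opi_op)
next
  case (2 i)
  then show ?case
    by (auto simp: hurwitz_def fun_eq_iff op_opi opi_op)
next
  case (3 i j)
  then show ?case
    by (auto simp: hurwitz_def fun_eq_iff)
next
  case (4 i)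
  then show ?case
    by (auto simp: hurwitz_def fun_eq_iff op_op)
qed

lemma subrack_act:
  assumes "subrack N" "position ` set w \<subseteq> {1..<n}" "\<And>i. s i \<in> S"
  shows "act w s ` {1..n} \<subseteq> N \<longleftrightarrow> s ` {1..n} \<subseteq> N"
proof
  have N: "\<And>x y. x \<in> N \<Longrightarrow> y \<in> N \<Longrightarrow> op x y \<in> N" "\<And>x y. x \<in> N \<Longrightarrow> y \<in> N \<Longrightarrow> opi x y \<in> N"
    using assms(1) by (auto simp: subrack_def)
  show "act w s ` {1..n} \<subseteq> N" if "s ` {1..n} \<subseteq> N"
    using hurwitz_word_mem[OF assms(2) that N] .
  show "s ` {1..n} \<subseteq> N" if "act w s ` {1..n} \<subseteq> N"
    using hurwitz_word_mem[OF _ that, of "inverse_word w" op opi] N act_inverse[of s w] assms(2,3)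
    by (simp add: inverse_word_positions)
qed

lemma colouring_transfer:
  assumes "colouring (n, v) \<kappa> s \<tau>" "is_braid (n, u)" "is_braid (n, v)" "is_braid (n, v')"
    and "act v' (act u s) = act u (act v s)" "writhe v' = writhe v"
  shows "colouring (n, v') \<kappa> (act u s) (permute u \<tau>)"
proof -
  have s: "\<And>i. s i \<in> S" and eq: "\<And>i. i \<in> {1..n} \<Longrightarrow> act v s i = tw (\<tau> i) (s i)"
    using assms(1) by (auto simp: colouring_def)
  have u: "position ` set u \<subseteq> {1..<n}"
    using assms(2) by (simp add: is_braid_iff)
  have "act v' (act u s) i = tw (permute u \<tau> i) (act u s i)" if "i \<in> {1..n}" for i
  proof -
    have "act v' (act u s) i = act u (\<lambda>i. tw (\<tau> i) (s i)) i"
      unfolding assms(5) by (rule hurwitz_word_cong[OF u eq that])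
    then show ?thesis
      by (simp add: act_tw s)
  qed
  then show ?thesis
    using assms(1,6) sum_permute[OF u, of \<tau>] by (auto simp: colouring_def act_in)
qed

text \<open>Both directions of conjugation are instances. The twists are only permuted by
  \<open>u\<close>, which keeps their sum.\<close>

lemma colourable_transfer:
  assumes "colourable (n, v) \<kappa> F" "is_braid (n, u)" "is_braid (n, v)" "is_braid (n, v')"
    and "\<And>s. (\<And>i. s i \<in> S) \<Longrightarrow> act v' (act u s) = act u (act v s)" "writhe v' = writhe v"
  shows "colourable (n, v') \<kappa> F"
proof -
  obtain s \<tau> where s: "colouring (n, v) \<kappa> s \<tau>" and F: "\<And>N. subrack N \<Longrightarrow> s ` {1..n} \<subseteq> N \<longleftrightarrow> F N"
    using assms(1) by (auto simp: colourable_def)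
  have sS: "\<And>i. s i \<in> S"
    using s by (auto simp: colouring_def)
  have "colouring (n, v') \<kappa> (act u s) (permute u \<tau>)"
    by (rule colouring_transfer[OF s assms(2-4) assms(5) assms(6)]) (rule sS)
  moreover have "act u s ` {1..n} \<subseteq> N \<longleftrightarrow> F N" if "subrack N" for N
    using subrack_act[OF that _ sS] F[OF that] assms(2) by (simp add: is_braid_iff)
  ultimately show ?thesis
    unfolding colourable_def by (metis fst_conv)
qed

lemma colourable_relation:
  assumes "artin_relation l r" 
  shows "colourable (n, x @ l @ y) \<kappa> F \<longleftrightarrow> colourable (n, x @ r @ y) \<kappa> F"
proof -
  have "colouring (n, x @ l @ y) \<kappa> s \<tau> \<longleftrightarrow> colouring (n, x @ r @ y) \<kappa> s \<tau>" for s \<tau>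
    using act_artin[OF assms, of "act x s"] writhe_artin[OF assms]
    by (auto simp: colouring_def act_in)
  then show ?thesis
    by (simp add: colourable_def)
qed

lemma is_braid_inverse: "is_braid (n, inverse_word u) \<longleftrightarrow> is_braid (n, u)"
  by (simp add: is_braid_iff inverse_word_positions)

lemma colourable_conjugation:
  assumes "is_braid (n, w)" "is_braid (n, u)"
  shows "colourable (n, w) \<kappa> F \<longleftrightarrow> colourable (n, u @ w @ inverse_word u) \<kappa> F"
proof -
  have b: "is_braid (n, u @ w @ inverse_word u)"
    using assms by (auto simp: is_braid_iff inverse_word_positions image_Un)
  show ?thesis
  proof
    assume "colourable (n, w) \<kappa> F"
    then show "colourable (n, u @ w @ inverse_word u) \<kappa> F"
      by (rule colourable_transfer[of _ _ _ _ "inverse_word u"])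
        (use assms b in \<open>simp_all add: is_braid_inverse act_inverse' act_in\<close>)
  next
    assume "colourable (n, u @ w @ inverse_word u) \<kappa> F"
    then show "colourable (n, w) \<kappa> F"
      by (rule colourable_transfer[of _ _ _ _ u])
        (use assms b in \<open>simp_all add: act_inverse' act_in\<close>)
  qed
qed

lemma subrack_insert_tw:
  fixes s :: "nat \<Rightarrow> 's"
  assumes "subrack N" "\<And>i. s i \<in> S" "1 \<le> n"
  shows "(s(Suc n := tw a (s n))) ` {1..Suc n} \<subseteq> N \<longleftrightarrow> s ` {1..n} \<subseteq> N"
proof -
  have "{1..Suc n} = insert (Suc n) {1..n}"
    by auto
  moreover have "tw a (s n) \<in> N" if "s n \<in> N"
    using that assms(1) by (auto simp: subrack_def)
  ultimately show ?thesis
    using assms(3) by (auto simp: image_subset_iff)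
qed

lemma subrack_split_last:
  assumes "subrack N" "\<And>i. s i \<in> S" "s (Suc n) = tw a (s n)" "1 \<le> n"
  shows "s ` {1..Suc n} \<subseteq> N \<longleftrightarrow> s ` {1..n} \<subseteq> N"
proof -
  have "s(Suc n := tw a (s n)) = s"
    by (simp add: assms(3)[symmetric])
  then show ?thesis
    using subrack_insert_tw[where s = s and a = a, OF assms(1,2,4)] by simp
qed

text \<open>Closing the kink forces the new strand to carry a twist of the colour of strand
  \<open>n\<close>, so the generated subrack is unchanged; the self-crossing contributes
  \<open>\<theta>\<close> with the sign of the crossing, which is the change of the writhe
  term.\<close>

lemma colourable_stabilize:
  assumes w: "is_braid (n, w)" and c: "c = Pos n \<or> c = Neg n"
  shows "colourable (n, w) \<kappa> F \<longleftrightarrow> colourable (n + 1, w @ [c]) \<kappa> F"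
proof
  have n: "1 \<le> n" and pos: "position ` set w \<subseteq> {1..<n}"
    using w by (auto simp: is_braid_iff)
  have wr: "of_int (writhe (w @ [c])) * \<theta> = of_int (writhe w) * \<theta> + of_int (crossing_sign c) * \<theta>"
    by (simp add: writhe_def algebra_simps)
  have set_n: "{1..Suc n} = insert (Suc n) {1..n}" "{1..n} = insert n {1..<n}"
    using n by auto
  {
    assume "colourable (n, w) \<kappa> F"
    then obtain s \<tau> where s: "colouring (n, w) \<kappa> s \<tau>"
      and F: "\<And>N. subrack N \<Longrightarrow> s ` {1..n} \<subseteq> N \<longleftrightarrow> F N"
      by (auto simp: colourable_def)
    have sS: "\<And>i. s i \<in> S" and eq: "\<And>i. i \<in> {1..n} \<Longrightarrow> act w s i = tw (\<tau> i) (s i)"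
      and sum: "sum \<tau> {1..n} = \<kappa> + of_int (writhe w) * \<theta>"
      using s by (auto simp: colouring_def)
    \<comment> \<open>The colour of the new strand is chosen such that this strand closes up with
      twist 0; the whole kink is charged to strand \<open>n\<close>.\<close>
    define a where "a = (if c = Pos n then \<tau> n else \<tau> n - \<theta>)"
    define s' where "s' = s(Suc n := tw a (s n))"
    define \<tau>' where "\<tau>' = (if c = Pos n then \<tau>(Suc n := 0, n := \<tau> n + \<theta>) else \<tau>(Suc n := 0, n := \<tau> n - \<theta>))"
    have s'S: "\<And>i. s' i \<in> S"
      using sS by (simp add: s'_def tw_closed)
    have act1: "act w s' i = (if i = Suc n then tw a (s n) else tw (\<tau> i) (s i))" if "i \<in> {1..Suc n}" for i
    proof (cases "i = Suc n")
      case True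
      then show ?thesis
        using hurwitz_word_outside[OF pos, of "Suc n" op opi s'] by (simp add: s'_def)
    next
      case False
      then have "i \<in> {1..n}"
        using that by auto
      then show ?thesis
        using hurwitz_word_cong[OF pos, of s' s i] eq False by (simp add: s'_def)
    qed
    have "act (w @ [c]) s' i = tw (\<tau>' i) (s' i)" if i: "i \<in> {1..Suc n}" for i
    proof -
      have *: "act w s' n = tw (\<tau> n) (s n)" "act w s' (Suc n) = tw a (s n)"
        using act1[of n] act1[of "Suc n"] n by auto
      consider "i = n" | "i = Suc n" | "i \<in> {1..<n}" "i \<noteq> n" "i \<noteq> Suc n"
        using i by fastforce
      then show ?thesis
      proof cases
        case 1
        show ?thesis
        proof (cases "c = Pos n")
          case True
          have "op (tw (\<tau> n) (s n)) (tw (\<tau> n) (s n)) = tw (\<tau> n + \<theta>) (s n)"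
            using sS by (simp add: op_self tw_closed tw_add[symmetric] add.commute)
          then show ?thesis
            using True 1 * by (simp add: hurwitz_def a_def s'_def \<tau>'_def)
        next
          case False
          then show ?thesis
            using c 1 * by (simp add: hurwitz_def a_def s'_def \<tau>'_def)
        qed
      next
        case 2
        show ?thesis
        proof (cases "c = Pos n")
          case True
          then show ?thesis
            using 2 * sS by (simp add: hurwitz_def a_def s'_def \<tau>'_def tw_zero tw_closed)
        next
          case False
          have "opi (tw (\<tau> n - \<theta>) (s n)) (tw (\<tau> n) (s n)) = tw (\<tau> n - \<theta>) (s n)"
            using sS by (simp add: opi_self opi_tw_left opi_tw_right tw_closed tw_add[symmetric])
          then show ?thesis
            using False c 2 * sS by (simp add: hurwitz_def a_def s'_def \<tau>'_def tw_zero tw_closed)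
        qed
      next
        case 3
        then show ?thesis
          using c act1[of i] by (auto simp: hurwitz_def s'_def \<tau>'_def)
      qed
    qed
    moreover have "sum \<tau>' {1..Suc n} = \<kappa> + of_int (writhe (w @ [c])) * \<theta>"
    proof -
      have "sum \<tau>' {1..Suc n} = \<tau>' (Suc n) + (\<tau>' n + sum \<tau>' {1..<n})"
        unfolding set_n by simp
      also have "sum \<tau>' {1..<n} = sum \<tau> {1..<n}"
        by (intro sum.cong) (auto simp: \<tau>'_def)
      also have "\<tau>' (Suc n) + (\<tau>' n + sum \<tau> {1..<n}) = sum \<tau> {1..n} + of_int (crossing_sign c) * \<theta>"
        using c unfolding set_n(2) by (auto simp: \<tau>'_def algebra_simps)
      finally show ?thesis
        unfolding wr sum by (simp only: add.assoc)
    qed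
    ultimately have "colouring (n + 1, w @ [c]) \<kappa> s' \<tau>'"
      using s'S by (simp add: colouring_def)
    moreover have "s' ` {1..Suc n} \<subseteq> N \<longleftrightarrow> F N" if "subrack N" for N
      using subrack_insert_tw[where s = s and a = a, OF that sS n] F[OF that] by (simp add: s'_def)
    ultimately show "colourable (n + 1, w @ [c]) \<kappa> F"
      unfolding colourable_def by (metis Suc_eq_plus1 fst_conv)
  }
  {
    assume "colourable (n + 1, w @ [c]) \<kappa> F"
    then obtain s \<tau> where s: "colouring (n + 1, w @ [c]) \<kappa> s \<tau>"
      and F: "\<And>N. subrack N \<Longrightarrow> s ` {1..Suc n} \<subseteq> N \<longleftrightarrow> F N"
      by (auto simp: colourable_def)
    have sS: "\<And>i. s i \<in> S" and eq: "\<And>i. i \<in> {1..Suc n} \<Longrightarrow> act (w @ [c]) s i = tw (\<tau> i) (s i)"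
      and sum: "sum \<tau> {1..Suc n} = \<kappa> + of_int (writhe (w @ [c])) * \<theta>"
      using s by (auto simp: colouring_def)
    define x where "x = act w s n"
    have x: "x \<in> S"
      using sS by (simp add: x_def act_in)
    \<comment> \<open>Removing strand \<open>n + 1\<close> merges its twist with that of strand
      \<open>n\<close> and takes away the kink.\<close>
    define a where "a = \<tau> n + \<tau> (Suc n) - of_int (crossing_sign c) * \<theta>"
    have last: "act w s (Suc n) = s (Suc n)"
      using hurwitz_word_outside[OF pos, of "Suc n"] by simp
    have x_eq: "x = tw a (s n) \<and> (\<exists>b. s (Suc n) = tw b (s n))"
    proof (cases "c = Pos n")
      case True
      have 1: "op x (s (Suc n)) = tw (\<tau> n) (s n)" "x = tw (\<tau> (Suc n)) (s (Suc n))"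
        using eq[of n] eq[of "Suc n"] n True last by (simp_all add: hurwitz_def x_def)
      then have "tw \<theta> (s (Suc n)) = tw (\<tau> n) (s n)"
        using op_self[OF sS, of "Suc n"] op_tw_left[OF sS sS, of "\<tau> (Suc n)" "Suc n" "Suc n"] by simp
      from tw_cancel[OF sS this] have 2: "s (Suc n) = tw (- \<theta> + \<tau> n) (s n)"
        by (simp only: tw_add[OF sS])
      have "a = \<tau> (Suc n) + (- \<theta> + \<tau> n)"
        using True by (simp add: a_def)
      then have "x = tw a (s n)"
        using 1(2) 2 by (simp only: tw_add[OF sS])
      then show ?thesis
        using 2 by blast
    next
      case False
      have 1: "s (Suc n) = tw (\<tau> n) (s n)" "opi (s (Suc n)) x = tw (\<tau> (Suc n)) (s (Suc n))"
        using eq[of n] eq[of "Suc n"] n False last c by (auto simp add: hurwitz_def x_def)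
      have "x = op (s (Suc n)) (tw (\<tau> (Suc n)) (s (Suc n)))"
        by (simp only: op_opi[OF sS x] 1(2)[symmetric])
      also have "\<dots> = tw (\<tau> (Suc n)) (tw \<theta> (tw (\<tau> n) (s n)))"
        using sS by (simp add: op_tw_right op_self 1(1)[symmetric])
      also have "\<dots> = tw a (s n)"
      proof -
        have "a = \<tau> (Suc n) + (\<theta> + \<tau> n)"
          using c False by (auto simp: a_def)
        then show ?thesis
          by (simp only: tw_add[OF sS])
      qed
      finally show ?thesis
        using 1(1) by blast
    qed
    define \<tau>' where "\<tau>' = \<tau>(n := a)"
    have "act w s i = tw (\<tau>' i) (s i)" if "i \<in> {1..n}" for i
    proof (cases "i = n")
      case True
      then show ?thesis
        using x_eq by (simp add: \<tau>'_def x_def)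
    next
      case False
      then show ?thesis
        using that eq[of i] c by (auto simp: \<tau>'_def hurwitz_def)
    qed
    moreover have "sum \<tau>' {1..n} = \<kappa> + of_int (writhe w) * \<theta>"
    proof -
      have "sum \<tau>' {1..n} = a + sum \<tau> {1..<n}"
        unfolding set_n(2) by (simp add: \<tau>'_def)
      moreover have "sum \<tau> {1..Suc n} = \<tau> (Suc n) + (\<tau> n + sum \<tau> {1..<n})"
        unfolding set_n by simp
      ultimately show ?thesis
        using sum unfolding wr by (simp add: a_def algebra_simps)
    qed
    ultimately have "colouring (n, w) \<kappa> s \<tau>'"
      using sS by (simp add: colouring_def)
    moreover have "s ` {1..n} \<subseteq> N \<longleftrightarrow> F N" if "subrack N" for N
    proof -
      obtain b where "s (Suc n) = tw b (s n)"
        using x_eq by blast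
      then show ?thesis
        using subrack_split_last[where s = s and a = b, OF that sS _ n] F[OF that] by simp
    qed
    ultimately show "colourable (n, w) \<kappa> F"
      unfolding colourable_def by (metis fst_conv)
  }
qed

theorem colourable_markov:
  assumes "equivclp markov_move b c"
  shows "colourable b \<kappa> F \<longleftrightarrow> colourable c \<kappa> F"
proof -
  have "colourable b \<kappa> F \<longleftrightarrow> colourable c \<kappa> F" if "markov_move b c" for b c
    using that
  proof cases
    case (relation l r n u v)
    then show ?thesis
      using colourable_relation by simp
  next
    case (conjugation n w u)
    then show ?thesis
      using colourable_conjugation[of n w u] by simp
  qed (use colourable_stabilize in auto)
  with assms show ?thesis
    by (induction rule: equivclp_induct) auto
qed

end

section \<open>Conjugation racks and blocks\<close>

definition group_conj :: "'g::group_add \<Rightarrow> 'g \<Rightarrow> 'g" where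
  "group_conj x y = x + y - x"

lemma group_conj_zero [simp]: "group_conj 0 y = y"
  by (simp add: group_conj_def)

lemma group_conj_add: "group_conj (x + y) z = group_conj x (group_conj y z)"
  by (simp add: group_conj_def add.assoc minus_add diff_conv_add_uminus del: add_uminus_conv_diff)

lemma group_conj_plus: "group_conj x (y + z) = group_conj x y + group_conj x z"
  by (simp add: group_conj_def add.assoc minus_add diff_conv_add_uminus del: add_uminus_conv_diff)

lemma group_conj_self [simp]: "group_conj x x = x"
  by (simp add: group_conj_def add.assoc minus_add diff_conv_add_uminus del: add_uminus_conv_diff)

lemma group_conj_uminus_cancel [simp]: "group_conj x (group_conj (- x) y) = y" "group_conj (- x) (group_conj x y) = y"
  by (simp_all flip: group_conj_add)

lemma group_conj_comp_cancel [simp]: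
  "group_conj x \<circ> group_conj (- x) = id" "group_conj (- x) \<circ> group_conj x = id"
  by (simp_all add: fun_eq_iff)

lemma map_group_conj_zero [simp]: "map (group_conj 0) xs = xs"
  by (rule map_idI) simp

lemma group_conj_conj: "group_conj (group_conj x y) (group_conj x z) = group_conj x (group_conj y z)"
  by (simp add: group_conj_def add.assoc minus_add diff_conv_add_uminus del: add_uminus_conv_diff)

lemma group_conj_add_self: "group_conj x y + x = x + y"
  by (simp add: group_conj_def)

lemma sum_list_map_group_conj: "sum_list (map (group_conj x) ys) = group_conj x (sum_list ys)"
  by (induction ys) (simp_all add: group_conj_plus, simp add: group_conj_def)

lemma map_group_conj_map_group_conj: "map (group_conj x) (map (group_conj y) zs) = map (group_conj (x + y)) zs"
  by (simp add: group_conj_add o_def)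

section \<open>Integer powers of a bijection\<close>

definition ipow :: "('a \<Rightarrow> 'a) \<Rightarrow> int \<Rightarrow> 'a \<Rightarrow> 'a" where
  "ipow f k = (if 0 \<le> k then f ^^ nat k else inv_into UNIV f ^^ nat (- k))"

lemma ipow_zero [simp]: "ipow f 0 = id"
  by (simp add: ipow_def)

lemma ipow_one [simp]: "ipow f 1 = f"
  by (simp add: ipow_def)

lemma ipow_of_nat: "ipow f (int k) = f ^^ k"
  by (simp add: ipow_def)

lemma ipow_step:
  assumes "bij f"
  shows "ipow f (k + 1) x = f (ipow f k x)"
proof -
  have f: "f (inv_into UNIV f y) = y" for y
    using assms by (simp add: bij_is_surj surj_f_inv_f)
  consider "0 \<le> k" | "k = -1" | "k < -1"
    by linarith
  then show ?thesis
  proof cases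
    case 3
    then have "nat (- k) = Suc (nat (- (k + 1)))"
      by simp
    then show ?thesis
      using 3 f by (simp add: ipow_def)
  qed (simp_all add: ipow_def f nat_add_distrib)
qed

lemma ipow_add:
  assumes "bij f"
  shows "ipow f (a + b) x = ipow f a (ipow f b x)"
proof (induction a rule: int_induct[where k = 0])
  case (step1 i)
  then show ?case
    using ipow_step[OF assms, of "i + b" x] ipow_step[OF assms, of i] by (simp add: add_ac)
next
  case (step2 i)
  have "f (ipow f (i - 1 + b) x) = f (ipow f (i - 1) (ipow f b x))"
    using step2 ipow_step[OF assms, of "i - 1 + b" x] ipow_step[OF assms, of "i - 1" "ipow f b x"]
    by (simp add: algebra_simps)
  then show ?case
    using assms by (simp add: bij_is_inj inj_eq)
qed simp

lemma ipow_invariant: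
  assumes "bij f" "\<And>x. P (f x) \<longleftrightarrow> P x"
  shows "P (ipow f k x) \<longleftrightarrow> P x"
proof (induction k rule: int_induct[where k = 0])
  case (step1 i)
  then show ?case
    using assms ipow_step by metis
next
  case (step2 i)
  then show ?case
    using assms ipow_step[OF assms(1), of "i - 1" x] by simp
qed simp

lemma ipow_commute:
  assumes "bij f" "\<And>x. f (g x) = g (f x)"
  shows "ipow f k (g x) = g (ipow f k x)"
proof (induction k rule: int_induct[where k = 0])
  case (step1 i)
  then show ?case
    using assms by (simp add: ipow_step)
next
  case (step2 i)
  have "f (ipow f (i - 1) (g x)) = f (g (ipow f (i - 1) x))"
    using step2 ipow_step[OF assms(1), of "i - 1"] assms(2) by simp
  then show ?case
    using assms(1) by (simp add: bij_is_inj inj_eq)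
qed simp

text \<open>This is the Hurwitz action of \<open>sigma_run 1 (p - 1)\<close> on a tuple of length
  \<open>p\<close>: the first entry passes over all the others.\<close>

definition shift :: "'g::group_add list \<Rightarrow> 'g list" where
  "shift xs = (case xs of [] \<Rightarrow> [] | x # ys \<Rightarrow> map (group_conj x) ys @ [x])"

lemma shift_simps [simp]: "shift [] = []" "shift (x # xs) = map (group_conj x) xs @ [x]"
  by (simp_all add: shift_def)

lemma length_shift [simp]: "length (shift xs) = length xs"
  by (cases xs) simp_all

lemma sum_list_shift [simp]: "sum_list (shift xs) = sum_list xs"
  by (cases xs) (simp_all add: sum_list_map_group_conj group_conj_add_self)

lemma shift_map_group_conj: "shift (map (group_conj x) xs) = map (group_conj x) (shift xs)"
  by (cases xs) (simp_all add: group_conj_conj)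

lemma bij_shift: "bij shift"
proof (rule o_bij)
  let ?g = "\<lambda>xs. if xs = [] then [] else last xs # map (group_conj (- last xs)) (butlast xs)"
  show "?g \<circ> shift = id"
    by (rule ext, rename_tac xs, case_tac xs) (simp_all add: o_def)
  show "shift \<circ> ?g = id"
    by (auto simp: fun_eq_iff o_def)
qed

lemma shift_ipow_cancel [simp]:
  "shift (ipow shift (- 1) xs) = xs" "ipow shift (- 1) (shift xs) = xs"
  using ipow_add[OF bij_shift, of 1 "- 1" xs] ipow_add[OF bij_shift, of "- 1" 1 xs] by simp_all

text \<open>An entry moved to the end is not conjugated by itself, but conjugation by itself is
  trivial; this makes one conjugating element serve for the whole tuple.\<close>

lemma shift_funpow:
  assumes "j \<le> length xs"
  shows "(shift ^^ j) xs = map (group_conj (sum_list (take j xs))) (drop j xs @ take j xs)"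
  using assms
proof (induction j)
  case (Suc j)
  then have j: "j < length xs"
    by simp
  let ?P = "sum_list (take j xs)"
  have "take (Suc j) xs = take j xs @ [xs ! j]" "drop j xs = xs ! j # drop (Suc j) xs"
    using j by (simp_all add: take_Suc_conv_app_nth Cons_nth_drop_Suc)
  then show ?case
    using Suc.IH j by (simp add: group_conj_add group_conj_conj)
qed simp

lemma shift_funpow_length: "(shift ^^ length xs) xs = map (group_conj (sum_list xs)) xs"
  by (simp add: shift_funpow)

definition block_op :: "'g::group_add list \<Rightarrow> 'g list \<Rightarrow> 'g list" where
  "block_op xs ys = map (group_conj (sum_list xs)) ys"

definition block_opi :: "'g::group_add list \<Rightarrow> 'g list \<Rightarrow> 'g list" where
  "block_opi xs ys = map (group_conj (- sum_list xs)) ys"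

lemma length_ipow_shift: "length (ipow shift k xs) = length xs"
  using ipow_invariant[of shift "\<lambda>ys. length ys = length xs" k xs] bij_shift by simp

lemma sum_list_ipow_shift: "sum_list (ipow shift k xs) = sum_list xs"
  using ipow_invariant[of shift "\<lambda>ys. sum_list ys = sum_list xs" k xs] bij_shift by simp

lemma ipow_shift_map_group_conj: "ipow shift k (map (group_conj x) xs) = map (group_conj x) (ipow shift k xs)"
  by (rule ipow_commute[OF bij_shift]) (simp add: shift_map_group_conj)

text \<open>A full turn of the shift is conjugation by the product of the block, so a block crossing
  itself amounts to \<open>p\<close> shifts. This is the origin of
  \<open>\<theta> = p\<close>.\<close>

lemma block_rack:
  "twisted_rack {xs::'g::group_add list. length xs = p} block_op block_opi (ipow shift) (int p)"
proof
  show "block_op x x = ipow shift (int p) x" if "x \<in> {xs::'g list. length xs = p}" for x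
    using that by (auto simp: block_op_def ipow_of_nat shift_funpow_length)
qed (auto simp: block_op_def block_opi_def length_ipow_shift sum_list_ipow_shift ipow_shift_map_group_conj
    map_group_conj_map_group_conj sum_list_map_group_conj o_def ipow_add[OF bij_shift] group_conj_add_self
    simp flip: group_conj_add simp del: map_map)

section \<open>The torus braid acting on blocks\<close>

lemma hurwitz_sigma_run:
  fixes s :: "nat \<Rightarrow> 's"
  shows "hurwitz_word f g (sigma_run k m) s =
    (\<lambda>i. if k \<le> i \<and> i < k + m then f (s k) (s (i + 1)) else if i = k + m then s k else s i)"
proof (induction m)
  case (Suc m)
  have "sigma_run k (Suc m) = sigma_run k m @ [Pos (k + m)]"
    by (simp add: sigma_run_def)
  then show ?case
    using Suc by (auto simp: hurwitz_def fun_eq_iff)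
qed (auto simp: sigma_run_def fun_eq_iff)

lemma concat_replicate_Suc: "concat (replicate (Suc j) w) = concat (replicate j w) @ w"
  by (simp add: replicate_append_same[symmetric])

definition partial_sum :: "(nat \<Rightarrow> 'g::group_add list) \<Rightarrow> nat \<Rightarrow> 'g" where
  "partial_sum s j = sum_list (map (\<lambda>i. sum_list (s i)) [1..<Suc j])"

lemma partial_sum_Suc: "partial_sum s (Suc j) = partial_sum s j + sum_list (s (Suc j))"
  by (simp add: partial_sum_def)

text \<open>A block that has wrapped around to the end passed over the others but not over itself.
  Conjugation by the partial product includes its own product, which amounts to \<open>p\<close>
  shifts, and these are taken back.\<close>

lemma block_rotation_power:
  fixes s :: "nat \<Rightarrow> 'g::group_add list"
  assumes "\<And>i. length (s i) = p" "j \<le> n" "1 \<le> i" "i \<le> n"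
  shows "hurwitz_word block_op block_opi (concat (replicate j (sigma_run 1 (n - 1)))) s i =
    (if i + j \<le> n then map (group_conj (partial_sum s j)) (s (i + j))
     else ipow shift (- int p) (map (group_conj (partial_sum s j)) (s (i + j - n))))"
  using assms(2-4)
proof (induction j arbitrary: i)
  case 0
  then show ?case
    by (simp add: partial_sum_def)
next
  case (Suc j)
  let ?u = "hurwitz_word block_op block_opi (concat (replicate j (sigma_run 1 (n - 1)))) s"
  have u1: "?u 1 = map (group_conj (partial_sum s j)) (s (Suc j))"
    using Suc.IH[of 1] Suc.prems by simp
  have op: "block_op (?u 1) (map (group_conj (partial_sum s j)) y) = map (group_conj (partial_sum s (Suc j))) y" for y
    unfolding u1 by (simp add: block_op_def sum_list_map_group_conj group_conj_conj group_conj_add partial_sum_Suc)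
  show ?case
  proof (cases "i < n")
    case True
    have "ipow shift (- int p) (map (group_conj (partial_sum s j)) y) =
      map (group_conj (partial_sum s j)) (ipow shift (- int p) y)" for y
      by (simp add: ipow_shift_map_group_conj)
    then show ?thesis
      unfolding concat_replicate_Suc hurwitz_word_append hurwitz_sigma_run
      using True Suc.prems Suc.IH[of "Suc i"] op by (auto simp: ipow_shift_map_group_conj)
  next
    case False
    then have i: "i = n"
      using Suc.prems by simp
    let ?y = "s (Suc j)"
    have "map (group_conj (sum_list ?y)) ?y = ipow shift (int p) ?y"
      using shift_funpow_length[of ?y] assms(1) by (simp add: ipow_of_nat)
    then have "ipow shift (- int p) (map (group_conj (partial_sum s (Suc j))) ?y)
        = map (group_conj (partial_sum s j)) (ipow shift (- int p) (ipow shift (int p) ?y))"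
      by (simp add: partial_sum_Suc ipow_shift_map_group_conj flip: map_group_conj_map_group_conj)
    also have "\<dots> = map (group_conj (partial_sum s j)) ?y"
      by (simp flip: ipow_add[OF bij_shift])
    finally show ?thesis
      unfolding concat_replicate_Suc hurwitz_word_append hurwitz_sigma_run
      using u1 Suc.prems i by simp
  qed
qed

abbreviation multiple :: "nat \<Rightarrow> 'g::monoid_add \<Rightarrow> 'g" where
  "multiple k x \<equiv> sum_list (replicate k x)"

lemma multiple_Suc': "multiple (Suc k) x = multiple k x + x"
  by (simp add: replicate_append_same[symmetric])

text \<open>
  With \<open>D\<close> the product of all blocks and \<open>g\<close> its product with the first block, the relation
  $g^n = D^{n+1}$ presents the group of the torus knot.
\<close>

lemma block_torus_colouring:
  fixes s :: "nat \<Rightarrow> 'g::group_add list"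
  assumes len: "\<And>i. length (s i) = p" and n: "1 \<le> n"
    and eq: "\<And>i. i \<in> {1..n} \<Longrightarrow>
      hurwitz_word block_op block_opi (concat (replicate (Suc n) (sigma_run 1 (n - 1)))) s i
        = ipow shift (\<tau> i) (s i)"
    and total: "sum \<tau> {1..n} = - 1"
  defines "D \<equiv> partial_sum s n"
  defines "g \<equiv> D + sum_list (s 1)"
  shows "multiple n g = multiple (Suc n) D"
    and "\<And>i. i \<in> {1..n} \<Longrightarrow> \<exists>k. s i = ipow shift k (map (group_conj (- multiple (i - 1) g)) (s 1))"
    and "shift (map (group_conj (- multiple (Suc n) (sum_list (s 1)) + multiple n g)) (s 1)) = s 1"
proof -
  let ?X = "sum_list (s 1)"
  let ?u = "hurwitz_word block_op block_opi (concat (replicate n (sigma_run 1 (n - 1)))) s"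
  have u: "?u i = ipow shift (- int p) (map (group_conj D) (s i))" if "1 \<le> i" "i \<le> n" for i
    using block_rotation_power[of s p n n i] len that by (simp add: D_def)
  have w: "hurwitz_word block_op block_opi (concat (replicate (Suc n) (sigma_run 1 (n - 1)))) s i
      = (if i < n then block_op (?u 1) (?u (i + 1)) else ?u 1)" if "i \<in> {1..n}" for i
    unfolding concat_replicate_Suc hurwitz_word_append hurwitz_sigma_run using that by auto
  have inv: "y = ipow shift (- a) x" if "x = ipow shift a y" for a and x y :: "'g list"
    using that by (simp flip: ipow_add[OF bij_shift])
  \<comment> \<open>The first \<open>n\<close> rotations conjugate by \<open>D\<close>, the last one
    by the conjugate of the first block; together this is conjugation by \<open>g\<close>.\<close>
  have step: "s (Suc i) = ipow shift (\<tau> i + int p) (map (group_conj (- g)) (s i))" if "i \<in> {1..<n}" for i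
  proof -
    have "ipow shift (\<tau> i) (s i) = block_op (?u 1) (?u (i + 1))"
      using eq[of i] w[of i] that by simp
    also have "\<dots> = map (group_conj g) (ipow shift (- int p) (s (Suc i)))"
      using u[of 1] u[of "Suc i"] that
      by (simp add: block_op_def sum_list_ipow_shift ipow_shift_map_group_conj sum_list_map_group_conj group_conj_conj
          g_def group_conj_add)
    finally have "map (group_conj (- g)) (ipow shift (\<tau> i) (s i)) = ipow shift (- int p) (s (Suc i))"
      by simp
    from inv[OF this] show ?thesis
      by (simp add: ipow_shift_map_group_conj ipow_add[OF bij_shift, symmetric] add.commute)
  qed
  \<comment> \<open>The last position receives the first block without the final conjugation.
    Writing \<open>g\<close> for \<open>D\<close> here costs \<open>p\<close> further shifts, hence
    \<open>2 * int p\<close>.\<close>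
  have last: "s 1 = ipow shift (\<tau> n + 2 * int p) (map (group_conj (- g)) (s n))"
  proof -
    have self: "map (group_conj ?X) (s 1) = ipow shift (int p) (s 1)"
      using shift_funpow_length[of "s 1"] len by (simp add: ipow_of_nat)
    have "ipow shift (\<tau> n) (s n) = ?u 1"
      using eq[of n] w[of n] n by simp
    also have "\<dots> = map (group_conj D) (ipow shift (- (2 * int p)) (ipow shift (int p) (s 1)))"
      using u[of 1] n by (simp add: ipow_shift_map_group_conj flip: ipow_add[OF bij_shift])
    also have "\<dots> = map (group_conj g) (ipow shift (- (2 * int p)) (s 1))"
      unfolding self[symmetric] ipow_shift_map_group_conj map_group_conj_map_group_conj g_def ..
    finally have "map (group_conj (- g)) (ipow shift (\<tau> n) (s n)) = ipow shift (- (2 * int p)) (s 1)"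
      by simp
    from inv[OF this] show ?thesis
      by (simp add: ipow_shift_map_group_conj ipow_add[OF bij_shift, symmetric] add.commute)
  qed
  have power: "s (Suc i) = ipow shift (sum \<tau> {1..i} + int i * int p) (map (group_conj (- multiple i g)) (s 1))"
    if "i < n" for i
    using that
  proof (induction i)
    case (Suc i)
    have "- multiple (Suc i) g = - g + - multiple i g"
      unfolding multiple_Suc' by (simp add: minus_add)
    have "s (Suc (Suc i)) = ipow shift (\<tau> (Suc i) + int p) (map (group_conj (- g))
        (ipow shift (sum \<tau> {1..i} + int i * int p) (map (group_conj (- multiple i g)) (s 1))))"
      using step[of "Suc i"] Suc by simp
    also have "\<dots> = map (group_conj (- multiple (Suc i) g))
        (ipow shift (\<tau> (Suc i) + int p + (sum \<tau> {1..i} + int i * int p)) (s 1))"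
      unfolding ipow_shift_map_group_conj ipow_add[OF bij_shift, symmetric] map_group_conj_map_group_conj
        \<open>- multiple (Suc i) g = - g + - multiple i g\<close> ..
    also have "\<tau> (Suc i) + int p + (sum \<tau> {1..i} + int i * int p)
        = sum \<tau> {1..Suc i} + int (Suc i) * int p"
      by (simp add: algebra_simps)
    finally show ?case
      by (simp only: ipow_shift_map_group_conj)
  qed simp
  show "\<exists>k. s i = ipow shift k (map (group_conj (- multiple (i - 1) g)) (s 1))" if "i \<in> {1..n}" for i
    using power[of "i - 1"] that by auto
  have sum_conj: "sum_list (s (Suc i)) = group_conj (- multiple i g) ?X" if "i < n" for i
    using power[OF that] by (simp add: sum_list_ipow_shift sum_list_map_group_conj)
  \<comment> \<open>Since every block has the product of a conjugate of the first one by a power of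
    \<open>g\<close>, the product of the blocks telescopes; with \<open>?X - g = - D\<close> this
    becomes the torus knot relation.\<close>
  have "partial_sum s i = multiple i (?X - g) + multiple i g" if "i \<le> n" for i
    using that
  proof (induction i)
    case (Suc i)
    have "partial_sum s (Suc i) = multiple i (?X - g) + multiple i g + group_conj (- multiple i g) ?X"
      using Suc sum_conj[of i] by (simp add: partial_sum_Suc)
    also have "\<dots> = multiple i (?X - g) + (?X - g) + (g + multiple i g)"
      by (simp add: group_conj_def add.assoc minus_add diff_conv_add_uminus del: add_uminus_conv_diff)
    finally show ?case
      unfolding multiple_Suc'[of i "?X - g"] by simp
  qed (simp add: partial_sum_def)
  then have "D = multiple n (?X - g) + multiple n g"
    by (simp add: D_def)
  moreover have "?X - g = - D"
    by (simp add: g_def minus_add diff_conv_add_uminus del: add_uminus_conv_diff)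
  moreover have "multiple n (- D) = - multiple n D"
  proof (induction n)
    case (Suc n)
    then show ?case
      unfolding multiple_Suc'[of n D] by (simp add: minus_add)
  qed simp
  ultimately have "multiple n D + D = multiple n g"
    by (metis add_minus_cancel)
  then show z: "multiple n g = multiple (Suc n) D"
    by (simp only: multiple_Suc')
  have X_mult: "map (group_conj (multiple k ?X)) (s 1) = ipow shift (int k * int p) (s 1)" for k
  proof (induction k)
    case (Suc k)
    have self: "map (group_conj ?X) (s 1) = ipow shift (int p) (s 1)"
      using shift_funpow_length[of "s 1"] len by (simp add: ipow_of_nat)
    show ?case
      unfolding multiple_Suc' map_group_conj_map_group_conj[symmetric] self ipow_shift_map_group_conj[symmetric] Suc
      by (simp add: algebra_simps flip: ipow_add[OF bij_shift])
  qed simp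
  have "s 1 = ipow shift (\<tau> n + 2 * int p + (sum \<tau> {1..n - 1} + int (n - 1) * int p))
      (map (group_conj (- multiple n g)) (s 1))"
  proof -
    have "- multiple n g = - g + - multiple (n - 1) g"
      using multiple_Suc'[of "n - 1" g] n by (simp add: minus_add)
    moreover have sn: "s n = ipow shift (sum \<tau> {1..n - 1} + int (n - 1) * int p)
        (map (group_conj (- multiple (n - 1) g)) (s 1))"
      using power[of "n - 1"] n by simp
    moreover have "ipow shift a (map (group_conj c) (ipow shift b (map (group_conj d) x)))
      = ipow shift (a + b) (map (group_conj (c + d)) x)" for a b c d and x :: "'g list"
      by (simp only: ipow_shift_map_group_conj ipow_add[OF bij_shift] map_group_conj_map_group_conj)
    ultimately show ?thesis
      using last[unfolded sn] by metis
  qed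
  \<comment> \<open>Going once around all positions uses the total twist -1. The remaining shifts,
    \<open>n + 1\<close> times \<open>p\<close>, are those of conjugation by \<open>n + 1\<close>
    copies of \<open>?X\<close>, so exactly one shift is left over.\<close>
  moreover have "\<tau> n + 2 * int p + (sum \<tau> {1..n - 1} + int (n - 1) * int p) = int (Suc n) * int p - 1"
  proof -
    have "{1..n} = insert n {1..n - 1}"
      using n by auto
    then have "sum \<tau> {1..n} = \<tau> n + sum \<tau> {1..n - 1}"
      using n by simp
    then show ?thesis
      using total n by (simp add: algebra_simps of_nat_diff)
  qed
  ultimately have 1: "s 1 = ipow shift (int (Suc n) * int p - 1) (map (group_conj (- multiple n g)) (s 1))"
    by simp
  have "map (group_conj (multiple n g)) (s 1) = ipow shift (int (Suc n) * int p - 1) (s 1)"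
    by (subst 1) (simp add: ipow_shift_map_group_conj)
  then have "map (group_conj (multiple n g)) (s 1)
      = ipow shift (- 1) (map (group_conj (multiple (Suc n) ?X)) (s 1))"
    unfolding X_mult by (simp flip: ipow_add[OF bij_shift])
  then have "shift (map (group_conj (multiple n g)) (s 1)) = map (group_conj (multiple (Suc n) ?X)) (s 1)"
    by (simp only: shift_ipow_cancel)
  then have "map (group_conj (- multiple (Suc n) ?X)) (map (group_conj (multiple n g)) (shift (s 1))) = s 1"
    by (simp add: shift_map_group_conj)
  then show "shift (map (group_conj (- multiple (Suc n) ?X + multiple n g)) (s 1)) = s 1"
    by (simp only: shift_map_group_conj map_group_conj_map_group_conj)
qed

section \<open>Cables and satellites acting on blocks\<close>

abbreviation conj_act :: "word \<Rightarrow> (nat \<Rightarrow> 'g::group_add) \<Rightarrow> nat \<Rightarrow> 'g" where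
  "conj_act \<equiv> hurwitz_word group_conj (\<lambda>x. group_conj (- x))"

abbreviation block_act :: "word \<Rightarrow> (nat \<Rightarrow> 'g::group_add list) \<Rightarrow> nat \<Rightarrow> 'g list" where
  "block_act \<equiv> hurwitz_word block_op block_opi"

text \<open>Blocks are numbered from 1; because of truncated subtraction, block 0 is a copy of block 1.\<close>

definition block :: "nat \<Rightarrow> (nat \<Rightarrow> 'g) \<Rightarrow> nat \<Rightarrow> 'g list" where
  "block p s j = map (\<lambda>t. s ((j - 1) * p + 1 + t)) [0..<p]"

lemma length_block [simp]: "length (block p s j) = p"
  by (simp add: block_def)

lemma conj_rack:
  "twisted_rack (UNIV :: 'g::group_add set) group_conj (\<lambda>x. group_conj (- x)) (\<lambda>_::int. id) 0"
  by standard (simp_all add: group_conj_conj)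

text \<open>The statement covers the intermediate stages of a cabled crossing: the runs start at
  descending positions, so with \<open>e\<close> fixed the induction appends one run at the lower
  end.\<close>

lemma conj_act_descending_runs:
  fixes s :: "nat \<Rightarrow> 'g::group_add"
  assumes "k \<le> e"
  shows "conj_act (concat (map (\<lambda>k. sigma_run k p) (rev [k..<e]))) s =
    (\<lambda>i. if i < k then s i
      else if i < k + p then group_conj (sum_list (map s [k..<e])) (s (i + (e - k)))
      else if i < e + p then s (i - p) else s i)"
  using assms
proof (induction k rule: inc_induct)
  case (step k)
  have u: "[k..<e] = k # [Suc k..<e]"
    using step.hyps by (simp add: upt_conv_Cons)
  show ?case
    unfolding u rev.simps map_append concat_append hurwitz_word_append step.IH
    using step.hyps by (auto simp: hurwitz_sigma_run fun_eq_iff group_conj_add Suc_diff_Suc)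
qed (auto simp: fun_eq_iff)

text \<open>All strands of block \<open>i\<close> pass over block \<open>i + 1\<close>, hence
  conjugate it by their product, and blocks behave like single strands.\<close>

lemma block_cable_generator:
  fixes s :: "nat \<Rightarrow> 'g::group_add"
  assumes "1 \<le> i" "1 \<le> j"
  shows "block p (conj_act (cable_generator p i) s) j
    = hurwitz block_op block_opi (Pos i) (block p s) j"
proof -
  define m where "m = (i - 1) * p + 1"
  have block_i: "map s [m..<m + p] = block p s i"
    unfolding block_def m_def[symmetric] by (rule nth_equalityI) simp_all
  have gen: "cable_generator p i = concat (map (\<lambda>k. sigma_run k p) (rev [m..<m + p]))"
    by (simp add: cable_generator_def m_def)
  have act: "conj_act (cable_generator p i) s q =
    (if q < m then s q else if q < m + p then group_conj (sum_list (block p s i)) (s (q + p))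
      else if q < m + p + p then s (q - p) else s q)" for q
    unfolding gen conj_act_descending_runs[OF le_add1] block_i by simp
  have offset: "(j' - 1) * p + p \<le> (i' - 1) * p" if "1 \<le> j'" "j' < i'" for i' j' :: nat
    using mult_le_mono1[of j' "i' - 1" p] that by (cases j') (simp_all add: add.commute)
  have Suc_offset: "(i + 1 - 1) * p + 1 = m + p"
    using assms(1) by (cases i) (simp_all add: m_def)
  consider "j < i" | "j = i" | "j = i + 1" | "i + 1 < j"
    by linarith
  then show ?thesis
  proof cases
    case 1
    then show ?thesis
      using offset[OF assms(2) 1] by (auto simp: block_def act m_def hurwitz_def)
  next
    case 2
    have "block p s (i + 1) = map (\<lambda>t. s (m + p + t)) [0..<p]"
      unfolding block_def Suc_offset ..
    moreover have "block p (conj_act (cable_generator p i) s) i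
        = map (\<lambda>t. group_conj (sum_list (block p s i)) (s (m + p + t))) [0..<p]"
      unfolding block_def[of _ "conj_act _ _"] m_def[symmetric] by (simp add: act add_ac)
    ultimately show ?thesis
      using 2 by (simp add: hurwitz_def block_op_def)
  next
    case 3
    have "block p (conj_act (cable_generator p i) s) (i + 1) = map (\<lambda>t. s (m + t)) [0..<p]"
      unfolding block_def Suc_offset by (simp add: act)
    then show ?thesis
      using 3 by (simp add: hurwitz_def block_def m_def)
  next
    case 4
    have "m + p + p \<le> (j - 1) * p + 1"
      using offset[of "i + 1" j] Suc_offset 4 by simp
    then show ?thesis
      using 4 by (simp add: block_def act hurwitz_def)
  qed
qed

lemma block_cable_crossing:
  fixes s :: "nat \<Rightarrow> 'g::group_add"
  assumes "1 \<le> position c" "1 \<le> j"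
  shows "block p (conj_act (cable_crossing p c) s) j = hurwitz block_op block_opi c (block p s) j"
proof (cases c)
  case (Pos i)
  then show ?thesis
    using block_cable_generator assms by simp
next
  case (Neg i)
  \<comment> \<open>The colours are written as the image of \<open>t\<close> under the positive
    cabled crossing, whose effect on blocks is already known and is then inverted.\<close>
  define t where "t = conj_act (inverse_word (cable_generator p i)) s"
  have s: "s = conj_act (cable_generator p i) t"
    unfolding t_def by (rule twisted_rack.act_inverse'[OF conj_rack, symmetric]) simp
  have "block p s j = hurwitz block_op block_opi (Pos i) (block p t) j" if "1 \<le> j" for j
    using block_cable_generator[of i j p t] that assms Neg s by simp
  then show ?thesis
    using assms Neg
    by (auto simp: hurwitz_def t_def[symmetric] block_op_def block_opi_def o_def simp flip: group_conj_add)
qed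

lemma block_cable_word:
  fixes s :: "nat \<Rightarrow> 'g::group_add"
  assumes "position ` set w \<subseteq> {1..<n}" "j \<in> {1..n}"
  shows "block p (conj_act (cable_word p w) s) j = block_act w (block p s) j"
  using assms(1)
proof (induction w arbitrary: s)
  case (Cons c w)
  have "conj_act (cable_word p (c # w)) s = conj_act (cable_word p w) (conj_act (cable_crossing p c) s)"
    by (simp add: cable_word_def)
  then have "block p (conj_act (cable_word p (c # w)) s) j
      = block_act w (block p (conj_act (cable_crossing p c) s)) j"
    using Cons by simp
  also have "\<dots> = block_act w (hurwitz block_op block_opi c (block p s)) j"
    using Cons.prems assms(2) block_cable_crossing[of c _ p s]
    by (intro hurwitz_word_cong[of w n]) auto
  finally show ?case
    by simp
qed (simp add: cable_word_def)

text \<open>The pattern shifts the first block and leaves the others alone. As the whole satellite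
  fixes all colours, the cable alone must shift the first block back once.\<close>

lemma block_satellite:
  fixes s :: "nat \<Rightarrow> 'g::group_add"
  assumes w: "position ` set w \<subseteq> {1..<n}" and "1 \<le> p" and j: "j \<in> {1..n}"
    and fixed: "\<And>i. i \<in> {1..n * p} \<Longrightarrow> conj_act (cable_word p w @ sigma_run 1 (p - 1)) s i = s i"
  shows "block_act w (block p s) j = ipow shift (if j = 1 then - 1 else 0) (block p s j)"
proof -
  define u where "u = conj_act (cable_word p w) s"
  have range: "(j - 1) * p + 1 + t \<in> {1..n * p}" if "t < p" for t
    using mult_le_mono1[of j n p] j that by (cases j) simp_all
  have u: "s i = (if i < p then group_conj (u 1) (u (i + 1)) else if i = p then u 1 else u i)"
    if "i \<in> {1..n * p}" for i
    using fixed[OF that] that assms(2) unfolding hurwitz_word_append u_def[symmetric] hurwitz_sigma_run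
    by auto
  have blk: "block p u j = block_act w (block p s) j"
    unfolding u_def by (rule block_cable_word[OF w j])
  show ?thesis
  proof (cases "j = 1")
    case True
    obtain q where p: "p = Suc q"
      using assms(2) by (cases p) simp_all
    have "block p s j = map (\<lambda>t. s (1 + t)) [0..<Suc q]"
      using True by (simp add: block_def p)
    also have "\<dots> = map (\<lambda>t. s (1 + t)) [0..<q] @ [s p]"
      by (simp add: p)
    also have "\<dots> = map (\<lambda>t. group_conj (u 1) (u (t + 2))) [0..<q] @ [u 1]"
      using u range[unfolded True] p by simp
    also have "\<dots> = shift (u 1 # map (\<lambda>t. u (t + 2)) [0..<q])"
      by simp
    also have "u 1 # map (\<lambda>t. u (t + 2)) [0..<q] = block p u j"
      using True upt_conv_Cons[of 0 p] by (simp add: block_def p map_Suc_upt[symmetric] del: upt_Suc)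
    finally have "shift (block p u j) = block p s j" ..
    then have "ipow shift (- 1) (block p s j) = ipow shift (- 1) (ipow shift 1 (block p u j))"
      by simp
    then show ?thesis
      using True blk by (simp flip: ipow_add[OF bij_shift])
  next
    case False
    have "1 \<le> j - 1"
      using False j by auto
    from mult_le_mono1[OF this, of p] have "p \<le> (j - 1) * p"
      by simp
    then have "s ((j - 1) * p + 1 + t) = u ((j - 1) * p + 1 + t)" if "t < p" for t
    proof -
      have "\<not> (j - 1) * p + 1 + t < p" "(j - 1) * p + 1 + t \<noteq> p"
        using \<open>p \<le> (j - 1) * p\<close> by linarith+
      then show ?thesis
        using u[OF range[OF that]] by (simp only: if_False)
    qed
    then have "block p s j = block p u j"
      unfolding block_def by (intro map_cong) auto
    then show ?thesis
      using False blk by simp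
  qed
qed

section \<open>Linear algebra\<close>

typedef 'a bijection = "{f :: 'a \<Rightarrow> 'a. bij f}"
  morphisms app Bij
  by (auto intro: bij_id)

text \<open>The class \<open>group_add\<close> is not commutative: \<open>+\<close> is composition.\<close>

instantiation bijection :: (type) group_add
begin

definition zero_bijection :: "'a bijection" where
  "zero_bijection = Bij id"

definition plus_bijection :: "'a bijection \<Rightarrow> 'a bijection \<Rightarrow> 'a bijection" where
  "plus_bijection a b = Bij (app a \<circ> app b)"

definition uminus_bijection :: "'a bijection \<Rightarrow> 'a bijection" where
  "uminus_bijection a = Bij (inv_into UNIV (app a))"

definition minus_bijection :: "'a bijection \<Rightarrow> 'a bijection \<Rightarrow> 'a bijection" where
  "minus_bijection a b = a + - b"

instance
proof
  have bij: "bij (app a)" for a :: "'a bijection"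
    using app by blast
  fix a b c :: "'a bijection"
  show "a + b + c = a + (b + c)"
    by (simp add: plus_bijection_def Bij_inverse bij bij_comp o_assoc)
  show "0 + a = a" "a + 0 = a"
    by (simp_all add: plus_bijection_def zero_bijection_def Bij_inverse app_inverse)
  show "- a + a = 0"
    using bij[of a]
    by (simp add: plus_bijection_def zero_bijection_def uminus_bijection_def Bij_inverse
        bij_imp_bij_inv inv_o_cancel bij_is_inj)
  show "a + - b = a - b"
    by (simp add: minus_bijection_def)
qed

end

lemma bij_app: "bij (app a)"
  using app by blast

lemma app_zero [simp]: "app 0 v = v"
  by (simp add: zero_bijection_def Bij_inverse)

lemma app_plus [simp]: "app (a + b) v = app a (app b v)"
  by (simp add: plus_bijection_def Bij_inverse bij_app bij_comp)

lemma app_cancel [simp]: "app (- a) (app a v) = v" "app a (app (- a) v) = v"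
  by (simp_all flip: app_plus)

lemma app_multiple: "app (multiple k a) v = (app a ^^ k) v"
  by (induction k) simp_all

lemma uminus_multiple: "- multiple k a = multiple k (- a)" for a :: "'g::group_add"
proof (induction k)
  case (Suc k)
  then show ?case
    unfolding multiple_Suc'[of k a] by (simp add: minus_add)
qed simp

text \<open>
  Extending \<open>vector_space\<close> itself would also extend its interpretation for real vector spaces.
\<close>

locale ambient_space = vector_space scale
  for scale :: "'a::field \<Rightarrow> 'b::ab_group_add \<Rightarrow> 'b"
begin

section \<open>Dimension and independent families\<close>

lemma dim_le_dim_finite:
  assumes "S \<subseteq> span T" "finite T"
  shows "dim S \<le> dim T"
proof -
  obtain B where B: "B \<subseteq> T" "independent B" "T \<subseteq> span B" "card B = dim T"
    using basis_exists by blast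
  then have "S \<subseteq> span B"
    using assms(1) span_minimal[OF B(3) subspace_span] by blast
  then show ?thesis
    using dim_le_card[of S B] finite_subset[OF B(1) assms(2)] B(4) by simp
qed

text \<open>A repetition or a dependence would leave a spanning set with fewer than
  \<open>card I\<close> elements.\<close>

lemma family_independent:
  assumes "finite I" "card I \<le> dim (w ` I)" "(\<Sum>i\<in>I. scale (c i) (w i)) = 0" "i \<in> I"
  shows "c i = 0"
proof -
  have card: "card (w ` I) = card I"
    using card_image_le[OF assms(1), of w] dim_le_card'[of "w ` I"] assms(1,2) by auto
  then have inj: "inj_on w I"
    using assms(1) by (rule eq_card_imp_inj_on[rotated])
  have "independent (w ` I)"
  proof
    assume "dependent (w ` I)"
    then obtain a where a: "a \<in> w ` I" "a \<in> span (w ` I - {a})"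
      by (auto simp: dependent_def)
    have "x \<in> span (w ` I - {a})" if "x \<in> w ` I" for x
      using that a(2) by (cases "x = a") (auto intro: span_base)
    then have "w ` I \<subseteq> span (w ` I - {a})"
      by blast
    then have "dim (w ` I) \<le> card (w ` I - {a})"
      using assms(1) by (intro dim_le_card) auto
    also have "\<dots> < card I"
      using a(1) assms(1) card card_Diff1_less[of "w ` I" a] by simp
    finally show False
      using assms(2) by simp
  qed
  moreover have "(\<Sum>v\<in>w ` I. scale (c (inv_into I w v)) v) = 0"
    using assms(3) inj by (subst sum.reindex) (auto simp: inv_into_f_f intro!: sum.cong)
  ultimately have "c (inv_into I w (w i)) = 0"
    using assms(1,4) by (intro independentD[of "w ` I" "w ` I" "\<lambda>v. c (inv_into I w v)"]) auto
  then show ?thesis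
    using inj assms(4) by simp
qed

lemma span_family:
  assumes "x \<in> span (w ` I)" "finite I"
  shows "\<exists>c. x = (\<Sum>i\<in>I. scale (c i) (w i))"
  using assms(1)
proof (induction rule: span_induct_alt)
  case base
  show ?case
    by (intro exI[of _ "\<lambda>_. 0"]) simp
next
  case (step a x y)
  then obtain i c where i: "i \<in> I" "x = w i" and c: "y = (\<Sum>i\<in>I. scale (c i) (w i))"
    by blast
  have "scale a x + y = (\<Sum>j\<in>I. scale ((if j = i then a else 0) + c j) (w j))"
    using i assms(2) by (simp add: c scale_left_distrib sum.distrib if_distrib[of "\<lambda>b. scale b _"] sum.delta cong: if_cong)
  then show ?case
    by (intro exI[of _ "\<lambda>j. (if j = i then a else 0) + c j"])
qed

section \<open>Linear operators and their powers\<close>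

definition lin_op :: "('b \<Rightarrow> 'b) \<Rightarrow> bool" where
  "lin_op h \<longleftrightarrow> (\<forall>u v. h (u + v) = h u + h v) \<and> (\<forall>c v. h (scale c v) = scale c (h v))"

lemma lin_opD:
  assumes "lin_op h"
  shows "h (u + v) = h u + h v" "h (scale c v) = scale c (h v)" "h 0 = 0" "h (- v) = - h v"
    "h (u - v) = h u - h v" "h (sum g A) = (\<Sum>i\<in>A. h (g i))"
proof -
  show add: "h (u + v) = h u + h v" and scale: "h (scale c v) = scale c (h v)" for u v c
    using assms by (auto simp: lin_op_def)
  show zero: "h 0 = 0"
    using scale[of 0 0] by simp
  show minus: "h (- v) = - h v" for v
    using scale[of "- 1" v] by simp
  show "h (u - v) = h u - h v"
    using add[of u "- v"] minus[of v] by simp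
  show "h (sum g A) = (\<Sum>i\<in>A. h (g i))"
    by (induction A rule: infinite_finite_induct) (simp_all add: add zero)
qed

lemma lin_op_funpow: "lin_op h \<Longrightarrow> lin_op (h ^^ k)"
  by (induction k) (simp_all add: lin_op_def)

lemma lin_op_image_subspace: "lin_op h \<Longrightarrow> subspace V \<Longrightarrow> subspace (h ` V)"
  unfolding subspace_def by (auto simp: lin_op_def image_iff) (metis lin_op_def lin_opD(3))+

lemma lin_op_span: "lin_op h \<Longrightarrow> (\<And>x. x \<in> A \<Longrightarrow> h x \<in> span B) \<Longrightarrow> x \<in> span A \<Longrightarrow> h x \<in> span B"
  by (erule span_induct_alt) (auto simp: lin_opD span_add span_scale span_zero)

text \<open>Telescoping with \<open>B - G = (X - 1) G\<close>. When \<open>X - 1\<close> takes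
  values in a subspace \<open>V\<close>, the powers of \<open>B\<close> and \<open>G\<close> thus
  agree up to translates of \<open>V\<close> under lower powers of \<open>B\<close>.\<close>

lemma funpow_difference:
  assumes "lin_op B" and B: "\<And>v. B v = X (G v)"
  shows "(B ^^ k) v = (G ^^ k) v + (\<Sum>j<k. (B ^^ j) (X ((G ^^ (k - j)) v) - (G ^^ (k - j)) v))"
proof (induction k arbitrary: v)
  case (Suc k)
  have "(B ^^ Suc k) v = (B ^^ k) (G v) + (B ^^ k) (X (G v) - G v)"
    by (simp add: funpow_swap1 B flip: lin_opD(1)[OF lin_op_funpow[OF assms(1)]])
  also have "(B ^^ k) (G v) = (G ^^ Suc k) v
      + (\<Sum>j<k. (B ^^ j) (X ((G ^^ (Suc k - j)) v) - (G ^^ (Suc k - j)) v))"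
    unfolding Suc.IH by (auto simp: funpow_swap1 Suc_diff_le intro!: sum.cong)
  finally show ?case
    by (simp add: add.assoc)
qed simp

text \<open>
  Block companion form: the \<open>n\<close> translates of \<open>V\<close> under \<open>B\<close> are independent, so expanding
  $B^{n+1}v$ in two ways determines all the coefficients of $B^n$ as powers of one operator \<open>R\<close>.
\<close>

lemma block_companion:
  assumes lin: "lin_op B" "lin_op G" "lin_op X" "lin_op Y"
    and V: "subspace V" and XV: "\<And>v. X v - v \<in> V" and YV: "\<And>v. v \<in> V \<Longrightarrow> Y v \<in> V"
    and B: "\<And>v. B v = X (G v)" and Gn: "\<And>v. (G ^^ Suc m) v = Y v"
    and Bn: "\<And>v. (B ^^ Suc (Suc m)) v = Y v"
    and comm: "\<And>v. X (Y v) = Y (X v)" and inj: "inj Y"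
    and direct: "\<And>u. (\<And>j. u j \<in> V) \<Longrightarrow> (\<Sum>j<Suc m. (B ^^ j) (u j)) = 0 \<Longrightarrow> \<forall>j<Suc m. u j = 0"
    and v: "v \<in> V"
  shows "Y ((X ^^ Suc (Suc m)) v) = scale ((- 1) ^ m) v"
proof -
  note lins = lin[THEN lin_opD(1)] lin[THEN lin_opD(5)] lin[THEN lin_opD(2)]
  have linB: "lin_op (B ^^ j)" for j
    using lin(1) by (rule lin_op_funpow)
  \<comment> \<open>These express \<open>B ^^ Suc m\<close> through lower powers of \<open>B\<close>
    and form the last column of the companion matrix. For \<open>j = 0\<close> the leading term
    \<open>Y\<close> of the expansion is absorbed.\<close>
  define q where "q j v = (if j = 0 then X (Y v) else X ((G ^^ (Suc m - j)) v) - (G ^^ (Suc m - j)) v)" for j v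
  have XV': "X v \<in> V" if "v \<in> V" for v
    using subspace_add[OF V XV that, of v] by simp
  have qV: "q j v \<in> V" if "v \<in> V" for j v
    using that XV YV XV' by (simp add: q_def)
  note expand = funpow_difference[where X = X, OF lin(1) B]
  have Bm: "(B ^^ Suc m) v = (\<Sum>j<Suc m. (B ^^ j) (q j v))" for v
    unfolding expand[of "Suc m"] sum.lessThan_Suc_shift
    by (simp add: q_def Gn[simplified])
  define R where "R v = q m v" for v
  have RV: "(R ^^ k) v \<in> V" if "v \<in> V" for k v
    using that by (induction k) (auto simp: R_def qV)
  have rel: "q 0 (R v) = Y v \<and> (\<forall>j<m. q (Suc j) (R v) = - q j v)" if v: "v \<in> V" for v
  proof -
    \<comment> \<open>Coefficients of the difference between the two expansions of
      \<open>B ^^ Suc (Suc m)\<close> at \<open>v\<close>; independence of the translates makes each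
      of them vanish.\<close>
    define u where "u j = (if j < Suc m then q j (R v) + (case j of 0 \<Rightarrow> - Y v | Suc i \<Rightarrow> q i v) else 0)" for j
    have uV: "u j \<in> V" for j
      using v qV RV[of v 1] YV V by (auto simp: u_def subspace_add subspace_neg subspace_0 split: nat.split)
    have "Y v = B ((B ^^ Suc m) v)"
      using Bn[of v] by simp
    also have "\<dots> = (\<Sum>j<Suc m. (B ^^ Suc j) (q j v))"
      unfolding Bm by (simp add: lin_opD[OF lin(1)])
    also have "\<dots> = (\<Sum>j<m. (B ^^ Suc j) (q j v)) + (B ^^ Suc m) (R v)"
      by (simp add: R_def)
    also have "(B ^^ Suc m) (R v) = (\<Sum>j<Suc m. (B ^^ j) (q j (R v)))"
      by (rule Bm)
    finally have 1: "(\<Sum>j<Suc m. (B ^^ j) (q j (R v))) = Y v - (\<Sum>j<m. (B ^^ Suc j) (q j v))"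
      by (simp add: algebra_simps)
    have "(\<Sum>j<Suc m. (B ^^ j) (u j)) = (\<Sum>j<Suc m. (B ^^ j) (q j (R v)))
        + (\<Sum>j<Suc m. (B ^^ j) (case j of 0 \<Rightarrow> - Y v | Suc i \<Rightarrow> q i v))"
      unfolding sum.distrib[symmetric] by (intro sum.cong) (auto simp: u_def lin_opD[OF linB])
    also have "(\<Sum>j<Suc m. (B ^^ j) (case j of 0 \<Rightarrow> - Y v | Suc i \<Rightarrow> q i v))
        = - Y v + (\<Sum>j<m. (B ^^ Suc j) (q j v))"
      unfolding sum.lessThan_Suc_shift by simp
    finally have "(\<Sum>j<Suc m. (B ^^ j) (u j)) = 0"
      unfolding 1 by simp
    from direct[OF uV this] have u0: "\<And>j. j < Suc m \<Longrightarrow> u j = 0"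
      by blast
    have "q 0 (R v) = Y v"
      using u0[of 0] by (simp add: u_def)
    moreover have "q (Suc j) (R v) = - q j v" if "j < m" for j
      using u0[of "Suc j"] that by (simp add: u_def eq_neg_iff_add_eq_0)
    ultimately show ?thesis
      by blast
  qed
  \<comment> \<open>The lowest coefficient is \<open>X\<close> after \<open>Y\<close>, so the
    relation for \<open>j = 0\<close> makes \<open>R\<close> a right inverse of \<open>X\<close> on
    \<open>V\<close>.\<close>
  have XR: "X (R v) = v" if "v \<in> V" for v
    using rel[OF that] inj by (simp add: q_def comm inj_eq)
  have XR': "(X ^^ k) ((R ^^ k) v) = v" if "v \<in> V" for k v
  proof (induction k)
    case (Suc k)
    then show ?case
      using XR[OF RV[OF that]] by (simp add: funpow_swap1)
  qed simp
  \<comment> \<open>Starting from the top coefficient \<open>R\<close>, each step down composes with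
    \<open>- R\<close>. At the bottom, \<open>X\<close> after \<open>Y\<close> is a signed power of
    \<open>R\<close>, which powers of \<open>X\<close> undo.\<close>
  have power: "q (m - k) v = scale ((- 1) ^ k) ((R ^^ Suc k) v)" if "k \<le> m" "v \<in> V" for k v
    using that
  proof (induction k arbitrary: v)
    case (Suc k)
    have "m - k = Suc (m - Suc k)"
      using Suc.prems by simp
    then have "q (m - Suc k) v = - q (m - k) (R v)"
      using rel[OF Suc.prems(2)] Suc.prems(1) by simp
    also have "\<dots> = - scale ((- 1) ^ k) ((R ^^ Suc k) (R v))"
      using Suc.IH[of "R v"] Suc.prems RV[of v 1] by simp
    finally show ?case
      by (simp add: funpow_swap1)
  qed (simp add: R_def)
  have Xlin: "lin_op (X ^^ k)" for k
    using lin(3) by (rule lin_op_funpow)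
  have comm': "(X ^^ k) (Y v) = Y ((X ^^ k) v)" for k
    by (induction k) (simp_all add: comm)
  have "X (Y v) = scale ((- 1) ^ m) ((R ^^ Suc m) v)"
    using power[of m v] v by (simp add: q_def)
  then have "(X ^^ Suc m) (X (Y v)) = scale ((- 1) ^ m) ((X ^^ Suc m) ((R ^^ Suc m) v))"
    by (simp only: lin_opD(2)[OF Xlin])
  then have "(X ^^ Suc m) (X (Y v)) = scale ((- 1) ^ m) v"
    by (simp only: XR'[OF v])
  then show ?thesis
    using comm'[of "Suc (Suc m)"] by (simp add: funpow_swap1)
qed

text \<open>The image of \<open>a - 1\<close> lies in \<open>W\<close>; for a reflection,
  \<open>W\<close> can be the line of its vector. Lines can thus be read off group elements, in
  which the scale of the vector is lost.\<close>

definition displaces :: "'b set \<Rightarrow> 'b bijection \<Rightarrow> bool" where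
  "displaces W a \<longleftrightarrow> (\<forall>v. app a v - v \<in> W)"

lemma displaces_zero [simp]: "subspace W \<Longrightarrow> displaces W 0"
  by (simp add: displaces_def subspace_0)

lemma displaces_plus: "subspace W \<Longrightarrow> displaces W a \<Longrightarrow> displaces W b \<Longrightarrow> displaces W (a + b)"
  unfolding displaces_def using subspace_add[of W] by (metis app_plus diff_add_cancel add_diff_eq)

lemma displaces_uminus:
  assumes "subspace W" "displaces W a"
  shows "displaces W (- a)"
  unfolding displaces_def
proof
  fix v
  have "app a (app (- a) v) - app (- a) v \<in> W"
    using assms(2) unfolding displaces_def by blast
  from subspace_neg[OF assms(1) this] show "app (- a) v - v \<in> W"
    by simp
qed

lemma displaces_conj: "subspace W \<Longrightarrow> displaces W a \<Longrightarrow> displaces W b \<Longrightarrow> displaces W (group_conj a b)"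
  unfolding group_conj_def diff_conv_add_uminus by (intro displaces_plus displaces_uminus)

lemma displaces_sum_list: "subspace W \<Longrightarrow> (\<And>a. a \<in> set as \<Longrightarrow> displaces W a) \<Longrightarrow> displaces W (sum_list as)"
  by (induction as) (auto intro: displaces_plus)

lemma displaces_stable: "subspace W \<Longrightarrow> displaces W a \<Longrightarrow> v \<in> W \<Longrightarrow> app a v \<in> W"
  using subspace_add[of W "app a v - v" v] by (simp add: displaces_def)

lemma displaces_conj_image:
  assumes "lin_op (app h)" "displaces W a"
  shows "displaces (app h ` W) (group_conj h a)"
  unfolding displaces_def
proof
  fix v
  have "app (group_conj h a) v - v = app h (app a (app (- h) v) - app (- h) v)"
    by (simp add: group_conj_def lin_opD[OF assms(1)] diff_conv_add_uminus[of "h + a" h]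
        del: add_uminus_conv_diff)
  then show "app (group_conj h a) v - v \<in> app h ` W"
    using assms(2) by (auto simp: displaces_def)
qed

text \<open>The map \<open>h\<close> carries the image of \<open>a - 1\<close> to the image of the
  conjugate minus 1, so vectors can be followed through conjugations.\<close>

lemma displacement_conj:
  assumes "lin_op (app h)" "e = app a u - u" "displaces W (group_conj h a)"
  shows "app h e \<in> W"
proof -
  have "app h e = app (group_conj h a) (app h u) - app h u"
    by (simp add: group_conj_def assms(2) lin_opD[OF assms(1)] diff_conv_add_uminus[of "h + a" h]
        del: add_uminus_conv_diff)
  then show ?thesis
    using assms(3) by (simp add: displaces_def)
qed

lemma lin_op_app_uminus:
  assumes "lin_op (app a)"
  shows "lin_op (app (- a))"
proof -
  have "inj (app a)"
    using bij_app bij_is_inj by blast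
  then show ?thesis
    unfolding lin_op_def
    by (auto simp: lin_opD[OF assms] intro: injD[of "app a"])
qed

lemma lin_op_app_plus: "lin_op (app a) \<Longrightarrow> lin_op (app b) \<Longrightarrow> lin_op (app (a + b))"
  by (simp add: lin_op_def)

lemma lin_op_app_sum_list:
  "(\<And>a. a \<in> set as \<Longrightarrow> lin_op (app a)) \<Longrightarrow> lin_op (app (sum_list as))"
  by (induction as) (auto intro: lin_op_app_plus simp: lin_op_def)

end

lemma set_shift_closed:
  assumes "set xs \<subseteq> N" "\<And>a b. a \<in> N \<Longrightarrow> b \<in> N \<Longrightarrow> group_conj a b \<in> N"
  shows "set (shift xs) \<subseteq> N"
  using assms by (cases xs) auto

lemma set_ipow_shift_closed:
  fixes N :: "'g::group_add set"
  assumes "set xs \<subseteq> N" "\<And>a b. a \<in> N \<Longrightarrow> b \<in> N \<Longrightarrow> group_conj a b \<in> N"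
    and "\<And>a b. a \<in> N \<Longrightarrow> b \<in> N \<Longrightarrow> group_conj (- a) b \<in> N"
  shows "set (ipow shift k xs) \<subseteq> N"
proof -
  have inv: "set ys \<subseteq> N" if "set (shift ys) \<subseteq> N" for ys
  proof (cases ys)
    case (Cons y zs)
    have "z \<in> N" if "z \<in> set zs" for z
      using assms(3)[of y "group_conj y z"] \<open>set (shift ys) \<subseteq> N\<close> Cons that by auto
    then show ?thesis
      using that Cons by auto
  qed simp
  have "set (shift ys) \<subseteq> N \<longleftrightarrow> set ys \<subseteq> N" for ys
    using inv[of ys] set_shift_closed[of ys N] assms(2) by blast
  from ipow_invariant[of shift "\<lambda>ys. set ys \<subseteq> N", OF bij_shift this] show ?thesis
    using assms(1) by simp
qed

context ambient_space
begin

text \<open>The vectors enter only through \<open>disp\<close> and \<open>range\<close>, which say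
  that \<open>e i k\<close> spans the image of \<open>t i ! k - 1\<close>; nothing more is
  remembered by a colouring with group elements. Full dimension is assumed for contradiction because
  it makes the translates of \<open>V\<close> independent, as the companion form requires.\<close>

lemma torus_cable_degenerate:
  fixes t :: "nat \<Rightarrow> 'b bijection list" and e :: "nat \<Rightarrow> nat \<Rightarrow> 'b"
  assumes p: "2 \<le> p" and n: "1 \<le> n" and len: "\<And>i. length (t i) = p"
    and lin: "\<And>i a. i \<in> {1..n} \<Longrightarrow> a \<in> set (t i) \<Longrightarrow> lin_op (app a)"
    and disp: "\<And>i k. i \<in> {1..n} \<Longrightarrow> k < p \<Longrightarrow> displaces (span {e i k}) (t i ! k)"
    and range: "\<And>i k. i \<in> {1..n} \<Longrightarrow> k < p \<Longrightarrow> \<exists>u. e i k = app (t i ! k) u - u"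
    and eq: "\<And>i. i \<in> {1..n} \<Longrightarrow>
      block_act (concat (replicate (Suc n) (sigma_run 1 (n - 1)))) t i = ipow shift (\<tau> i) (t i)"
    and total: "sum \<tau> {1..n} = - 1"
  shows "dim {e i k | i k. i \<in> {1..n} \<and> k < p} < n * p"
proof (rule ccontr)
  assume full: "\<not> ?thesis"
  define \<chi> where "\<chi> = sum_list (t 1)"
  define D where "D = partial_sum t n"
  define g where "g = D + \<chi>"
  define z where "z = multiple n g"
  define y where "y = - multiple (Suc n) \<chi> + z"
  note torus = block_torus_colouring[OF len n eq total, folded D_def, folded \<chi>_def, folded g_def,
      folded z_def, folded y_def]
  have zD: "z = multiple (Suc n) D"
    using torus(1) by simp
  obtain m where m: "n = Suc m"
    using n by (cases n) simp_all
  have lin_t: "lin_op (app (sum_list (t i)))" if "i \<in> {1..n}" for i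
    using lin[OF that] by (rule lin_op_app_sum_list)
  then have lin\<chi>: "lin_op (app \<chi>)"
    using n by (simp add: \<chi>_def)
  have linD: "lin_op (app D)"
    unfolding D_def partial_sum_def using lin_t by (intro lin_op_app_sum_list) (auto simp del: upt_Suc)
  have ling: "lin_op (app g)"
    unfolding g_def using lin\<chi> linD by (rule lin_op_app_plus[rotated])
  have lin_multiple: "lin_op (app (multiple k a))" if "lin_op (app a)" for k a
    using that by (auto intro!: lin_op_app_sum_list)
  have liny: "lin_op (app (- y))"
    unfolding y_def z_def by (intro lin_op_app_uminus lin_op_app_plus lin_multiple lin\<chi> ling)
  define V where "V = span (e 1 ` {..<p})"
  have V: "subspace V"
    by (simp add: V_def)
  have dispV: "displaces V a" if a: "a \<in> set (t 1)" for a
  proof -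
    obtain k where k: "k < p" "a = t 1 ! k"
      using a len by (metis in_set_conv_nth)
    have "span {e 1 k} \<subseteq> V"
      unfolding V_def using k(1) by (intro span_mono) auto
    then show ?thesis
      using disp[of 1 k] k n by (auto simp: displaces_def)
  qed
  have disp\<chi>: "displaces V \<chi>"
    unfolding \<chi>_def using V dispV by (rule displaces_sum_list)
  let ?B = "app (- D)" and ?G = "app (- g)" and ?X = "app \<chi>" and ?Y = "app (- z)"
  have linB: "lin_op (?B ^^ j)" for j
    using linD by (intro lin_op_funpow lin_op_app_uminus)
  have BG: "?B v = ?X (?G v)" for v
  proof -
    have "- D = \<chi> + - g"
      by (simp add: g_def minus_add diff_conv_add_uminus del: add_uminus_conv_diff)
    then show ?thesis
      by (simp only: app_plus)
  qed
  have funpow_uminus: "(app (- a) ^^ k) v = app (- multiple k a) v" for a :: "'b bijection" and k v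
    by (simp add: uminus_multiple app_multiple)
  have shift_y: "shift (t 1) = map (group_conj (- y)) (t 1)"
  proof -
    have "map (group_conj (- y)) (t 1) = map (group_conj (- y)) (map (group_conj y) (shift (t 1)))"
      using torus(3) by (simp add: shift_map_group_conj)
    then show ?thesis
      by simp
  qed
  have y\<chi>: "group_conj (- y) \<chi> = \<chi>"
    unfolding \<chi>_def using arg_cong[OF shift_y, of sum_list] by (simp add: sum_list_map_group_conj)
  \<comment> \<open>Conjugation by \<open>- y\<close> turns the first block into its shift, whose
    entries still displace into \<open>V\<close>; hence \<open>- y\<close> keeps the vectors of the
    block inside \<open>V\<close>.\<close>
  have yV: "app (- y) v \<in> V" if "v \<in> V" for v
  proof -
    have "app (- y) (e 1 k) \<in> V" if k: "k < p" for k
    proof -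
      have "group_conj (- y) (t 1 ! k) \<in> set (shift (t 1))"
        unfolding shift_y using k len by auto
      then have "displaces V (group_conj (- y) (t 1 ! k))"
        using set_shift_closed[of "t 1" "{a. displaces V a}"] dispV displaces_conj[OF V] by blast
      moreover obtain u where "e 1 k = app (t 1 ! k) u - u"
        using range[of 1 k] k n by auto
      ultimately show ?thesis
        using displacement_conj[OF liny] by blast
    qed
    then show ?thesis
      using lin_op_span[OF liny _ that[unfolded V_def], of "e 1 ` {..<p}"] by (auto simp: V_def)
  qed
  have zy: "- z = - y + - multiple (Suc n) \<chi>"
    by (simp only: y_def minus_add minus_minus add.assoc right_minus add_0_right)
  have disp_multiple: "displaces V (multiple k \<chi>)" for k
    using V disp\<chi> by (auto intro: displaces_sum_list)
  have YV: "?Y v \<in> V" if "v \<in> V" for v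
    unfolding zy app_plus by (intro yV displaces_stable[OF V _ that] displaces_uminus V disp_multiple)
  have comm: "?X (?Y v) = ?Y (?X v)" for v
  proof -
    have "\<chi> + - y = - y + \<chi>"
      using y\<chi> group_conj_add_self[of "- y" \<chi>] by simp
    moreover have "\<chi> + - multiple k \<chi> = - multiple k \<chi> + \<chi>" for k
    proof -
      have "multiple k (- \<chi>) + - \<chi> = - \<chi> + multiple k (- \<chi>)"
        using multiple_Suc'[of k "- \<chi>"] by simp
      then have "\<chi> + (multiple k (- \<chi>) + - \<chi>) + \<chi> = \<chi> + (- \<chi> + multiple k (- \<chi>)) + \<chi>"
        by simp
      then show ?thesis
        by (simp add: uminus_multiple add.assoc)
    qed
    ultimately have "\<chi> + - z = - z + \<chi>"
      unfolding zy by (metis add.assoc)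
    then show ?thesis
      by (metis app_plus)
  qed
  note expand = funpow_difference[where B = ?B and X = ?X, OF lin_op_app_uminus[OF linD] BG]
  define w where "w = (\<lambda>(j, k). (?B ^^ j) (e 1 k))"
  define I where "I = {..<n} \<times> {..<p}"
  have BV: "(?B ^^ j) v \<in> span (w ` I)" if "j < n" "v \<in> V" for j v
    using lin_op_span[OF linB _ that(2)[unfolded V_def], of j "w ` I"] that(1)
    by (force simp: w_def I_def intro: span_base)
  have GV: "(?G ^^ j) v \<in> span (w ` I)" if "j < n" "v \<in> V" for j v
  proof -
    have "(\<Sum>i<j. (?B ^^ i) (?X ((?G ^^ (j - i)) v) - (?G ^^ (j - i)) v)) \<in> span (w ` I)"
      using that(1) disp\<chi> by (intro span_sum BV) (auto simp: displaces_def)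
    from span_diff[OF BV[OF that] this] show ?thesis
      by (simp only: expand[of j v] add_diff_cancel_right')
  qed
  \<comment> \<open>Up to shifts, block \<open>i\<close> is the first block conjugated by a power of
    \<open>- g\<close>, so its vectors lie in the translate of \<open>V\<close> under
    \<open>?G ^^ (i - 1)\<close>; by \<open>GV\<close> the translates under \<open>?B\<close> cover
    this.\<close>
  have "e i k \<in> span (w ` I)" if ik: "i \<in> {1..n}" "k < p" for i k
  proof -
    define h where "h = - multiple (i - 1) g"
    have linh: "lin_op (app h)"
      unfolding h_def by (intro lin_op_app_uminus lin_multiple ling)
    have sub: "subspace (app h ` V)"
      using linh V by (rule lin_op_image_subspace)
    obtain r where r: "t i = ipow shift r (map (group_conj h) (t 1))"
      using torus(2)[of i] ik(1) unfolding h_def by blast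
    have "set (t i) \<subseteq> {a. displaces (app h ` V) a}"
      unfolding r using dispV displaces_conj_image[OF linh] displaces_conj[OF sub] displaces_uminus[OF sub]
      by (intro set_ipow_shift_closed) auto
    then have "displaces (app h ` V) (t i ! k)"
      using ik len by (metis mem_Collect_eq nth_mem subsetD)
    moreover obtain u where "e i k = app (t i ! k) u - u"
      using range[OF ik] by blast
    ultimately have "e i k \<in> app h ` V"
      by (simp add: displaces_def)
    moreover have "i - 1 < n"
      using ik by auto
    ultimately show ?thesis
      using GV[of "i - 1"] by (auto simp: h_def funpow_uminus)
  qed
  then have "{e i k | i k. i \<in> {1..n} \<and> k < p} \<subseteq> span (w ` I)"
    by blast
  moreover have finI: "finite I"
    by (simp add: I_def)
  ultimately have card: "card I \<le> dim (w ` I)"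
    using full dim_le_dim_finite[OF _ finI[THEN finite_imageI], of "{e i k | i k. i \<in> {1..n} \<and> k < p}" w] by (simp add: I_def)
  note ind = family_independent[OF finI card]
  have direct: "\<forall>j<Suc m. u j = 0" if uV: "\<And>j. u j \<in> V" and sum: "(\<Sum>j<Suc m. (?B ^^ j) (u j)) = 0" for u
  proof -
    have "\<exists>c. u j = (\<Sum>k<p. scale (c k) (e 1 k))" for j
      using uV[of j] unfolding V_def by (intro span_family) simp_all
    then obtain c where c: "\<And>j. u j = (\<Sum>k<p. scale (c j k) (e 1 k))"
      by metis
    have "(\<Sum>i\<in>I. scale (case i of (j, k) \<Rightarrow> c j k) (w i)) = 0"
    proof -
      have "(\<Sum>i\<in>I. scale (case i of (j, k) \<Rightarrow> c j k) (w i))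
          = (\<Sum>j<n. \<Sum>k<p. scale (c j k) ((?B ^^ j) (e 1 k)))"
        unfolding I_def sum.cartesian_product by (intro sum.cong) (auto simp: w_def)
      also have "\<dots> = (\<Sum>j<Suc m. (?B ^^ j) (u j))"
        unfolding m by (intro sum.cong refl) (simp add: c lin_opD[OF linB])
      finally show ?thesis
        using sum by simp
    qed
    from ind[OF this] have "c j k = 0" if "j < n" "k < p" for j k
      using that by (force simp: I_def)
    then show ?thesis
      using c m by simp
  qed
  have Gn: "(?G ^^ Suc m) v = ?Y v" and Bn: "(?B ^^ Suc (Suc m)) v = ?Y v" for v
    unfolding funpow_uminus z_def[unfolded m, symmetric] zD[unfolded m, symmetric] by simp_all
  have scalar: "app (- y) v = scale ((- 1) ^ m) v" if "v \<in> V" for v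
  proof -
    have "?Y ((?X ^^ Suc (Suc m)) v) = scale ((- 1) ^ m) v"
    proof (rule block_companion[of ?B ?G ?X ?Y V])
      show "inj ?Y"
        using bij_app bij_is_inj by blast
      show "lin_op ?B" "lin_op ?G" "lin_op ?Y"
        using lin_op_app_uminus linD ling lin_multiple[OF ling, of n] unfolding z_def by blast+
    qed (use lin\<chi> V disp\<chi> YV BG Gn Bn comm direct that in \<open>auto simp: displaces_def\<close>)
    moreover have "- y = - z + multiple (Suc n) \<chi>"
      by (simp add: y_def minus_add)
    ultimately show ?thesis
      by (simp only: app_plus app_multiple m)
  qed
  \<comment> \<open>Under \<open>shift\<close> the first entry moves to the end without being
    conjugated, so \<open>- y\<close> takes the last line of the block to the first one.\<close>
  have "app (- y) (e 1 (p - 1)) \<in> span {e 1 0}"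
  proof -
    obtain u where "e 1 (p - 1) = app (t 1 ! (p - 1)) u - u"
      using range[of 1 "p - 1"] p n by auto
    moreover have "group_conj (- y) (t 1 ! (p - 1)) = t 1 ! 0"
    proof -
      have "shift (t 1) ! (p - 1) = t 1 ! 0"
        using len[of 1] p by (cases "t 1") (auto simp: nth_append)
      then show ?thesis
        using shift_y len[of 1] p by simp
    qed
    moreover have "displaces (span {e 1 0}) (t 1 ! 0)"
      using disp[of 1 0] p n by simp
    ultimately show ?thesis
      using displacement_conj[OF liny] by metis
  qed
  moreover have "e 1 (p - 1) \<in> V"
    unfolding V_def using p by (intro span_base) auto
  ultimately have "scale ((- 1) ^ m) (e 1 (p - 1)) \<in> span {e 1 0}"
    by (simp add: scalar)
  then have "scale ((- 1) ^ m) (scale ((- 1) ^ m) (e 1 (p - 1))) \<in> span {e 1 0}"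
    by (rule span_scale)
  then have "e 1 (p - 1) \<in> span {e 1 0}"
    by (simp add: power_mult_distrib[symmetric])
  then obtain c where c: "e 1 (p - 1) = scale c (e 1 0)"
    by (auto simp: span_singleton)
  \<comment> \<open>Coefficients of the relation between the last and the first vector of the block.
    Their indices differ because \<open>p\<close> is at least 2, so this contradicts
    independence.\<close>
  define d where "d = (\<lambda>i. if i = (0 :: nat, p - 1) then 1 else if i = (0, 0) then - c else (0 :: 'a))"
  have "(\<Sum>i\<in>I. scale (d i) (w i)) = (\<Sum>i\<in>{(0, p - 1), (0, 0)}. scale (d i) (w i))"
    using p n by (intro sum.mono_neutral_right finI) (auto simp: I_def d_def)
  also have "\<dots> = 0"
    using p c by (simp add: d_def w_def)
  finally have "d (0, p - 1) = 0"
    using p n by (intro ind) (auto simp: I_def)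
  then show False
    by (simp add: d_def)
qed

end

section \<open>Reflections\<close>

lemma inverse_pair:
  fixes x y a :: complex
  assumes "x * y = 1"
  shows "x * a - (a + x * a * (1 - y)) = 0" "x * (a - a * (1 - y)) - a = 0"
    "a + x * a * (1 - y) = x * a" "x * a * y = a"
proof -
  have e: "x * a * y = a"
    using assms by (simp add: mult.commute mult.left_commute)
  show "x * a - (a + x * a * (1 - y)) = 0" "x * (a - a * (1 - y)) - a = 0"
    "a + x * a * (1 - y) = x * a" "x * a * y = a"
    using e by (simp_all add: right_diff_distrib mult.assoc)
qed

lemma exp_minus_cancel: "exp (- a) * exp a = (1 :: complex)" "exp a * exp (- a) = (1 :: complex)"
  by (simp_all flip: exp_add)

text \<open>In its uses \<open>\<pi>\<close> is the identity or a projection onto the column space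
  of an augmentation. Covectors are required to factor through it, so that they can be compared on
  its range alone. The number \<open>\<theta>\<close> is a logarithm of the value of
  \<open>mu\<close>.\<close>

locale reflection_space = ambient_space scale
  for scale :: "complex \<Rightarrow> 'b::ab_group_add \<Rightarrow> 'b" (infixr \<open>*s\<close> 75) +
  fixes \<pi> :: "'b \<Rightarrow> 'b" and \<theta> :: complex
  assumes exp_theta: "exp \<theta> \<noteq> 1"
begin

definition functional :: "('b \<Rightarrow> complex) \<Rightarrow> bool" where
  "functional f \<longleftrightarrow> (\<forall>u v. f (u + v) = f u + f v) \<and> (\<forall>c v. f (c *s v) = c * f v)"

lemma functionalD:
  assumes "functional f"
  shows "f (u + v) = f u + f v" "f (c *s v) = c * f v" "f 0 = 0" "f (- v) = - f v" "f (u - v) = f u - f v"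
proof -
  show add: "f (u + v) = f u + f v" and scale: "f (c *s v) = c * f v" for u v c
    using assms by (auto simp: functional_def)
  show "f 0 = 0"
    using scale[of 0 0] by simp
  show minus: "f (- v) = - f v" for v
    using scale[of "- 1" v] by simp
  show "f (u - v) = f u - f v"
    using add[of u "- v"] minus[of v] by simp
qed

lemma functional_eq_on_span:
  assumes "functional f" "functional g" "\<And>x. x \<in> A \<Longrightarrow> f x = g x" "x \<in> span A"
  shows "f x = g x"
  using assms(4)
  by (induction rule: span_induct_alt) (simp_all add: functionalD[OF assms(1)] functionalD[OF assms(2)] assms(3))

type_synonym 'v reflection = "'v \<times> ('v \<Rightarrow> complex)"

text \<open>The normalisation makes \<open>exp \<theta>\<close> the eigenvalue of the reflection on
  its own vector.\<close>

definition reflections :: "'b reflection set" where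
  "reflections = {(e, f). functional f \<and> f \<circ> \<pi> = f \<and> f e = 1 - exp \<theta>}"

definition reflect :: "'b reflection \<Rightarrow> 'b \<Rightarrow> 'b" where
  "reflect x v = v - snd x v *s fst x"

definition reflect_inv :: "'b reflection \<Rightarrow> 'b \<Rightarrow> 'b" where
  "reflect_inv x v = v + (exp (- \<theta>) * snd x v) *s fst x"

definition reflect_op :: "'b reflection \<Rightarrow> 'b reflection \<Rightarrow> 'b reflection" where
  "reflect_op x y = (reflect x (fst y), snd y \<circ> reflect_inv x)"

definition reflect_opi :: "'b reflection \<Rightarrow> 'b reflection \<Rightarrow> 'b reflection" where
  "reflect_opi x y = (reflect_inv x (fst y), snd y \<circ> reflect x)"

text \<open>Opposite rescalings of vector and covector leave the reflection itself unchanged; the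
  exponential turns composition of rescalings into addition.\<close>

definition reflect_tw :: "complex \<Rightarrow> 'b reflection \<Rightarrow> 'b reflection" where
  "reflect_tw a x = (exp a *s fst x, \<lambda>v. exp (- a) * snd x v)"

lemma reflect_Pair: "reflect (e, f) v = v - f v *s e" "reflect_inv (e, f) v = v + (exp (- \<theta>) * f v) *s e"
  by (simp_all add: reflect_def reflect_inv_def)

lemma reflectionsD:
  assumes "x \<in> reflections"
  shows "functional (snd x)" "snd x (fst x) = 1 - exp \<theta>" "snd x (\<pi> v) = snd x v"
  using assms by (auto simp: reflections_def o_def fun_eq_iff)

lemma lin_op_reflect: "x \<in> reflections \<Longrightarrow> lin_op (reflect x)" "x \<in> reflections \<Longrightarrow> lin_op (reflect_inv x)"
  by (auto simp: lin_op_def reflect_def reflect_inv_def functionalD[OF reflectionsD(1)] algebra_simps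
      scale_left_distrib scale_right_distrib scale_right_diff_distrib)

lemma reflect_reflect_inv:
  assumes x: "x \<in> reflections"
  shows "reflect x (reflect_inv x v) = v" "reflect_inv x (reflect x v) = v"
proof -
  note c = inverse_pair(1,2)[OF exp_minus_cancel(1)[of \<theta>]]
  have "reflect x (reflect_inv x v) = v + (exp (- \<theta>) * snd x v - (snd x v + exp (- \<theta>) * snd x v * (1 - exp \<theta>))) *s fst x"
    by (simp add: reflect_def reflect_inv_def functionalD[OF reflectionsD(1)[OF x]] reflectionsD(2)[OF x]
        scale_left_diff_distrib scale_left_distrib)
  then show "reflect x (reflect_inv x v) = v"
    unfolding c by simp
  have "reflect_inv x (reflect x v) = v + (exp (- \<theta>) * (snd x v - snd x v * (1 - exp \<theta>)) - snd x v) *s fst x"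
    by (simp add: reflect_def reflect_inv_def functionalD[OF reflectionsD(1)[OF x]] reflectionsD(2)[OF x]
        scale_left_diff_distrib scale_left_distrib algebra_simps)
  then show "reflect_inv x (reflect x v) = v"
    unfolding c by simp
qed

lemma reflect_op_closed:
  assumes "x \<in> reflections" "y \<in> reflections"
  shows "reflect_op x y \<in> reflections" "reflect_opi x y \<in> reflections"
proof -
  have "functional (snd y \<circ> reflect x)" "functional (snd y \<circ> reflect_inv x)"
    using lin_op_reflect[OF assms(1)] functionalD[OF reflectionsD(1)[OF assms(2)]]
    by (auto simp: functional_def lin_op_def)
  moreover have "snd y (reflect x (\<pi> v)) = snd y (reflect x v)" "snd y (reflect_inv x (\<pi> v)) = snd y (reflect_inv x v)" for v
    using functionalD[OF reflectionsD(1)[OF assms(2)]] reflectionsD(3)[OF assms(1)] reflectionsD(3)[OF assms(2)]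
    by (simp_all add: reflect_def reflect_inv_def)
  ultimately show "reflect_op x y \<in> reflections" "reflect_opi x y \<in> reflections"
    using reflectionsD(2)[OF assms(2)] reflect_reflect_inv[OF assms(1)]
    by (auto simp: reflect_op_def reflect_opi_def reflections_def fun_eq_iff)
qed

lemma reflect_of_op:
  assumes x: "x \<in> reflections"
  shows "reflect (reflect_op x y) v = reflect x (reflect y (reflect_inv x v))"
    "reflect_inv (reflect_op x y) v = reflect x (reflect_inv y (reflect_inv x v))"
    "reflect (reflect_opi x y) v = reflect_inv x (reflect y (reflect x v))"
  using lin_opD[OF lin_op_reflect(1)[OF x]] lin_opD[OF lin_op_reflect(2)[OF x]] reflect_reflect_inv[OF x]
  by (simp_all add: reflect_op_def reflect_opi_def reflect_Pair reflect_def[of y] reflect_inv_def[of y])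

lemma reflect_tw_closed: "x \<in> reflections \<Longrightarrow> reflect_tw a x \<in> reflections"
  using reflectionsD[of x]
  by (auto simp: reflect_tw_def reflections_def functional_def fun_eq_iff exp_minus_cancel algebra_simps)

lemma reflect_of_tw: "reflect (reflect_tw a x) = reflect x" "reflect_inv (reflect_tw a x) = reflect_inv x"
proof -
  have "exp (- a) * b * exp a = b" for b :: complex
    using inverse_pair(4)[OF exp_minus_cancel(1)] .
  then show "reflect (reflect_tw a x) = reflect x" "reflect_inv (reflect_tw a x) = reflect_inv x"
    by (simp_all add: reflect_def reflect_inv_def reflect_tw_def fun_eq_iff mult.assoc)
qed

text \<open>A reflection acts on its own vector by \<open>exp \<theta>\<close> and on its own
  covector by the inverse factor, so a kink is the twist \<open>\<theta>\<close>.\<close>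

lemma reflection_rack: "twisted_rack reflections reflect_op reflect_opi reflect_tw \<theta>"
proof
  fix x y z :: "'b reflection" and a b :: complex
  assume x: "x \<in> reflections"
  note lins = lin_opD[OF lin_op_reflect(1)[OF x]] lin_opD[OF lin_op_reflect(2)[OF x]]
  show "reflect_tw a x \<in> reflections"
    using x by (rule reflect_tw_closed)
  show "reflect_tw 0 x = x"
    by (simp add: reflect_tw_def)
  show "reflect_tw (a + b) x = reflect_tw a (reflect_tw b x)"
  proof -
    have e: "exp (- (a + b)) = exp (- a) * exp (- b)"
      by (simp flip: exp_add)
    show ?thesis
      by (simp only: reflect_tw_def e exp_add fst_conv snd_conv scale_scale mult.assoc)
  qed
  show "reflect_op x x = reflect_tw \<theta> x"
  proof -
    have "reflect x (fst x) = exp \<theta> *s fst x"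
      unfolding reflect_def reflectionsD(2)[OF x] by (simp add: scale_left_diff_distrib)
    moreover have "snd x (reflect_inv x v) = exp (- \<theta>) * snd x v" for v
    proof -
      have "snd x (reflect_inv x v) = snd x v + exp (- \<theta>) * snd x v * (1 - exp \<theta>)"
        by (simp add: reflect_inv_def functionalD[OF reflectionsD(1)[OF x]] reflectionsD(2)[OF x])
      then show ?thesis
        by (simp only: inverse_pair(3)[OF exp_minus_cancel(1)])
    qed
    ultimately show ?thesis
      by (auto simp: reflect_op_def reflect_tw_def)
  qed
  assume y: "y \<in> reflections"
  show "reflect_op x y \<in> reflections" "reflect_opi x y \<in> reflections"
    using reflect_op_closed x y by auto
  show "reflect_op x (reflect_opi x y) = y" "reflect_opi x (reflect_op x y) = y"
    using reflect_reflect_inv[OF x] by (auto simp: reflect_op_def reflect_opi_def o_def)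
  show "reflect_op (reflect_tw a x) y = reflect_op x y"
    by (simp add: reflect_op_def reflect_of_tw)
  show "reflect_op x (reflect_tw a y) = reflect_tw a (reflect_op x y)"
    by (auto simp: reflect_op_def reflect_tw_def lins)
  assume "z \<in> reflections"
  have 1: "reflect_op x (reflect_op y z) = (reflect x (reflect y (fst z)), snd z \<circ> reflect_inv y \<circ> reflect_inv x)"
    by (simp add: reflect_op_def)
  have 2: "reflect_op u (reflect_op x z) = (reflect u (reflect x (fst z)), snd z \<circ> reflect_inv x \<circ> reflect_inv u)" for u
    by (simp add: reflect_op_def)
  show "reflect_op x (reflect_op y z) = reflect_op (reflect_op x y) (reflect_op x z)"
    unfolding 1 2 by (simp add: reflect_of_op[OF x] reflect_reflect_inv[OF x] o_def)
qed

sublocale rack: twisted_rack reflections reflect_op reflect_opi reflect_tw \<theta>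
  by (rule reflection_rack)

text \<open>Applied to the span of the vectors of a new colouring, this shows that Markov moves do
  not lower the dimension spanned.\<close>

lemma subrack_line_in:
  assumes "subspace W"
  shows "rack.subrack {x \<in> reflections. fst x \<in> W}"
proof -
  have "fst (reflect_op x y) \<in> W \<and> fst (reflect_opi x y) \<in> W" if "fst x \<in> W" "fst y \<in> W" for x y :: "'b reflection"
    using assms that
    by (simp add: reflect_op_def reflect_opi_def reflect_def reflect_inv_def subspace_diff subspace_add subspace_scale)
  moreover have "fst (reflect_tw a x) \<in> W" if "fst x \<in> W" for a and x :: "'b reflection"
    using assms that by (simp add: reflect_tw_def subspace_scale)
  ultimately show ?thesis
    unfolding rack.subrack_def
    by (intro conjI ballI allI) (simp_all add: reflect_op_closed reflect_tw_closed del: split_paired_All)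
qed

text \<open>Passing to the underlying bijection forgets the scale of the vector and thereby all
  twists.\<close>

definition elt :: "'b reflection \<Rightarrow> 'b bijection" where
  "elt x = Bij (reflect x)"

lemma app_elt:
  assumes "x \<in> reflections"
  shows "app (elt x) = reflect x"
proof -
  have "bij (reflect x)"
    using reflect_reflect_inv[OF assms] by (intro o_bij[of "reflect_inv x"]) (simp_all add: fun_eq_iff)
  then show ?thesis
    by (simp add: elt_def Bij_inverse)
qed

lemma app_elt_uminus:
  assumes "x \<in> reflections"
  shows "app (- elt x) v = reflect_inv x v"
proof -
  have "app (- elt x) v = reflect_inv x (app (elt x) (app (- elt x) v))"
    by (simp only: app_elt[OF assms] reflect_reflect_inv[OF assms])
  then show ?thesis
    by simp
qed

lemma bijection_eqI: "(\<And>v. app a v = app b v) \<Longrightarrow> a = b"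
  by (metis app_inject ext)

lemma elt_op:
  assumes "x \<in> reflections" "y \<in> reflections"
  shows "elt (reflect_op x y) = group_conj (elt x) (elt y)" "elt (reflect_opi x y) = group_conj (- elt x) (elt y)"
  using assms reflect_op_closed[OF assms]
  by (auto intro!: bijection_eqI simp: group_conj_def diff_conv_add_uminus app_elt app_elt_uminus reflect_of_op
      simp del: add_uminus_conv_diff)

lemma elt_tw: "elt (reflect_tw a x) = elt x"
  by (simp add: elt_def reflect_of_tw)

lemma conj_act_elt:
  assumes "\<And>i. x i \<in> reflections"
  shows "conj_act w (\<lambda>i. elt (x i)) = (\<lambda>i. elt (rack.act w x i))"
  using assms
proof (induction w arbitrary: x)
  case (Cons c w)
  have "hurwitz group_conj (\<lambda>x. group_conj (- x)) c (\<lambda>i. elt (x i)) = (\<lambda>i. elt (hurwitz reflect_op reflect_opi c x i))"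
    using Cons.prems by (cases c) (auto simp: hurwitz_def elt_op fun_eq_iff)
  then show ?case
    using Cons rack.hurwitz_in by simp
qed simp

end

section \<open>Full rank colourings and the simplex colouring\<close>

context reflection_space
begin

text \<open>
  The determinant of the coordinate matrix of the vectors changes sign at every crossing.
\<close>

lemma full_rank_colouring_norm:
  assumes b: "is_braid (n, w)" and col: "rack.colouring (n, w) \<kappa> x \<tau>"
    and full: "n \<le> dim ((\<lambda>i. fst (x i)) ` {1..n})"
  shows "Re (\<kappa> + of_int (writhe w) * \<theta>) = 0"
proof -
  have xR: "\<And>i. x i \<in> reflections" and eq: "\<And>i. i \<in> {1..n} \<Longrightarrow> rack.act w x i = reflect_tw (\<tau> i) (x i)"
    and sum: "sum \<tau> {1..n} = \<kappa> + of_int (writhe w) * \<theta>"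
    using col by (auto simp: rack.colouring_def)
  define e where "e = (\<lambda>j. fst (x (Suc j)))"
  have "(\<lambda>i. fst (x i)) ` {1..n} = e ` {..<n}"
    unfolding e_def image_Suc_lessThan[symmetric] by (auto simp: image_image)
  then have card: "card {..<n} \<le> dim (e ` {..<n})"
    using full by simp
  define coords where "coords M y \<longleftrightarrow> M \<in> carrier_mat n n \<and> cmod (det M) = 1
    \<and> (\<forall>i<n. fst (y (Suc i)) = (\<Sum>j<n. M $$ (i, j) *s e j))" for M :: "complex mat" and y :: "nat \<Rightarrow> 'b reflection"
  have step: "\<exists>M'. coords M' (hurwitz reflect_op reflect_opi c y)" if M: "coords M y" and c: "position c \<in> {1..<n}" for c M y
  proof -
    define k where "k = position c - 1"
    have k: "Suc k < n" "position c = Suc k"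
      using c by (auto simp: k_def)
    have Mc: "M \<in> carrier_mat n n" "cmod (det M) = 1"
      and My: "\<And>i. i < n \<Longrightarrow> fst (y (Suc i)) = (\<Sum>j<n. M $$ (i, j) *s e j)"
      using M by (auto simp: coords_def)
    \<comment> \<open>The acting vector moves unchanged and the other one gains a multiple of it: a
      row addition, of determinant 1, followed by a swap.\<close>
    define M' where "M' = swaprows k (Suc k) (case c of
        Pos _ \<Rightarrow> addrow (- snd (y (Suc k)) (fst (y (Suc (Suc k))))) (Suc k) k M
      | Neg _ \<Rightarrow> addrow (exp (- \<theta>) * snd (y (Suc (Suc k))) (fst (y (Suc k)))) k (Suc k) M)"
    have M': "M' \<in> carrier_mat n n"
      using Mc by (auto simp: M'_def split: crossing.split)
    have "det M' = - det M"
      using k Mc by (auto simp: M'_def det_swaprows[of _ n] det_addrow[of _ n] split: crossing.split)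
    moreover have "fst (hurwitz reflect_op reflect_opi c y (Suc i)) = (\<Sum>j<n. M' $$ (i, j) *s e j)" if "i < n" for i
    proof (cases c)
      case (Pos l)
      then show ?thesis
        using k Mc(1) that My[of i] My[of k] My[of "Suc k"]
        by (auto simp: hurwitz_def M'_def reflect_op_def reflect_def scale_left_distrib scale_left_diff_distrib
            sum.distrib sum_subtractf scale_sum_right)
    next
      case (Neg l)
      then show ?thesis
        using k Mc(1) that My[of i] My[of k] My[of "Suc k"]
        by (auto simp: hurwitz_def M'_def reflect_opi_def reflect_inv_def scale_left_distrib
            sum.distrib scale_sum_right add.commute)
    qed
    ultimately show ?thesis
      using M' Mc(2) unfolding coords_def by (intro exI[of _ M']) auto
  qed
  have "\<exists>M. coords M (rack.act w y)" if "\<exists>M. coords M y" for y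
    using that b
  proof (induction w arbitrary: y)
    case (Cons c w)
    then show ?case
      using step[of _ y c] by (auto simp: is_braid_iff)
  qed simp
  moreover have "coords (1\<^sub>m n) x"
  proof -
    have "(\<Sum>j<n. 1\<^sub>m n $$ (i, j) *s e j) = e i" if "i < n" for i
    proof -
      have "(\<Sum>j<n. 1\<^sub>m n $$ (i, j) *s e j) = (\<Sum>j<n. if j = i then e j else 0)"
        using that by (intro sum.cong) auto
      then show ?thesis
        using that by simp
    qed
    then show ?thesis
      by (simp add: coords_def e_def)
  qed
  ultimately obtain M where M: "M \<in> carrier_mat n n" "cmod (det M) = 1"
    and Mx: "\<And>i. i < n \<Longrightarrow> fst (rack.act w x (Suc i)) = (\<Sum>j<n. M $$ (i, j) *s e j)"
    unfolding coords_def by blast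
  \<comment> \<open>Full rank makes coordinates unique, so the closing condition forces the matrix
    to be diagonal with the exponentials of the twists as entries.\<close>
  have entry: "M $$ (i, j) = (if j = i then exp (\<tau> (Suc i)) else 0)" if ij: "i < n" "j < n" for i j
  proof -
    have "(\<Sum>j<n. (if j = i then exp (\<tau> (Suc i)) else 0) *s e j) = (\<Sum>j<n. if j = i then exp (\<tau> (Suc i)) *s e j else 0)"
      by (intro sum.cong) auto
    also have "\<dots> = exp (\<tau> (Suc i)) *s e i"
      using ij by simp
    also have "\<dots> = (\<Sum>j<n. M $$ (i, j) *s e j)"
      using Mx[OF ij(1)] eq[of "Suc i"] ij by (simp add: reflect_tw_def e_def)
    finally have "(\<Sum>j<n. (M $$ (i, j) - (if j = i then exp (\<tau> (Suc i)) else 0)) *s e j) = 0"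
      by (simp add: scale_left_diff_distrib sum_subtractf)
    from family_independent[OF _ card this, of j] show ?thesis
      using ij by simp
  qed
  have "upper_triangular M"
    using M(1) entry by (auto simp: upper_triangular_def)
  then have "det M = prod_list (diag_mat M)"
    using M(1) by (rule det_upper_triangular)
  also have "\<dots> = (\<Prod>i<n. M $$ (i, i))"
    using M(1) by (simp add: diag_mat_def prod.list_conv_set_nth atLeast0LessThan)
  also have "\<dots> = (\<Prod>i<n. exp (\<tau> (Suc i)))"
    using entry by (intro prod.cong) auto
  also have "\<dots> = exp (\<Sum>i<n. \<tau> (Suc i))"
    by (simp add: exp_sum)
  also have "(\<Sum>i<n. \<tau> (Suc i)) = sum \<tau> {1..n}"
    by (rule sum.reindex_bij_witness[of _ "\<lambda>i. i - 1" Suc]) auto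
  finally have "exp (Re (sum \<tau> {1..n})) = 1"
    using M(2) by (simp add: norm_exp_eq_Re)
  then have "Re (sum \<tau> {1..n}) = 0"
    by simp
  then show ?thesis
    by (simp only: sum)
qed

text \<open>
  Vertices of a simplex: any two differences pair like the standard configuration in which all
  \<open>a i j\<close> equal one, and $\sigma_1\cdots\sigma_{n-1}$ rotates the \<open>n + 1\<close> vertices up to signs.
\<close>

lemma simplex_rotation:
  assumes v0: "v 0 = 0" and f0: "f 0 = (\<lambda>_. 0)"
    and pair: "\<And>i j. i \<in> {1..n} \<Longrightarrow> j \<in> {1..n} \<Longrightarrow>
      f i (v j) = (if i < j then 1 else if j < i then - exp \<theta> else 1 - exp \<theta>)"
    and fun_f: "\<And>i. functional (f i)"
    and x: "\<And>i. i \<in> {1..n} \<Longrightarrow> x i = (v i, f i)"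
    and j: "j \<le> n" "1 \<le> i" "i \<le> n"
  shows "rack.act (concat (replicate j (sigma_run 1 (n - 1)))) x i =
    (if i + j \<le> n then (v (i + j) - v j, \<lambda>u. f (i + j) u - f j u)
     else (v j - v (i + j - n - 1), \<lambda>u. f j u - f (i + j - n - 1) u))"
  using j
proof (induction j arbitrary: i)
  case 0
  then show ?case
    by (simp add: x v0 f0)
next
  case (Suc j)
  let ?u = "rack.act (concat (replicate j (sigma_run 1 (n - 1)))) x"
  have pair': "f i (v j) = (if i = 0 \<or> j = 0 then 0 else if i < j then 1 else if j < i then - exp \<theta> else 1 - exp \<theta>)"
    if "i \<le> n" "j \<le> n" for i j
    using pair[of i j] that v0 f0 functionalD(3)[OF fun_f] by auto
  have u1: "?u 1 = (v (Suc j) - v j, \<lambda>u. f (Suc j) u - f j u)"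
    using Suc.IH[of 1] Suc.prems by simp
  \<comment> \<open>Two vertex differences occurring here pair as \<open>1\<close> and
    \<open>- exp \<theta>\<close>, or as the negatives of these; the operation then gives their
    difference or their sum, which is again a difference of vertices.\<close>
  have op: "reflect_op (a, g) (b, h) = (if g b = 1 \<and> h a = - exp \<theta> then (b - a, \<lambda>u. h u - g u) else (b + a, \<lambda>u. h u + g u))"
    if "functional h" "g b = 1 \<and> h a = - exp \<theta> \<or> g b = - 1 \<and> h a = exp \<theta>" for a b g h
    using that exp_minus_cancel(1)[of \<theta>]
    by (auto simp: reflect_op_def reflect_Pair functionalD[OF that(1)] fun_eq_iff mult.assoc[symmetric] mult.commute[of _ "exp \<theta>"]
        mult.left_commute[of _ "exp \<theta>"] exp_minus)
  show ?case
  proof (cases "i < n")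
    case True
    have funs: "functional (\<lambda>u. f k u - f l u)" for k l
      using functionalD(1,2)[OF fun_f] by (auto simp: functional_def algebra_simps)
    have "rack.act (concat (replicate (Suc j) (sigma_run 1 (n - 1)))) x i = reflect_op (?u 1) (?u (Suc i))"
      unfolding concat_replicate_Suc hurwitz_word_append hurwitz_sigma_run using True Suc.prems by auto
    also have "\<dots> = (if i + Suc j \<le> n then (v (i + Suc j) - v (Suc j), \<lambda>u. f (i + Suc j) u - f (Suc j) u)
     else (v (Suc j) - v (i + Suc j - n - 1), \<lambda>u. f (Suc j) u - f (i + Suc j - n - 1) u))"
    proof (cases "i + Suc j \<le> n")
      case True
      then have u: "?u (Suc i) = (v (i + Suc j) - v j, \<lambda>u. f (i + Suc j) u - f j u)"
        using Suc.IH[of "Suc i"] Suc.prems \<open>i < n\<close> by simp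
      show ?thesis
        using True Suc.prems unfolding u u1
        by (subst op[OF funs]) (auto simp: functionalD[OF fun_f] pair' fun_eq_iff)
    next
      case False
      define l where "l = i + Suc j - n - 1"
      have l: "l < j" "l \<le> n"
        using False True Suc.prems by (auto simp: l_def)
      have u: "?u (Suc i) = (v j - v l, \<lambda>u. f j u - f l u)"
        using Suc.IH[of "Suc i"] Suc.prems \<open>i < n\<close> False by (simp add: l_def)
      show ?thesis
        using False Suc.prems l unfolding u u1 l_def[symmetric]
        by (subst op[OF funs]) (auto simp: functionalD[OF fun_f] pair' fun_eq_iff)
    qed
    finally show ?thesis .
  next
    case False
    then have i: "i = n"
      using Suc.prems by simp
    show ?thesis
      unfolding concat_replicate_Suc hurwitz_word_append hurwitz_sigma_run
      using u1 Suc.prems i by auto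
  qed
qed

text \<open>One rotation after the first \<open>n\<close> brings every vertex back, with a sign
  except at the last position. A sign is the twist \<open>\<i> * of_real pi\<close>, so all twists
  have real part zero.\<close>

lemma simplex_colouring:
  assumes n: "2 \<le> n" and v0: "v 0 = 0" and f0: "f 0 = (\<lambda>_. 0)"
    and pair: "\<And>i j. i \<in> {1..n} \<Longrightarrow> j \<in> {1..n} \<Longrightarrow>
      f i (v j) = (if i < j then 1 else if j < i then - exp \<theta> else 1 - exp \<theta>)"
    and fun_f: "\<And>i. functional (f i)"
    and x: "\<And>i. i \<in> {1..n} \<Longrightarrow> x i = (v i, f i)"
    and i: "i \<in> {1..n}"
  shows "rack.act (concat (replicate (Suc n) (sigma_run 1 (n - 1)))) x i =
    reflect_tw (if i < n then \<i> * of_real pi else 0) (x i)"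
proof -
  let ?u = "rack.act (concat (replicate n (sigma_run 1 (n - 1)))) x"
  have u: "?u i = (v n - v (i - 1), \<lambda>u. f n u - f (i - 1) u)" if "1 \<le> i" "i \<le> n" for i
    using simplex_rotation[where v = v and f = f and n = n and x = x and j = n and i = i] v0 f0 pair fun_f x that
    by simp
  have u1: "?u 1 = (v n, f n)"
    using u[of 1] n by (simp add: v0 f0)
  show ?thesis
  proof (cases "i < n")
    case True
    have "f n (v n - v i) = 1"
      using True i n by (simp add: functionalD[OF fun_f] pair)
    moreover have "f n (v n) - f i (v n) = - exp \<theta>"
      using True i n by (simp add: pair)
    then have "f n u + exp (- \<theta>) * f n u * (f n (v n) - f i (v n)) = 0" for u
      by (simp only: mult_minus_right inverse_pair(4)[OF exp_minus_cancel(1)] add.right_inverse)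
    ultimately have "reflect_op (?u 1) (?u (Suc i)) = (- v i, \<lambda>u. - f i u)"
      using u[of "Suc i"] True i unfolding u1
      by (simp add: reflect_op_def reflect_Pair functionalD[OF fun_f] fun_eq_iff right_diff_distrib)
    moreover have "reflect_tw (\<i> * of_real pi) (x i) = (- v i, \<lambda>u. - f i u)"
      using i by (simp add: reflect_tw_def x exp_minus)
    ultimately show ?thesis
      unfolding concat_replicate_Suc hurwitz_word_append hurwitz_sigma_run using True i by auto
  next
    case False
    then have "i = n"
      using i by simp
    then show ?thesis
      unfolding concat_replicate_Suc hurwitz_word_append hurwitz_sigma_run
      using u1 x i n by (auto simp: reflect_tw_def)
  qed
qed

end

section \<open>The braid action on the free algebra\<close>

lemma sum_singles: "x = (\<Sum>w\<in>Poly_Mapping.keys x. Poly_Mapping.single w (Poly_Mapping.lookup x w))"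
proof (rule poly_mapping_eqI)
  fix k
  have "(\<Sum>w\<in>Poly_Mapping.keys x. if w = k then Poly_Mapping.lookup x w else 0) = Poly_Mapping.lookup x k"
    by (simp add: in_keys_iff)
  then show "Poly_Mapping.lookup x k =
      Poly_Mapping.lookup (\<Sum>w\<in>Poly_Mapping.keys x. Poly_Mapping.single w (Poly_Mapping.lookup x w)) k"
    by (simp add: lookup_sum lookup_single when_def)
qed

text \<open>The ring homomorphism with prescribed values on letters. With an arbitrary target ring
  it covers the substitutions, the extension of scalars and the evaluation at complex
  numbers.\<close>

definition hom_ext :: "(nat \<times> nat \<Rightarrow> 'b::ring_1) \<Rightarrow> int free_alg \<Rightarrow> 'b" where
  "hom_ext f x = (\<Sum>w\<in>Poly_Mapping.keys x. of_int (Poly_Mapping.lookup x w) * prod_list (map f w))"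

lemma subst_alg_eq: "subst_alg = hom_ext"
  by (simp add: fun_eq_iff subst_alg_def hom_ext_def)

lemma hom_ext_superset:
  assumes "finite A" "Poly_Mapping.keys x \<subseteq> A"
  shows "hom_ext f x = (\<Sum>w\<in>A. of_int (Poly_Mapping.lookup x w) * prod_list (map f w))"
  unfolding hom_ext_def using assms by (intro sum.mono_neutral_left) (auto simp: in_keys_iff)

lemma hom_ext_single: "hom_ext f (Poly_Mapping.single w c) = of_int c * prod_list (map f w)"
  by (subst hom_ext_superset[of "{w}"]) (auto split: if_splits)

lemma hom_ext_zero [simp]: "hom_ext f 0 = 0"
  by (simp add: hom_ext_def)

lemma hom_ext_plus [simp]: "hom_ext f (x + y) = hom_ext f x + hom_ext f y"
  using keys_add[of x y]
  by (simp add: hom_ext_superset[of "Poly_Mapping.keys x \<union> Poly_Mapping.keys y"] lookup_add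
      algebra_simps sum.distrib)

lemma hom_ext_sum [simp]: "hom_ext f (sum g A) = (\<Sum>i\<in>A. hom_ext f (g i))"
  by (induction A rule: infinite_finite_induct) simp_all

lemma hom_ext_uminus [simp]: "hom_ext f (- x) = - hom_ext f x"
  using hom_ext_plus[of f "- x" x] by (simp add: eq_neg_iff_add_eq_0)

lemma hom_ext_diff [simp]: "hom_ext f (x - y) = hom_ext f x - hom_ext f y"
  using hom_ext_plus[of f x "- y"] by simp

lemma hom_ext_mult [simp]: "hom_ext f (x * y) = hom_ext f x * hom_ext f y"
proof -
  have single: "hom_ext f (Poly_Mapping.single v a * Poly_Mapping.single w b)
      = hom_ext f (Poly_Mapping.single v a) * hom_ext f (Poly_Mapping.single w b)" for v w a b
    unfolding mult_single hom_ext_single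
    by (simp add: plus_list_def) (metis (no_types, opaque_lifting) mult.assoc mult_of_int_commute)
  let ?s = "\<lambda>x w. Poly_Mapping.single w (Poly_Mapping.lookup x w) :: int free_alg"
  have "hom_ext f (x * y) = hom_ext f ((\<Sum>w\<in>Poly_Mapping.keys x. ?s x w) * (\<Sum>w\<in>Poly_Mapping.keys y. ?s y w))"
    by (simp only: sum_singles[symmetric])
  also have "\<dots> = hom_ext f (\<Sum>w\<in>Poly_Mapping.keys x. ?s x w) * hom_ext f (\<Sum>w\<in>Poly_Mapping.keys y. ?s y w)"
    by (simp add: sum_distrib_left sum_distrib_right single)
  finally show ?thesis
    by (simp only: sum_singles[symmetric])
qed

lemma single_Nil: "Poly_Mapping.single [] 1 = (1 :: 'r::comm_ring_1 free_alg)"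
  unfolding zero_list_def[symmetric] by simp

lemma hom_ext_one [simp]: "hom_ext f 1 = 1"
  using hom_ext_single[of f "[]" 1] by (simp add: single_Nil)

lemma hom_ext_of_int [simp]: "hom_ext f (of_int c) = of_int c"
proof -
  have "hom_ext f (of_nat k) = of_nat k" for k
    by (induction k) simp_all
  then show ?thesis
    by (cases c) simp_all
qed

lemma hom_ext_prod_list: "hom_ext f (prod_list xs) = prod_list (map (hom_ext f) xs)"
  by (induction xs) simp_all

lemma hom_ext_gen [simp]: "hom_ext f (gen i j) = f (i, j)"
  by (simp add: gen_def hom_ext_single)

lemma hom_ext_hom_ext: "hom_ext f (hom_ext g x) = hom_ext (\<lambda>l. hom_ext f (g l)) x"
  by (simp add: hom_ext_def[of g] hom_ext_def[of "\<lambda>l. hom_ext f (g l)"] hom_ext_prod_list o_def)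

lemma prod_list_gen: "prod_list (map (\<lambda>(i, j). gen i j) w) = (Poly_Mapping.single w 1 :: 'r::comm_ring_1 free_alg)"
  by (induction w) (auto simp: single_Nil gen_def mult_single plus_list_def)

lemma of_int_mult_single:
  "of_int c * (Poly_Mapping.single w 1 :: 'r::comm_ring_1 free_alg) = Poly_Mapping.single w (of_int c)"
  by (simp add: single_of_int[symmetric] mult_single del: single_of_int)

lemma hom_ext_gen_gen: "hom_ext (\<lambda>(i, j). gen i j) x = x"
  unfolding hom_ext_def prod_list_gen of_int_mult_single by (simp flip: sum_singles)

lemma hom_ext_cong:
  "(\<And>w l. w \<in> Poly_Mapping.keys x \<Longrightarrow> l \<in> set w \<Longrightarrow> f l = g l) \<Longrightarrow> hom_ext f x = hom_ext g x"
  unfolding hom_ext_def by (intro sum.cong arg_cong[where f = prod_list] arg_cong2[where f = "(*)"] map_cong) auto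

section \<open>The subalgebra on letters of bounded index\<close>

lemma algD: "x \<in> alg n \<Longrightarrow> w \<in> Poly_Mapping.keys x \<Longrightarrow> (i, j) \<in> set w \<Longrightarrow> i \<noteq> j \<and> i \<in> {1..n} \<and> j \<in> {1..n}"
  by (fastforce simp: alg_def)

lemma alg_plus: "x \<in> alg n \<Longrightarrow> y \<in> alg n \<Longrightarrow> x + y \<in> alg n"
  using keys_add[of x y] unfolding alg_def by blast

lemma alg_uminus: "x \<in> alg n \<Longrightarrow> - x \<in> alg n"
  by (simp add: alg_def in_keys_iff)

lemma alg_diff: "x \<in> alg n \<Longrightarrow> y \<in> alg n \<Longrightarrow> x - y \<in> alg n"
  using alg_plus[of x n "- y"] alg_uminus[of y n] by simp

lemma alg_mult:
  assumes "x \<in> alg n" "y \<in> alg n"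
  shows "x * y \<in> alg n"
  unfolding alg_def
proof (intro CollectI ballI)
  fix w l assume w: "w \<in> Poly_Mapping.keys (x * y)" and l: "l \<in> set w"
  obtain u v where "u \<in> Poly_Mapping.keys x" "v \<in> Poly_Mapping.keys y" "w = u @ v"
    using w keys_mult[of x y] by (auto simp: plus_list_def)
  then show "case l of (i, j) \<Rightarrow> i \<noteq> j \<and> 1 \<le> i \<and> i \<le> n \<and> 1 \<le> j \<and> j \<le> n"
    using l assms unfolding alg_def by auto
qed

lemma alg_single_Nil [simp]: "Poly_Mapping.single [] c \<in> alg n"
  by (auto simp: alg_def split: if_splits)

lemma alg_one [simp]: "1 \<in> alg n" and alg_zero [simp]: "0 \<in> alg n"
  using alg_single_Nil[of 1 n] alg_single_Nil[of 0 n] by (simp_all add: single_Nil)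

lemma alg_gen: "i \<noteq> j \<Longrightarrow> i \<in> {1..n} \<Longrightarrow> j \<in> {1..n} \<Longrightarrow> gen i j \<in> alg n"
  by (auto simp: alg_def gen_def)

lemma alg_sum: "(\<And>i. i \<in> A \<Longrightarrow> f i \<in> alg n) \<Longrightarrow> sum f A \<in> alg n"
  by (induction A rule: infinite_finite_induct) (auto intro: alg_plus)

lemma alg_of_int: "(of_int c :: 'r::comm_ring_1 free_alg) \<in> alg n"
proof -
  have "(of_nat k :: 'r free_alg) \<in> alg n" for k
    by (induction k) (auto intro: alg_plus)
  then show ?thesis
    by (cases c) (auto intro: alg_uminus alg_diff alg_one)
qed

lemma alg_prod_list: "(\<And>x. x \<in> set xs \<Longrightarrow> x \<in> alg n) \<Longrightarrow> prod_list xs \<in> alg n"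
  by (induction xs) (auto intro: alg_mult)

lemma hom_ext_alg:
  fixes f :: "nat \<times> nat \<Rightarrow> 'r::comm_ring_1 free_alg"
  assumes "x \<in> alg n" "\<And>i j. i \<noteq> j \<Longrightarrow> i \<in> {1..n} \<Longrightarrow> j \<in> {1..n} \<Longrightarrow> f (i, j) \<in> alg m"
  shows "hom_ext f x \<in> alg m"
  unfolding hom_ext_def
  using algD[OF assms(1)] assms(2) by (intro alg_sum alg_mult alg_of_int alg_prod_list) fastforce

lemma extend_scalars_eq: "extend_scalars x = hom_ext (\<lambda>(i, j). gen i j) x"
  unfolding hom_ext_def prod_list_gen of_int_mult_single
proof (rule poly_mapping_eqI)
  fix k
  have "(\<Sum>w\<in>Poly_Mapping.keys x. if w = k then of_int (Poly_Mapping.lookup x w) else 0) = (of_int (Poly_Mapping.lookup x k) :: laurent)"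
    by (simp add: in_keys_iff)
  then show "Poly_Mapping.lookup (extend_scalars x) k = Poly_Mapping.lookup
      (\<Sum>w\<in>Poly_Mapping.keys x. Poly_Mapping.single w (of_int (Poly_Mapping.lookup x w))) k"
    by (simp add: extend_scalars_def lookup_sum lookup_single when_def Poly_Mapping.map.rep_eq)
qed

definition phi_inv_letter :: "nat \<Rightarrow> nat \<times> nat \<Rightarrow> int free_alg" where
  "phi_inv_letter k = (\<lambda>(i, j).
     if i = j then gen i j
     else if i = k \<and> j = k + 1 then - gen (k + 1) k
     else if i = k + 1 \<and> j = k then - gen k (k + 1)
     else if i = k then gen (k + 1) j
     else if j = k then gen i (k + 1)
     else if i = k + 1 then gen k j - gen k (k + 1) * gen (k + 1) j
     else if j = k + 1 then gen i k - gen i (k + 1) * gen (k + 1) k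
     else gen i j)"

text \<open>Both composites of the two substitutions fix every letter, so they are the identity and
  the abstract inverse has explicit formulas.\<close>

lemma phi_crossing_Neg: "phi_crossing (Neg k) = hom_ext (phi_inv_letter k)"
proof -
  have "hom_ext (phi_letter k) (phi_inv_letter k l) = (case l of (i, j) \<Rightarrow> gen i j)"
    "hom_ext (phi_inv_letter k) (phi_letter k l) = (case l of (i, j) \<Rightarrow> gen i j)" for l
    by (cases l; auto simp: phi_letter_def phi_inv_letter_def algebra_simps)+
  then have "hom_ext (phi_letter k) (hom_ext (phi_inv_letter k) x) = x"
    "hom_ext (phi_inv_letter k) (hom_ext (phi_letter k) x) = x" for x
    by (simp_all add: hom_ext_hom_ext hom_ext_gen_gen)
  then show ?thesis
    by (simp add: subst_alg_eq inv_equality)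
qed

definition crossing_letter :: "crossing \<Rightarrow> nat \<times> nat \<Rightarrow> int free_alg" where
  "crossing_letter c = (case c of Pos k \<Rightarrow> phi_letter k | Neg k \<Rightarrow> phi_inv_letter k)"

lemma phi_crossing_eq: "phi_crossing c = hom_ext (crossing_letter c)"
  by (cases c) (simp_all add: crossing_letter_def phi_crossing_Neg subst_alg_eq del: phi_crossing.simps(2))

lemma crossing_letter_alg:
  assumes "position c \<in> {1..<n}" "i \<noteq> j" "i \<in> {1..n}" "j \<in> {1..n}"
  shows "crossing_letter c (i, j) \<in> alg n"
  using assms
  by (cases c) (auto simp: crossing_letter_def phi_letter_def phi_inv_letter_def
      intro!: alg_uminus alg_diff alg_mult alg_gen)

text \<open>The left module over \<open>alg n\<close> generated by the letters ending in the extra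
  strand. Its stability under the braid action provides the matrix that the choice operator in
  \<open>PhiL\<close> asks for.\<close>

definition left_span :: "nat \<Rightarrow> int free_alg set" where
  "left_span n = {x. \<exists>M. (\<forall>j<n. M j \<in> alg n) \<and> x = (\<Sum>j<n. M j * gen (j + 1) (n + 1))}"

definition right_span :: "nat \<Rightarrow> int free_alg set" where
  "right_span n = {x. \<exists>M. (\<forall>j<n. M j \<in> alg n) \<and> x = (\<Sum>j<n. gen (n + 1) (j + 1) * M j)}"

lemma left_span_diff: "x \<in> left_span n \<Longrightarrow> y \<in> left_span n \<Longrightarrow> x - y \<in> left_span n"
  unfolding left_span_def
proof (elim CollectE exE conjE, intro CollectI exI conjI)
  fix M N
  assume "\<forall>j<n. M j \<in> alg n" "\<forall>j<n. N j \<in> alg n"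
    "x = (\<Sum>j<n. M j * gen (j + 1) (n + 1))" "y = (\<Sum>j<n. N j * gen (j + 1) (n + 1))"
  then show "\<forall>j<n. M j - N j \<in> alg n" "x - y = (\<Sum>j<n. (M j - N j) * gen (j + 1) (n + 1))"
    by (auto intro: alg_diff simp: left_diff_distrib sum_subtractf)
qed

lemma left_span_mult: "a \<in> alg n \<Longrightarrow> x \<in> left_span n \<Longrightarrow> a * x \<in> left_span n"
  unfolding left_span_def
proof (elim CollectE exE conjE, intro CollectI exI conjI)
  fix M
  assume "a \<in> alg n" "\<forall>j<n. M j \<in> alg n" "x = (\<Sum>j<n. M j * gen (j + 1) (n + 1))"
  then show "\<forall>j<n. a * M j \<in> alg n" "a * x = (\<Sum>j<n. (a * M j) * gen (j + 1) (n + 1))"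
    by (auto intro: alg_mult simp: sum_distrib_left mult.assoc)
qed

lemma left_span_zero: "0 \<in> left_span n"
  unfolding left_span_def by (intro CollectI exI[of _ "\<lambda>_. 0"]) simp

lemma left_span_sum: "(\<And>i. i \<in> A \<Longrightarrow> f i \<in> left_span n) \<Longrightarrow> sum f A \<in> left_span n"
proof (induction A rule: infinite_finite_induct)
  case (insert i A)
  have "f i - (0 - sum f A) \<in> left_span n"
    using insert by (intro left_span_diff left_span_zero) auto
  then show ?case
    using insert by simp
qed (simp_all add: left_span_zero)

lemma left_span_gen:
  assumes "i \<in> {1..n}"
  shows "gen i (n + 1) \<in> left_span n"
proof -
  have "(\<Sum>j<n. (if j = i - 1 then 1 else 0) * gen (j + 1) (n + 1)) = (\<Sum>j<n. if j = i - 1 then gen (j + 1) (n + 1) else 0)"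
    by (intro sum.cong) auto
  also have "\<dots> = (gen i (n + 1) :: int free_alg)"
    using assms by auto
  finally show ?thesis
    unfolding left_span_def by (intro CollectI exI[of _ "\<lambda>j. if j = i - 1 then 1 else 0"]) auto
qed

lemma right_span_diff: "x \<in> right_span n \<Longrightarrow> y \<in> right_span n \<Longrightarrow> x - y \<in> right_span n"
  unfolding right_span_def
proof (elim CollectE exE conjE, intro CollectI exI conjI)
  fix M N
  assume "\<forall>j<n. M j \<in> alg n" "\<forall>j<n. N j \<in> alg n"
    "x = (\<Sum>j<n. gen (n + 1) (j + 1) * M j)" "y = (\<Sum>j<n. gen (n + 1) (j + 1) * N j)"
  then show "\<forall>j<n. M j - N j \<in> alg n" "x - y = (\<Sum>j<n. gen (n + 1) (j + 1) * (M j - N j))"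
    by (auto intro: alg_diff simp: right_diff_distrib sum_subtractf)
qed

lemma right_span_mult: "a \<in> alg n \<Longrightarrow> x \<in> right_span n \<Longrightarrow> x * a \<in> right_span n"
  unfolding right_span_def
proof (elim CollectE exE conjE, intro CollectI exI conjI)
  fix M
  assume "a \<in> alg n" "\<forall>j<n. M j \<in> alg n" "x = (\<Sum>j<n. gen (n + 1) (j + 1) * M j)"
  then show "\<forall>j<n. M j * a \<in> alg n" "x * a = (\<Sum>j<n. gen (n + 1) (j + 1) * (M j * a))"
    by (auto intro: alg_mult simp: sum_distrib_right mult.assoc)
qed

lemma right_span_zero: "0 \<in> right_span n"
  unfolding right_span_def by (intro CollectI exI[of _ "\<lambda>_. 0"]) simp

lemma right_span_sum: "(\<And>i. i \<in> A \<Longrightarrow> f i \<in> right_span n) \<Longrightarrow> sum f A \<in> right_span n"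
proof (induction A rule: infinite_finite_induct)
  case (insert i A)
  have "f i - (0 - sum f A) \<in> right_span n"
    using insert by (intro right_span_diff right_span_zero) auto
  then show ?case
    using insert by simp
qed (simp_all add: right_span_zero)

lemma right_span_gen:
  assumes "i \<in> {1..n}"
  shows "gen (n + 1) i \<in> right_span n"
proof -
  have "(\<Sum>j<n. gen (n + 1) (j + 1) * (if j = i - 1 then 1 else 0)) = (\<Sum>j<n. if j = i - 1 then gen (n + 1) (j + 1) else 0)"
    by (intro sum.cong) auto
  also have "\<dots> = (gen (n + 1) i :: int free_alg)"
    using assms by auto
  finally show ?thesis
    unfolding right_span_def by (intro CollectI exI[of _ "\<lambda>j. if j = i - 1 then 1 else 0"]) auto
qed

lemma phi_crossing_spans:
  assumes c: "position c \<in> {1..<n}"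
  shows "x \<in> left_span n \<Longrightarrow> phi_crossing c x \<in> left_span n"
    "y \<in> right_span n \<Longrightarrow> phi_crossing c y \<in> right_span n"
proof -
  have alg: "hom_ext (crossing_letter c) a \<in> alg n" if "a \<in> alg n" for a
    using that crossing_letter_alg[OF c] by (rule hom_ext_alg)
  have "crossing_letter c (i, n + 1) \<in> left_span n" "crossing_letter c (n + 1, i) \<in> right_span n"
    if i: "i \<in> {1..n}" for i
    using c i by (cases c; auto simp: crossing_letter_def phi_letter_def phi_inv_letter_def
      intro!: left_span_diff left_span_mult left_span_gen[of _ n, simplified] alg_gen
        right_span_diff right_span_mult right_span_gen[of _ n, simplified])+
  then show "x \<in> left_span n \<Longrightarrow> phi_crossing c x \<in> left_span n"
    "y \<in> right_span n \<Longrightarrow> phi_crossing c y \<in> right_span n"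
    unfolding phi_crossing_eq left_span_def[of n, THEN eqset_imp_iff, of x] right_span_def[of n, THEN eqset_imp_iff, of y]
    by (auto intro!: left_span_sum left_span_mult right_span_sum right_span_mult alg)
qed

lemma phi_spans:
  assumes "position ` set w \<subseteq> {1..<n}" "i \<in> {1..n}"
  shows "phi w (gen i (n + 1)) \<in> left_span n" "phi w (gen (n + 1) i) \<in> right_span n"
proof -
  show "phi w (gen i (n + 1)) \<in> left_span n"
    using assms(1) by (induction w) (use assms(2) left_span_gen phi_crossing_spans in auto)
  show "phi w (gen (n + 1) i) \<in> right_span n"
    using assms(1) by (induction w) (use assms(2) right_span_gen phi_crossing_spans in auto)
qed

lemma PhiL_spec:
  assumes "is_braid (n, w)"
  shows "PhiL (n, w) \<in> carrier_mat n n"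
    and "\<And>i j. i < n \<Longrightarrow> j < n \<Longrightarrow> PhiL (n, w) $$ (i, j) \<in> alg n"
    and "\<And>i. i < n \<Longrightarrow> phi w (gen (i + 1) (n + 1)) = (\<Sum>j<n. PhiL (n, w) $$ (i, j) * gen (j + 1) (n + 1))"
proof -
  let ?P = "\<lambda>M. M \<in> carrier_mat n n \<and> (\<forall>i<n. \<forall>j<n. M $$ (i, j) \<in> alg n)
     \<and> (\<forall>i<n. phi w (gen (i + 1) (n + 1)) = (\<Sum>j<n. M $$ (i, j) * gen (j + 1) (n + 1)))"
  have "\<forall>i\<in>{..<n}. \<exists>M. (\<forall>j<n. M j \<in> alg n) \<and> phi w (gen (i + 1) (n + 1)) = (\<Sum>j<n. M j * gen (j + 1) (n + 1))"
    using phi_spans(1)[of w n] assms by (auto simp: is_braid_iff left_span_def)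
  from bchoice[OF this] obtain M where "\<forall>i\<in>{..<n}. (\<forall>j<n. M i j \<in> alg n) \<and> phi w (gen (i + 1) (n + 1)) = (\<Sum>j<n. M i j * gen (j + 1) (n + 1))"
    by blast
  then have "?P (mat n n (\<lambda>(i, j). M i j))"
    by simp
  from someI[of ?P, OF this] have "?P (PhiL (n, w))"
    unfolding PhiL_def prod.case .
  then show "PhiL (n, w) \<in> carrier_mat n n"
    and "\<And>i j. i < n \<Longrightarrow> j < n \<Longrightarrow> PhiL (n, w) $$ (i, j) \<in> alg n"
    and "\<And>i. i < n \<Longrightarrow> phi w (gen (i + 1) (n + 1)) = (\<Sum>j<n. PhiL (n, w) $$ (i, j) * gen (j + 1) (n + 1))"
    by blast+
qed

lemma PhiR_spec:
  assumes "is_braid (n, w)"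
  shows "PhiR (n, w) \<in> carrier_mat n n"
    and "\<And>i j. i < n \<Longrightarrow> j < n \<Longrightarrow> PhiR (n, w) $$ (i, j) \<in> alg n"
    and "\<And>i. i < n \<Longrightarrow> phi w (gen (n + 1) (i + 1)) = (\<Sum>j<n. gen (n + 1) (j + 1) * PhiR (n, w) $$ (j, i))"
proof -
  let ?P = "\<lambda>M. M \<in> carrier_mat n n \<and> (\<forall>i<n. \<forall>j<n. M $$ (i, j) \<in> alg n)
     \<and> (\<forall>i<n. phi w (gen (n + 1) (i + 1)) = (\<Sum>j<n. gen (n + 1) (j + 1) * M $$ (j, i)))"
  have "\<forall>i\<in>{..<n}. \<exists>M. (\<forall>j<n. M j \<in> alg n) \<and> phi w (gen (n + 1) (i + 1)) = (\<Sum>j<n. gen (n + 1) (j + 1) * M j)"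
    using phi_spans(2)[of w n] assms by (auto simp: is_braid_iff right_span_def)
  from bchoice[OF this] obtain M where "\<forall>i\<in>{..<n}. (\<forall>j<n. M i j \<in> alg n) \<and> phi w (gen (n + 1) (i + 1)) = (\<Sum>j<n. gen (n + 1) (j + 1) * M i j)"
    by blast
  then have "?P (mat n n (\<lambda>(j, i). M i j))"
    by simp
  from someI[of ?P, OF this] have "?P (PhiR (n, w))"
    unfolding PhiR_def prod.case .
  then show "PhiR (n, w) \<in> carrier_mat n n"
    and "\<And>i j. i < n \<Longrightarrow> j < n \<Longrightarrow> PhiR (n, w) $$ (i, j) \<in> alg n"
    and "\<And>i. i < n \<Longrightarrow> phi w (gen (n + 1) (i + 1)) = (\<Sum>j<n. gen (n + 1) (j + 1) * PhiR (n, w) $$ (j, i))"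
    by blast+
qed

section \<open>Evaluating the braid action at reflections\<close>

context reflection_space
begin

text \<open>The letter values belonging to the matrix of covectors applied to vectors: below the
  diagonal that matrix holds \<open>- mu\<close> times the letter, whence the factor
  \<open>- exp (- \<theta>)\<close>.\<close>

definition pairing :: "(nat \<Rightarrow> 'b reflection) \<Rightarrow> nat \<times> nat \<Rightarrow> complex" where
  "pairing x = (\<lambda>(i, j). if i = j then 0
     else if i < j then snd (x i) (fst (x j)) else - exp (- \<theta>) * snd (x i) (fst (x j)))"

text \<open>The formulas for the letters are precisely how pairings change under a Hurwitz move.
  This is the bridge between the free algebra and colourings.\<close>

lemma hom_ext_crossing_letter:
  assumes "\<And>i. x i \<in> reflections"
  shows "hom_ext (pairing x) (crossing_letter c l) = pairing (hurwitz reflect_op reflect_opi c x) l"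
proof -
  note F = functionalD[OF reflectionsD(1)[OF assms]] reflectionsD(2)[OF assms]
  have r: "snd (x i) (reflect_inv (x i) v) = exp (- \<theta>) * snd (x i) v"
    "snd (x i) (reflect (x i) v) = exp \<theta> * snd (x i) v" for i v
    by (simp_all add: reflect_inv_def reflect_def F algebra_simps flip: exp_add)
  have q: "exp (- \<theta>) * (exp \<theta> * a) = a" "exp \<theta> * (exp (- \<theta>) * a) = a" for a
    by (simp_all add: exp_minus_cancel flip: mult.assoc)
  obtain i j where l: "l = (i, j)"
    by fastforce
  show ?thesis
  proof (cases c)
    case (Pos k)
    have e: "fst (hurwitz reflect_op reflect_opi c x i) =
        (if i = k then reflect (x k) (fst (x (k + 1))) else if i = k + 1 then fst (x k) else fst (x i))"
      "snd (hurwitz reflect_op reflect_opi c x i) =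
        (if i = k then snd (x (k + 1)) \<circ> reflect_inv (x k) else if i = k + 1 then snd (x k) else snd (x i))" for i
      by (auto simp: Pos hurwitz_def reflect_op_def)
    show ?thesis
      unfolding l Pos crossing_letter_def crossing.case phi_letter_def prod.case pairing_def e[unfolded Pos]
      by (auto simp: r q reflect_reflect_inv[OF assms] F algebra_simps; auto simp: reflect_inv_def reflect_def F algebra_simps r q)
  next
    case (Neg k)
    have e: "fst (hurwitz reflect_op reflect_opi c x i) =
        (if i = k then fst (x (k + 1)) else if i = k + 1 then reflect_inv (x (k + 1)) (fst (x k)) else fst (x i))"
      "snd (hurwitz reflect_op reflect_opi c x i) =
        (if i = k then snd (x (k + 1)) else if i = k + 1 then snd (x k) \<circ> reflect (x (k + 1)) else snd (x i))" for i
      by (auto simp: Neg hurwitz_def reflect_opi_def)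
    show ?thesis
      unfolding l Neg crossing_letter_def crossing.case phi_inv_letter_def prod.case pairing_def e[unfolded Neg]
      by (auto simp: r q reflect_reflect_inv[OF assms] F algebra_simps; auto simp: reflect_inv_def reflect_def F algebra_simps r q)
  qed
qed

text \<open>Evaluation reverses the order of composition: \<open>phi\<close> applies the
  automorphism of the last crossing first, whereas the colours meet the first crossing
  first.\<close>

lemma hom_ext_phi:
  assumes "\<And>i. x i \<in> reflections"
  shows "hom_ext (pairing x) (phi w a) = hom_ext (pairing (rack.act w x)) a"
  using assms
proof (induction w arbitrary: x)
  case (Cons c w)
  have "hom_ext (pairing x) (phi (c # w) a) = hom_ext (pairing (hurwitz reflect_op reflect_opi c x)) (phi w a)"
    by (simp add: phi_crossing_eq hom_ext_hom_ext hom_ext_crossing_letter[OF Cons.prems] del: phi_crossing.simps)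
  then show ?case
    using Cons rack.hurwitz_in by simp
qed simp

end

section \<open>Augmentations as colourings\<close>

definition cscale :: "complex \<Rightarrow> (nat \<Rightarrow> complex) \<Rightarrow> nat \<Rightarrow> complex" where
  "cscale c f = (\<lambda>i. c * f i)"

interpretation cvec: ambient_space cscale
  by unfold_locales (auto simp: cscale_def fun_eq_iff algebra_simps)

definition vec_fun :: "nat \<Rightarrow> complex vec \<Rightarrow> nat \<Rightarrow> complex" where
  "vec_fun n v = (\<lambda>r. if r < n then v $ r else 0)"

lemma sum_fun_apply: "sum f A x = (\<Sum>i\<in>A. f i x)" for f :: "'i \<Rightarrow> 'a \<Rightarrow> 'b::ab_group_add"
  by (induction A rule: infinite_finite_induct) simp_all

text \<open>A maximal independent set of columns stays independent when the columns are extended by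
  zero to functions.\<close>

lemma rank_le_dim:
  assumes A: "A \<in> carrier_mat n m"
  shows "vec_space.rank n A \<le> cvec.dim (vec_fun n ` set (cols A))"
proof -
  interpret vs: vec_space "TYPE(complex)" n .
  let ?P = "\<lambda>T. T \<subseteq> set (cols A) \<and> vs.lin_indpt T"
  have "?P {}"
    by (simp add: vs.lin_dep_def)
  then obtain S where S: "maximal S ?P" "finite S"
    using maximal_exists_superset[of "set (cols A)" ?P "{}"] by auto
  then have S_cols: "S \<subseteq> set (cols A)" and indpt: "vs.lin_indpt S"
    by (auto simp: maximal_def)
  have carrier: "S \<subseteq> carrier_vec n"
    using S_cols cols_dim[of A] A by auto
  have inj: "inj_on (vec_fun n) S"
  proof (rule inj_onI)
    fix u v assume "u \<in> S" "v \<in> S" and eq: "vec_fun n u = vec_fun n v"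
    then have "u \<in> carrier_vec n" "v \<in> carrier_vec n"
      using carrier by auto
    moreover have "u $ i = v $ i" if "i < n" for i
      using fun_cong[OF eq, of i] that by (simp add: vec_fun_def)
    ultimately show "u = v"
      by auto
  qed
  have "cvec.independent (vec_fun n ` S)"
  proof
    assume "cvec.dependent (vec_fun n ` S)"
    then obtain u v where v: "v \<in> S" "u (vec_fun n v) \<noteq> 0"
      and sum: "(\<Sum>v\<in>vec_fun n ` S. cscale (u v) v) = 0"
      using S(2) by (auto simp: cvec.dependent_finite)
    have "vs.lincomb (\<lambda>v. u (vec_fun n v)) S = 0\<^sub>v n"
    proof (rule eq_vecI)
      fix i assume "i < dim_vec (0\<^sub>v n :: complex vec)"
      then have i: "i < n"
        by simp
      have "vs.lincomb (\<lambda>v. u (vec_fun n v)) S $ i = (\<Sum>v\<in>S. u (vec_fun n v) * v $ i)"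
        using i carrier by (rule vs.lincomb_index)
      also have "\<dots> = (\<Sum>v\<in>S. cscale (u (vec_fun n v)) (vec_fun n v)) i"
        using i by (simp add: sum_fun_apply cscale_def vec_fun_def)
      also have "\<dots> = 0"
        using fun_cong[OF sum, of i] inj by (simp add: sum.reindex)
      finally show "vs.lincomb (\<lambda>v. u (vec_fun n v)) S $ i = 0\<^sub>v n $ i"
        using i by simp
    qed (use carrier S(2) vs.lincomb_dim in auto)
    then have "vs.lin_dep S"
      unfolding vs.lin_dep_def using v S(2) by (intro exI[of _ S] exI[of _ "\<lambda>v. u (vec_fun n v)"] exI[of _ v]) auto
    then show False
      using indpt by simp
  qed
  moreover obtain B where B: "B \<subseteq> vec_fun n ` set (cols A)"
    "vec_fun n ` set (cols A) \<subseteq> cvec.span B" "card B = cvec.dim (vec_fun n ` set (cols A))"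
    using cvec.basis_exists by metis
  moreover have "finite B"
    using B(1) finite_subset by blast
  ultimately have "card (vec_fun n ` S) \<le> card B"
    using S_cols cvec.independent_span_bound[of B "vec_fun n ` S"] by blast
  then show ?thesis
    using vs.rank_card_indpt[OF A S(1)] inj B(3) by (simp add: card_image)
qed

lemma complex_exp_surj:
  assumes "z \<noteq> 0"
  obtains a :: complex where "exp a = z"
proof -
  obtain b r where z: "z = complex_of_real r * exp b"
    using complex_exp_exists by blast
  show thesis
  proof (cases "0 < r")
    case True
    then have "exp (of_real (ln r) + b) = z"
      by (simp add: z exp_add exp_of_real)
    then show thesis
      using that by blast
  next
    case False
    then have "r < 0"
      using assms z by (cases "r = 0") auto
    then have "exp (of_real (ln (- r)) + \<i> * of_real pi + b) = z"
      by (simp add: z exp_add exp_of_real)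
    then show thesis
      using that by blast
  qed
qed

lemma monomial_lm_mult: "monomial_lm a b * monomial_lm c d = monomial_lm (a + c) (b + d)"
  by (simp add: monomial_lm_def mult_single plus_list_def)

lemma monomial_lm_zero: "monomial_lm 0 0 = 1"
proof -
  have "Poly_Mapping.single ((0, 0) :: int \<times> int) (1 :: int) = 1"
    unfolding zero_prod_def[symmetric] by simp
  then show ?thesis
    by (simp add: monomial_lm_def single_Nil)
qed

lemma monomial_lm_alg: "monomial_lm a b \<in> alg n"
  by (simp add: monomial_lm_def)

lemma mult_mat_entry:
  assumes "P \<in> carrier_mat n n" "Q \<in> carrier_mat n n" "i < n" "j < n"
  shows "(P * Q) $$ (i, j) = (\<Sum>k<n. P $$ (i, k) * Q $$ (k, j))"
  using assms by (simp add: scalar_prod_def atLeast0LessThan)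

lemma square_carriers:
  "matA n \<in> carrier_mat n n" "Lambda (n, w) \<in> carrier_mat n n" "Lambda_inverse (n, w) \<in> carrier_mat n n"
  by (simp_all add: matA_def Lambda_def Lambda_inverse_def)

section \<open>The defining equations under an augmentation\<close>

locale augmentation =
  fixes n :: nat and w :: word and e :: "laurent free_alg \<Rightarrow> complex"
  assumes braid: "is_braid (n, w)" and aug: "e \<in> augmentations (n, w)"
begin

definition twist :: complex where
  "twist = e (monomial_lm 1 (writhe w))"

definition scalar :: "nat \<Rightarrow> complex" where
  "scalar i = (if i = 0 then twist else 1)"

definition entry :: "nat \<Rightarrow> nat \<Rightarrow> complex" where
  "entry i j = e (matA n $$ (i, j))"

definition specialize :: "int free_alg \<Rightarrow> complex" where
  "specialize = hom_ext (\<lambda>(i, j). e (gen i j))"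

lemma hom:
  assumes "a \<in> alg n" "b \<in> alg n"
  shows "e (a + b) = e a + e b" "e (a * b) = e a * e b"
  using aug assms by (auto simp: augmentations_def Ring.ring_hom_def ring_on_def)

lemma hom_one: "e 1 = 1"
  using aug by (auto simp: augmentations_def Ring.ring_hom_def ring_on_def)

lemma hom_zero: "e 0 = 0"
  using hom(1)[of 0 0] by simp

lemma hom_uminus: "a \<in> alg n \<Longrightarrow> e (- a) = - e a"
  using hom(1)[of "- a" a] by (simp add: alg_uminus hom_zero eq_neg_iff_add_eq_0)

lemma hom_diff: "a \<in> alg n \<Longrightarrow> b \<in> alg n \<Longrightarrow> e (a - b) = e a - e b"
  using hom(1)[of a "- b"] by (simp add: alg_uminus hom_uminus)

lemma hom_sum: "(\<And>i. i \<in> A \<Longrightarrow> f i \<in> alg n) \<Longrightarrow> e (sum f A) = (\<Sum>i\<in>A. e (f i))"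
  by (induction A rule: infinite_finite_induct) (simp_all add: hom hom_zero alg_sum)

lemma hom_prod_list: "(\<And>x. x \<in> set xs \<Longrightarrow> x \<in> alg n) \<Longrightarrow> e (prod_list xs) = prod_list (map e xs)"
  by (induction xs) (simp_all add: hom hom_one alg_prod_list)

lemma hom_of_int: "e (of_int c) = of_int c"
proof -
  have "e (of_nat k) = of_nat k" for k
    using alg_of_int[of "int _" n, where 'r = laurent]
    by (induction k) (simp_all add: hom hom_one hom_zero)
  then show ?thesis
    using alg_of_int[of "int _" n, where 'r = laurent] 
    by (cases c) (simp_all add: hom_uminus hom_diff hom_one alg_uminus)
qed

lemma extend_scalars_alg: "a \<in> alg n \<Longrightarrow> extend_scalars a \<in> alg n"
  unfolding extend_scalars_eq by (rule hom_ext_alg) (auto intro: alg_gen)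

lemma hom_extend_scalars:
  assumes a: "a \<in> alg n"
  shows "e (extend_scalars a) = specialize a"
proof -
  have "e (of_int (Poly_Mapping.lookup a w) * prod_list (map (\<lambda>(i, j). gen i j) w))
      = of_int (Poly_Mapping.lookup a w) * prod_list (map (\<lambda>(i, j). e (gen i j)) w)
      \<and> of_int (Poly_Mapping.lookup a w) * prod_list (map (\<lambda>(i, j). gen i j) w) \<in> (alg n :: laurent free_alg set)"
    if w: "w \<in> Poly_Mapping.keys a" for w
  proof -
    have g: "(case l of (i, j) \<Rightarrow> gen i j) \<in> (alg n :: laurent free_alg set)" if "l \<in> set w" for l
      using algD[OF a w] that by (cases l) (auto intro!: alg_gen)
    then have "prod_list (map (\<lambda>(i, j). gen i j) w) \<in> (alg n :: laurent free_alg set)"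
      by (intro alg_prod_list) auto
    moreover have "e (prod_list (map (\<lambda>(i, j). gen i j) w)) = prod_list (map (\<lambda>(i, j). e (gen i j)) w)"
      using g by (subst hom_prod_list) (auto simp: o_def split_def)
    ultimately show ?thesis
      using alg_of_int by (auto simp: hom hom_of_int intro: alg_mult)
  qed
  then show ?thesis
    unfolding extend_scalars_eq specialize_def hom_ext_def by (subst hom_sum) auto
qed

lemma n_pos: "1 \<le> n"
  using braid by (simp add: is_braid_iff)

lemma matA_alg: "i < n \<Longrightarrow> j < n \<Longrightarrow> matA n $$ (i, j) \<in> alg n"
  by (auto simp: matA_def intro!: alg_gen alg_uminus alg_mult alg_diff monomial_lm_alg)

lemma mu_nonzero: "e mu \<noteq> 0"
  using hom(2)[of mu "monomial_lm 0 (- 1)"]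
  by (auto simp: monomial_lm_alg monomial_lm_mult monomial_lm_zero hom_one)

lemma twist_inverse: "twist * e (monomial_lm (- 1) (- writhe w)) = 1"
  using hom(2)[of "monomial_lm 1 (writhe w)" "monomial_lm (- 1) (- writhe w)"]
  by (simp add: twist_def monomial_lm_alg monomial_lm_mult monomial_lm_zero hom_one)

lemma entry_simps:
  assumes "i < n" "j < n"
  shows "entry i j = (if i < j then e (gen (i + 1) (j + 1)) else if j < i then - e mu * e (gen (i + 1) (j + 1)) else 1 - e mu)"
  using assms by (auto simp: entry_def matA_def hom_uminus hom hom_diff hom_one alg_gen alg_mult monomial_lm_alg)

lemma left_equation:
  assumes "i < n" "j < n"
  shows "entry i j = scalar i * (\<Sum>k<n. specialize (PhiL (n, w) $$ (i, k)) * entry k j)"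
proof -
  let ?F = "map_mat extend_scalars (PhiL (n, w))" and ?L = "Lambda (n, w)"
  let ?l = "if i = 0 then monomial_lm 1 (writhe w) else 1"
  note spec = PhiL_spec[OF braid]
  have F: "?F $$ (k, l) = extend_scalars (PhiL (n, w) $$ (k, l))" "?F $$ (k, l) \<in> alg n" if "k < n" "l < n" for k l
    using spec(1,2) that by (auto intro: extend_scalars_alg)
  have LF: "(?L * ?F) $$ (i, k) = ?l * ?F $$ (i, k)" if "k < n" for k
  proof -
    have "(?L * ?F) $$ (i, k) = (\<Sum>l<n. ?L $$ (i, l) * ?F $$ (l, k))"
      using spec(1) square_carriers assms that by (intro mult_mat_entry) auto
    also have "\<dots> = (\<Sum>l<n. if l = i then ?l * ?F $$ (i, k) else 0)"
      using assms by (intro sum.cong) (auto simp: Lambda_def)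
    finally show ?thesis
      using assms by simp
  qed
  have l: "?l \<in> alg n" "e ?l = scalar i"
    by (auto simp: monomial_lm_alg scalar_def twist_def hom_one)
  have M: "(?L * ?F * matA n) $$ (i, j) = (\<Sum>k<n. ?l * ?F $$ (i, k) * matA n $$ (k, j))"
  proof -
    have "?L * ?F \<in> carrier_mat n n"
      using spec(1) square_carriers by (intro mult_carrier_mat) auto
    then have "(?L * ?F * matA n) $$ (i, j) = (\<Sum>k<n. (?L * ?F) $$ (i, k) * matA n $$ (k, j))"
      using square_carriers assms by (intro mult_mat_entry) auto
    then show ?thesis
      using LF by simp
  qed
  have "e (\<Sum>k<n. ?l * ?F $$ (i, k) * matA n $$ (k, j)) = (\<Sum>k<n. scalar i * specialize (PhiL (n, w) $$ (i, k)) * entry k j)"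
    using assms l F matA_alg spec(2)
    by (subst hom_sum) (auto simp: hom alg_mult hom_extend_scalars entry_def simp del: index_map_mat intro!: sum.cong)
  moreover have "(\<Sum>k<n. ?l * ?F $$ (i, k) * matA n $$ (k, j)) \<in> alg n"
    using assms l F matA_alg by (intro alg_sum alg_mult) auto
  moreover have "e ((matA n - ?L * ?F * matA n) $$ (i, j)) = 0"
  proof -
    let ?R = "matA n - ?L * ?F * matA n"
    have "dim_row ?R = n" "dim_col ?R = n"
      by (auto simp: matA_def Lambda_def)
    then have "?R $$ (i, j) \<in> elements_mat ?R"
      using elements_matI[of ?R n n i j] assms by (metis carrier_matI)
    then have "?R $$ (i, j) \<in> knot_ideal (n, w)"
      unfolding knot_ideal_def genideal_def by auto
    then show ?thesis
      using aug by (simp add: augmentations_def)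
  qed
  moreover have "(matA n - ?L * ?F * matA n) $$ (i, j) = matA n $$ (i, j) - (?L * ?F * matA n) $$ (i, j)"
    using assms by (intro index_minus_mat(1)) (simp_all add: matA_def Lambda_def Lambda_inverse_def)
  ultimately show ?thesis
    using matA_alg[OF assms] by (simp add: M hom_diff entry_def sum_distrib_left mult.assoc)
qed

text \<open>The inverse of Lambda is moved to the other side, so that both equations involve the
  same scalar.\<close>

lemma right_equation:
  assumes "i < n" "j < n"
  shows "entry i j * scalar j = (\<Sum>k<n. entry i k * specialize (PhiR (n, w) $$ (k, j)))"
proof -
  let ?F = "map_mat extend_scalars (PhiR (n, w))" and ?L = "Lambda_inverse (n, w)"
  let ?l = "if j = 0 then monomial_lm (- 1) (- writhe w) else 1"
  note spec = PhiR_spec[OF braid]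
  have F: "?F $$ (k, l) = extend_scalars (PhiR (n, w) $$ (k, l))" "?F $$ (k, l) \<in> alg n" if "k < n" "l < n" for k l
    using spec(1,2) that by (auto intro: extend_scalars_alg)
  have l: "?l \<in> alg n" "e ?l * scalar j = 1"
    using twist_inverse by (auto simp: monomial_lm_alg scalar_def hom_one mult.commute)
  have AF: "(matA n * ?F) $$ (i, k) = (\<Sum>l<n. matA n $$ (i, l) * ?F $$ (l, k))" if "k < n" for k
    using spec(1) square_carriers assms that by (intro mult_mat_entry) auto
  have M: "(matA n * ?F * ?L) $$ (i, j) = (\<Sum>k<n. matA n $$ (i, k) * ?F $$ (k, j)) * ?l"
  proof -
    have "(matA n * ?F * ?L) $$ (i, j) = (\<Sum>l<n. (matA n * ?F) $$ (i, l) * ?L $$ (l, j))"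
    proof -
      have "matA n * ?F \<in> carrier_mat n n"
        using spec(1) square_carriers by (intro mult_carrier_mat) auto
      then show ?thesis
        using square_carriers assms by (intro mult_mat_entry) auto
    qed
    also have "\<dots> = (\<Sum>l<n. if l = j then (matA n * ?F) $$ (i, j) * ?l else 0)"
      using assms by (intro sum.cong) (auto simp: Lambda_inverse_def)
    finally show ?thesis
      using assms AF by simp
  qed
  have s: "e (\<Sum>k<n. matA n $$ (i, k) * ?F $$ (k, j)) = (\<Sum>k<n. entry i k * specialize (PhiR (n, w) $$ (k, j)))"
    using assms F matA_alg spec(2)
    by (subst hom_sum) (auto simp: hom alg_mult hom_extend_scalars entry_def simp del: index_map_mat intro!: sum.cong)
  have alg: "(\<Sum>k<n. matA n $$ (i, k) * ?F $$ (k, j)) \<in> alg n"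
    using assms F matA_alg by (intro alg_sum alg_mult) auto
  have "e ((matA n - matA n * ?F * ?L) $$ (i, j)) = 0"
  proof -
    let ?R = "matA n - matA n * ?F * ?L"
    have "dim_row ?R = n" "dim_col ?R = n"
      by (auto simp: matA_def Lambda_inverse_def)
    then have "?R $$ (i, j) \<in> elements_mat ?R"
      using elements_matI[of ?R n n i j] assms by (metis carrier_matI)
    then have "?R $$ (i, j) \<in> knot_ideal (n, w)"
      unfolding knot_ideal_def genideal_def by auto
    then show ?thesis
      using aug by (simp add: augmentations_def)
  qed
  moreover have "(matA n - matA n * ?F * ?L) $$ (i, j) = matA n $$ (i, j) - (matA n * ?F * ?L) $$ (i, j)"
    using assms by (intro index_minus_mat(1)) (simp_all add: matA_def Lambda_def Lambda_inverse_def)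
  ultimately have "entry i j = (\<Sum>k<n. entry i k * specialize (PhiR (n, w) $$ (k, j))) * e ?l"
    using matA_alg[OF assms] l alg by (simp only: M hom_diff hom s entry_def alg_mult) (simp add: s)
  then show ?thesis
    using l(2) by (simp only: mult.assoc mult_1_right)
qed

end

section \<open>Reflections as group elements and the lines they determine\<close>

context reflection_space
begin

lemma displaces_elt:
  assumes "x \<in> reflections"
  shows "displaces (span {fst x}) (elt x)"
  unfolding displaces_def app_elt[OF assms] reflect_def
proof
  fix v
  have "- (snd x v *s fst x) \<in> span {fst x}"
    by (intro span_neg span_scale span_base) simp
  then show "v - snd x v *s fst x - v \<in> span {fst x}"
    by simp
qed

text \<open>Here \<open>exp \<theta> \<noteq> 1\<close> is essential: the reflection changes its own
  vector by a nonzero multiple of it, and dividing by that factor gives the preimage.\<close>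

lemma displacement_elt:
  assumes "x \<in> reflections"
  shows "\<exists>u. fst x = app (elt x) u - u"
proof
  have "- inverse (1 - exp \<theta>) * (1 - exp \<theta>) = - 1"
    using exp_theta by simp
  then have "- ((- inverse (1 - exp \<theta>) * (1 - exp \<theta>)) *s fst x) = fst x"
    by (simp only: scale_minus_left minus_minus scale_one)
  then show "fst x = app (elt x) ((- inverse (1 - exp \<theta>)) *s fst x) - (- inverse (1 - exp \<theta>)) *s fst x"
    unfolding app_elt[OF assms] reflect_def functionalD(2)[OF reflectionsD(1)[OF assms]] reflectionsD(2)[OF assms]
    by simp
qed

lemma elt_line:
  assumes "x \<in> reflections" "z \<in> reflections" "elt x = elt z"
  shows "fst x \<in> span {fst z}"
  using displacement_elt[OF assms(1)] displaces_elt[OF assms(2)] assms(3) by (auto simp: displaces_def)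

end

text \<open>Turns a condition on single group elements that is stable under conjugation into one
  that travels with blocks through Markov moves.\<close>

lemma block_subrack:
  fixes N :: "'g::group_add set"
  assumes N: "\<And>a b. a \<in> N \<Longrightarrow> b \<in> N \<Longrightarrow> group_conj a b \<in> N"
    "\<And>a b. a \<in> N \<Longrightarrow> b \<in> N \<Longrightarrow> group_conj (- a) b \<in> N"
  shows "twisted_rack.subrack {xs. length xs = p} block_op block_opi (ipow shift) {xs. length xs = p \<and> set xs \<subseteq> N}"
proof -
  have 1: "group_conj (sum_list xs) b \<in> N" if "set xs \<subseteq> N" "b \<in> N" for xs b
    using that(1) by (induction xs) (auto simp: group_conj_add N that(2))
  have 2: "group_conj (- sum_list xs) b \<in> N" if "set xs \<subseteq> N" "b \<in> N" for xs b
    using that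
  proof (induction xs arbitrary: b)
    case (Cons a xs)
    have "- sum_list (a # xs) = - sum_list xs + - a"
      by (simp add: minus_add)
    then show ?case
      using Cons N by (simp only: group_conj_add) auto
  qed simp
  show ?thesis
    unfolding twisted_rack.subrack_def[OF block_rack]
    using 1 2 set_ipow_shift_closed[of _ N] N
    by (auto simp: block_op_def block_opi_def length_ipow_shift image_subset_iff subset_iff)
qed

locale augmentation_space = augmentation n w e + reflection_space cscale \<pi> \<theta>
  for n w e and \<pi> :: "(nat \<Rightarrow> complex) \<Rightarrow> nat \<Rightarrow> complex" and \<theta> +
  assumes theta: "exp \<theta> = e mu" and lin_pi: "cvec.lin_op \<pi>"
    and pi_range: "\<pi> v \<in> cvec.span (vec_fun n ` set (cols (map_mat e (matA n))))"
    and pi_id: "v \<in> cvec.span (vec_fun n ` set (cols (map_mat e (matA n)))) \<Longrightarrow> \<pi> v = v"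
begin

definition column :: "nat \<Rightarrow> nat \<Rightarrow> complex" where
  "column j = (\<lambda>r. if r < n then entry r j else 0)"

lemma columns: "vec_fun n ` set (cols (map_mat e (matA n))) = column ` {..<n}"
proof -
  have "vec_fun n (col (map_mat e (matA n)) j) = column j" if "j < n" for j
    using that square_carriers(1)[of n] by (auto simp: vec_fun_def column_def entry_def)
  moreover have "set (cols (map_mat e (matA n))) = col (map_mat e (matA n)) ` {..<n}"
    using square_carriers(1)[of n] by (auto simp: cols_def)
  ultimately show ?thesis
    by (auto simp: image_image)
qed

lemma support:
  assumes "v \<in> span (column ` {..<n})" "n \<le> r"
  shows "v r = 0"
  using assms(1) by (induction rule: span_induct_alt) (use assms(2) in \<open>auto simp: column_def cscale_def\<close>)

lemma pi_column: "j < n \<Longrightarrow> \<pi> (column j) = column j"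
  by (rule pi_id) (auto simp: columns intro: span_base)

text \<open>The matrix \<open>A\<close> is factored through its column space: the vectors are its
  columns, and the covectors read off coordinates after projecting. Indices outside the braid repeat
  the first strand, since every index must carry a reflection.\<close>

definition point :: "nat \<Rightarrow> (nat \<Rightarrow> complex) \<times> ((nat \<Rightarrow> complex) \<Rightarrow> complex)" where
  "point i = (let k = if i \<in> {1..n} then i - 1 else 0 in (column k, \<lambda>v. \<pi> v k))"

lemma point_Suc: "k < n \<Longrightarrow> point (Suc k) = (column k, \<lambda>v. \<pi> v k)"
  by (simp add: point_def)

lemma point_reflections: "point i \<in> reflections"
proof -
  define k where "k = (if i \<in> {1..n} then i - 1 else 0)"
  have k: "k < n"
    using n_pos by (auto simp: k_def)
  have "functional (\<lambda>v. \<pi> v k)"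
    using lin_pi by (simp add: functional_def lin_op_def cscale_def)
  moreover have "\<pi> (\<pi> v) = \<pi> v" for v
    using pi_id pi_range by blast
  moreover have "\<pi> (column k) k = 1 - exp \<theta>"
    using k theta by (simp add: pi_column) (simp add: column_def entry_simps)
  ultimately show ?thesis
    unfolding point_def Let_def k_def[symmetric] by (simp add: reflections_def o_def)
qed

lemma point_apply: "j < n \<Longrightarrow> k < n \<Longrightarrow> snd (point (Suc j)) (fst (point (Suc k))) = entry j k"
  by (simp add: point_Suc pi_column) (simp add: column_def)

lemma pairing_point:
  assumes "i \<in> {1..n}" "j \<in> {1..n}" "i \<noteq> j"
  shows "pairing point (i, j) = e (gen i j)"
proof -
  obtain a b where ab: "i = Suc a" "j = Suc b" "a < n" "b < n"
    using assms by (cases i; cases j) auto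
  have "exp (- \<theta>) * e mu = 1"
    unfolding theta[symmetric] by (rule exp_minus_cancel)
  then show ?thesis
    using ab assms(3) by (auto simp: pairing_def point_apply entry_simps simp flip: mult.assoc)
qed

text \<open>
  Giving the extra strand \<open>n + 1\<close> the colour of strand \<open>j + 1\<close> evaluates the new covectors on the
  vector of that strand, and the new vectors under its covector.
\<close>

lemma act_point:
  assumes ij: "i < n" "j < n"
  shows "scalar i * snd (rack.act w point (Suc i)) (column j) = entry i j"
    and "snd (point (Suc j)) (fst (rack.act w point (Suc i))) = entry j i * scalar i"
proof -
  define x where "x = point(Suc n := point (Suc j))"
  have x: "\<And>i. x i \<in> reflections"
    by (simp add: x_def point_reflections)
  have pos: "position ` set w \<subseteq> {1..<n}"
    using braid by (simp add: is_braid_iff)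
  have y: "rack.act w x (Suc i) = rack.act w point (Suc i)"
    using hurwitz_word_cong[OF pos, of x point "Suc i"] ij by (simp add: x_def)
  have last: "rack.act w x (Suc n) = point (Suc j)"
    using hurwitz_word_outside[OF pos, of "Suc n" _ _ x] by (simp add: x_def)
  have special: "hom_ext (pairing x) a = specialize a" if "a \<in> alg n" for a
    unfolding specialize_def
  proof (rule hom_ext_cong)
    fix v l assume "v \<in> Poly_Mapping.keys a" "l \<in> set v"
    moreover obtain i j where "l = (i, j)"
      by fastforce
    ultimately have "i \<noteq> j" "i \<in> {1..n}" "j \<in> {1..n}" "l = (i, j)"
      using algD[OF that] by blast+
    moreover from this have "pairing x (i, j) = pairing point (i, j)"
      by (simp add: pairing_def x_def)
    ultimately show "pairing x l = (case l of (i, j) \<Rightarrow> e (gen i j))"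
      using pairing_point by simp
  qed
  note L = PhiL_spec[OF braid] and R = PhiR_spec[OF braid]
  have "snd (rack.act w point (Suc i)) (column j) = pairing (rack.act w x) (Suc i, Suc n)"
    using ij by (simp add: pairing_def y last point_Suc)
  also have "\<dots> = hom_ext (pairing x) (phi w (gen (Suc i) (Suc n)))"
    by (simp add: hom_ext_phi x)
  also have "\<dots> = (\<Sum>k<n. specialize (PhiL (n, w) $$ (i, k)) * pairing x (Suc k, Suc n))"
    using L(2,3) ij by (simp add: special)
  also have "\<dots> = (\<Sum>k<n. specialize (PhiL (n, w) $$ (i, k)) * entry k j)"
    using ij by (intro sum.cong) (auto simp: pairing_def x_def point_apply)
  finally show "scalar i * snd (rack.act w point (Suc i)) (column j) = entry i j"
    using left_equation[OF ij] by simp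
  have "- exp (- \<theta>) * snd (point (Suc j)) (fst (rack.act w point (Suc i))) = pairing (rack.act w x) (Suc n, Suc i)"
    using ij by (simp add: pairing_def y last)
  also have "\<dots> = hom_ext (pairing x) (phi w (gen (Suc n) (Suc i)))"
    by (simp add: hom_ext_phi x)
  also have "\<dots> = (\<Sum>k<n. pairing x (Suc n, Suc k) * specialize (PhiR (n, w) $$ (k, i)))"
    using R(2,3) ij by (simp add: special)
  also have "\<dots> = (\<Sum>k<n. - exp (- \<theta>) * (entry j k * specialize (PhiR (n, w) $$ (k, i))))"
    using ij by (intro sum.cong) (auto simp: pairing_def x_def point_apply)
  also have "\<dots> = - exp (- \<theta>) * (entry j i * scalar i)"
    using right_equation[OF ij(2,1)] by (simp add: sum_distrib_left)
  finally show "snd (point (Suc j)) (fst (rack.act w point (Suc i))) = entry j i * scalar i"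
    by simp
qed

text \<open>By \<open>act_point\<close>, the strand with index \<open>Suc i\<close> returns scaled
  by \<open>scalar i\<close>. The twist therefore sits on the first strand only, and
  \<open>\<kappa>\<close> is whatever its logarithm leaves after subtracting the writhe
  term.\<close>

lemma augmentation_colouring: "\<exists>\<kappa> \<tau>. rack.colouring (n, w) \<kappa> point \<tau>"
proof -
  have "twist \<noteq> 0"
    using twist_inverse by auto
  then obtain L where L: "exp L = twist"
    by (rule complex_exp_surj)
  define \<tau> where "\<tau> i = (if i = 1 then L else 0)" for i :: nat
  have scalar: "exp (\<tau> (Suc i)) = scalar i" "exp (- \<tau> (Suc i)) * scalar i = 1" for i
    using exp_minus_cancel(1)[of L] by (auto simp: \<tau>_def scalar_def L)
  have "rack.act w point i = reflect_tw (\<tau> i) (point i)" if i: "i \<in> {1..n}" for i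
  proof -
    obtain a where a: "i = Suc a" "a < n"
      using i by (cases i) auto
    let ?y = "rack.act w point i"
    have yR: "?y \<in> reflections"
      by (rule rack.act_in) (rule point_reflections)
    have U: "subspace (span (column ` {..<n}))"
      by simp
    have pos: "position ` set w \<subseteq> {1..<n}"
      using braid by (simp add: is_braid_iff)
    have "fst (point k) \<in> span (column ` {..<n})" if "k \<in> {1..n}" for k
      using that point_Suc[of "k - 1"] by (auto intro!: span_base)
    then have "point ` {1..n} \<subseteq> {x \<in> reflections. fst x \<in> span (column ` {..<n})}"
      using point_reflections by auto
    then have "rack.act w point ` {1..n} \<subseteq> {x \<in> reflections. fst x \<in> span (column ` {..<n})}"
      using rack.subrack_act[OF subrack_line_in[OF U] pos point_reflections] by simp
    from subsetD[OF this imageI[OF i]] have yU: "fst ?y \<in> span (column ` {..<n})"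
      by simp
    have "fst ?y r = cscale (exp (\<tau> i)) (column a) r" for r
    proof (cases "r < n")
      case True
      \<comment> \<open>A vector of the column space is fixed by \<open>\<pi>\<close>, so its
        coordinates are its values under the covectors of the points.\<close>
      have "fst ?y r = snd (point (Suc r)) (fst ?y)"
        using True yU pi_id[of "fst ?y"] by (simp add: point_Suc columns)
      then show ?thesis
        using act_point(2)[OF a(2) True] True a scalar(1)[of a] by (simp add: cscale_def column_def mult.commute)
    next
      case False
      then show ?thesis
        using support[OF yU] by (simp add: cscale_def column_def)
    qed
    moreover have "snd ?y v = exp (- \<tau> i) * snd (point i) v" for v
    proof -
      have "functional (\<lambda>v. exp (- \<tau> i) * snd (point i) v)"
        using functionalD(1,2)[OF reflectionsD(1)[OF point_reflections[of i]]]
        by (simp add: functional_def algebra_simps)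
      moreover have "snd ?y c = exp (- \<tau> i) * snd (point i) c" if c: "c \<in> column ` {..<n}" for c
      proof -
        obtain b where b: "c = column b" "b < n"
          using c by blast
        have "snd ?y c = exp (- \<tau> i) * scalar a * snd ?y c"
          using scalar(2)[of a] a by simp
        also have "\<dots> = exp (- \<tau> i) * snd (point i) c"
          using act_point(1)[OF a(2) b(2)] point_apply[OF a(2) b(2)] point_Suc[OF b(2)] a b by simp
        finally show ?thesis .
      qed
      \<comment> \<open>Both covectors factor through \<open>\<pi>\<close>, so agreement on the
        columns is enough.\<close>
      ultimately have "snd ?y (\<pi> v) = exp (- \<tau> i) * snd (point i) (\<pi> v)"
        using pi_range[of v] functional_eq_on_span[OF reflectionsD(1)[OF yR]] unfolding columns by blast
      then show ?thesis
        by (simp add: reflectionsD(3)[OF yR] reflectionsD(3)[OF point_reflections])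
    qed
    ultimately show ?thesis
      using point_Suc[OF a(2)] a(1) by (intro prod_eqI ext) (simp_all add: reflect_tw_def)
  qed
  then have "rack.colouring (n, w) (sum \<tau> {1..n} - of_int (writhe w) * \<theta>) point \<tau>"
    using point_reflections by (simp add: rack.colouring_def)
  then show ?thesis
    by blast
qed

lemma point_vectors: "(\<lambda>i. fst (point i)) ` {1..n} = vec_fun n ` set (cols (map_mat e (matA n)))"
  unfolding columns image_Suc_lessThan[symmetric] by (auto simp: image_image point_Suc)

end

section \<open>The iterated torus knots\<close>

abbreviation unit_fun :: "nat \<Rightarrow> nat \<Rightarrow> complex" where
  "unit_fun j \<equiv> (\<lambda>r. if r = j then 1 else 0)"

lemma dim_unit_funs: "n \<le> cvec.dim (unit_fun ` {..<n})"
proof -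
  have inj: "inj_on unit_fun {..<n}"
    by (rule inj_onI) (metis zero_neq_one)
  have "cvec.independent (unit_fun ` {..<n})"
  proof
    assume "cvec.dependent (unit_fun ` {..<n})"
    then obtain u k where k: "k < n" "u (unit_fun k) \<noteq> 0"
      and sum: "(\<Sum>v\<in>unit_fun ` {..<n}. cscale (u v) v) = 0"
      by (auto simp: cvec.dependent_finite)
    have "0 = (\<Sum>j<n. cscale (u (unit_fun j)) (unit_fun j)) k"
      using fun_cong[OF sum, of k] inj by (simp add: sum.reindex)
    also have "\<dots> = (\<Sum>j<n. if j = k then u (unit_fun k) else 0)"
      unfolding sum_fun_apply by (intro sum.cong) (auto simp: cscale_def)
    finally show False
      using k by simp
  qed
  then show ?thesis
    using cvec.dim_eq_card_independent[of "unit_fun ` {..<n}"] inj by (simp add: card_image)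
qed

abbreviation torus_word :: "nat \<Rightarrow> word" where
  "torus_word n \<equiv> concat (replicate (Suc n) (sigma_run 1 (n - 1)))"

lemma is_braid_torus_word: "1 \<le> n \<Longrightarrow> is_braid (n, torus_word n)"
  by (auto simp: is_braid_def sigma_run_def)

text \<open>
  The torus knot has a colouring of full rank with $|\mu| \neq 1$, which determines the writhe of
  every braid of minimal index.
\<close>

lemma writhe_minimal:
  assumes n: "2 \<le> n" and b: "is_braid (n, w)" and equiv: "equivclp markov_move (n, torus_word n) (n, w)"
  shows "writhe w = writhe (torus_word n)"
proof -
  \<comment> \<open>This sets \<open>mu\<close> to -2. What matters is an absolute value other than
    1, so that \<open>Re \<theta>\<close> is nonzero and can detect the writhe.\<close>
  define \<theta> where "\<theta> = complex_of_real (ln 2) + \<i> * of_real pi"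
  have exp_theta: "exp \<theta> = - 2"
    by (simp add: \<theta>_def exp_add exp_of_real)
  interpret R: reflection_space cscale id \<theta>
    by unfold_locales (simp add: exp_theta)
  \<comment> \<open>The vectors are unit vectors, hence independent, and the covectors are the rows
    of the matrix \<open>A\<close> with every letter equal to 1.\<close>
  define v where "v i = (if i = 0 then 0 else unit_fun (i - 1))" for i
  define c where "c i j = (if i < j then 1 else if j < i then - exp \<theta> else 1 - exp \<theta>)" for i j :: nat
  define f where "f i u = (if i = 0 then 0 else \<Sum>j<n. c i (Suc j) * u j)" for i and u :: "nat \<Rightarrow> complex"
  define x where "x i = (if i \<in> {1..n} then (v i, f i) else (v 1, f 1))" for i
  have fun_f: "R.functional (f i)" for i
    by (simp add: R.functional_def f_def cscale_def sum.distrib distrib_left sum_distrib_left mult.left_commute)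
  have pair: "f i (v j) = c i j" if "i \<in> {1..n}" "j \<in> {1..n}" for i j
  proof -
    have "f i (v j) = (\<Sum>k<n. c i (Suc k) * unit_fun (j - 1) k)"
      using that by (simp add: f_def v_def)
    also have "\<dots> = (\<Sum>k<n. if k = j - 1 then c i j else 0)"
      using that by (intro sum.cong) auto
    also have "\<dots> = c i j"
    proof -
      have "j - 1 < n"
        using that by auto
      then show ?thesis
        by simp
    qed
    finally show ?thesis .
  qed
  have xR: "x i \<in> R.reflections" for i
    using n by (simp add: x_def R.reflections_def fun_f pair) (simp add: c_def)
  define \<tau> where "\<tau> i = (if i < n then \<i> * complex_of_real pi else 0)" for i
  define \<kappa> where "\<kappa> = sum \<tau> {1..n} - of_int (writhe (torus_word n)) * \<theta>"
  have "R.rack.act (torus_word n) x i = R.reflect_tw (\<tau> i) (x i)" if "i \<in> {1..n}" for i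
    unfolding \<tau>_def
  proof (rule R.simplex_colouring[OF n, of v f])
    show "v 0 = 0" "f 0 = (\<lambda>_. 0)"
      by (simp_all add: v_def f_def fun_eq_iff)
  qed (use that pair[unfolded c_def] fun_f in \<open>simp_all add: x_def\<close>)
  then have "R.rack.colouring (n, torus_word n) \<kappa> x \<tau>"
    using xR by (simp add: R.rack.colouring_def \<kappa>_def)
  then have "R.rack.colourable (n, torus_word n) \<kappa> (\<lambda>N. x ` {1..n} \<subseteq> N)"
    unfolding R.rack.colourable_def by (intro exI conjI) auto
  then have "R.rack.colourable (n, w) \<kappa> (\<lambda>N. x ` {1..n} \<subseteq> N)"
    using R.rack.colourable_markov[OF equiv] by blast
  then obtain y \<sigma> where y: "R.rack.colouring (n, w) \<kappa> y \<sigma>"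
    and sub: "\<And>N. R.rack.subrack N \<Longrightarrow> y ` {1..n} \<subseteq> N \<longleftrightarrow> x ` {1..n} \<subseteq> N"
    by (auto simp: R.rack.colourable_def)
  let ?W = "cvec.span ((\<lambda>i. fst (y i)) ` {1..n})"
  have "R.rack.subrack {z \<in> R.reflections. fst z \<in> ?W}"
    by (rule R.subrack_line_in) simp
  moreover have "y ` {1..n} \<subseteq> {z \<in> R.reflections. fst z \<in> ?W}"
    using y by (auto simp: R.rack.colouring_def intro: cvec.span_base)
  ultimately have "x ` {1..n} \<subseteq> {z \<in> R.reflections. fst z \<in> ?W}"
    using sub by blast
  then have xW: "fst (x i) \<in> ?W" if "i \<in> {1..n}" for i
    using that by blast
  have "unit_fun j \<in> ?W" if "j < n" for j
    using xW[of "Suc j"] that by (simp add: x_def v_def)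
  then have "unit_fun ` {..<n} \<subseteq> ?W"
    by blast
  then have "n \<le> cvec.dim ((\<lambda>i. fst (y i)) ` {1..n})"
    using cvec.dim_le_dim_finite[of "unit_fun ` {..<n}" "(\<lambda>i. fst (y i)) ` {1..n}"] dim_unit_funs[of n] by simp
  from R.full_rank_colouring_norm[OF b y this] have 1: "Re (\<kappa> + of_int (writhe w) * \<theta>) = 0" .
  \<comment> \<open>The twists are logarithms of signs, so the norm condition holds for the torus
    word as well with the same \<open>\<kappa>\<close>; comparing the two conditions leaves
    \<open>Re \<theta>\<close> times the difference of the writhes.\<close>
  have "Re (\<tau> i) = 0" for i
    by (simp add: \<tau>_def)
  then have "Re (\<kappa> + of_int (writhe (torus_word n)) * \<theta>) = 0"
    by (simp add: \<kappa>_def)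
  with 1 have "Re (of_int (writhe w) * \<theta>) = Re (of_int (writhe (torus_word n)) * \<theta>)"
    unfolding plus_complex.sel by linarith
  then have "of_int (writhe w) * Re \<theta> = of_int (writhe (torus_word n)) * Re \<theta>"
    by (simp del: writhe_append)
  moreover have "Re \<theta> \<noteq> 0"
    by (simp add: \<theta>_def)
  ultimately show ?thesis
    unfolding mult_cancel_right of_int_eq_iff by blast
qed

text \<open>In passing to group elements the twists of the reflections disappear and only shifts of
  blocks remain. The block colouring is moved to the torus word, the dimension is bounded there, and
  the subrack condition carries the bound back.\<close>

lemma (in reflection_space) satellite_degenerate:
  assumes n: "1 \<le> n" and p: "2 \<le> p" and b: "is_braid (n, w)"
    and equiv: "equivclp markov_move (n, w) (n, torus_word n)"
    and writhe: "writhe w = writhe (torus_word n)"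
    and col: "rack.colouring (n * p, cable_word p w @ sigma_run 1 (p - 1)) \<kappa> x \<tau>"
  shows "dim ((\<lambda>i. fst (x i)) ` {1..n * p}) < n * p"
proof -
  interpret blocks: twisted_rack "{xs :: 'b bijection list. length xs = p}" block_op block_opi "ipow shift" "int p"
    by (rule block_rack)
  have xR: "\<And>i. x i \<in> reflections"
    and eq: "\<And>i. i \<in> {1..n * p} \<Longrightarrow> rack.act (cable_word p w @ sigma_run 1 (p - 1)) x i = reflect_tw (\<tau> i) (x i)"
    using col by (auto simp: rack.colouring_def)
  have pos: "position ` set w \<subseteq> {1..<n}"
    using b by (simp add: is_braid_iff)
  define t where "t i = elt (x i)" for i
  have "conj_act (cable_word p w @ sigma_run 1 (p - 1)) t i = t i" if "i \<in> {1..n * p}" for i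
    using eq[OF that] conj_act_elt[OF xR, of "cable_word p w @ sigma_run 1 (p - 1)"] unfolding t_def
    by (simp only: elt_tw)
  from block_satellite[OF pos _ _ this] p
  have act: "block_act w (block p t) j = ipow shift (if j = 1 then - 1 else 0) (block p t j)" if "j \<in> {1..n}" for j
    using that by simp
  \<comment> \<open>Chosen so that the twists sum to -1 on \<open>w\<close>; equality of the writhes
    then makes them sum to -1 on the torus word too.\<close>
  define \<kappa>' where "\<kappa>' = - 1 - writhe w * int p"
  have "(\<Sum>j=1..n. if j = 1 then - 1 else 0) = (- 1 :: int)"
    using n by simp
  then have "blocks.colouring (n, w) \<kappa>' (block p t) (\<lambda>j. if j = 1 then - 1 else 0)"
    using act by (simp add: blocks.colouring_def \<kappa>'_def)
  then have "blocks.colourable (n, w) \<kappa>' (\<lambda>N. block p t ` {1..n} \<subseteq> N)"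
    unfolding blocks.colourable_def by (intro exI conjI) auto
  then have "blocks.colourable (n, torus_word n) \<kappa>' (\<lambda>N. block p t ` {1..n} \<subseteq> N)"
    using blocks.colourable_markov[OF equiv] by blast
  then obtain s \<sigma> where s: "blocks.colouring (n, torus_word n) \<kappa>' s \<sigma>"
    and sub: "\<And>N. blocks.subrack N \<Longrightarrow> s ` {1..n} \<subseteq> N \<longleftrightarrow> block p t ` {1..n} \<subseteq> N"
    by (auto simp: blocks.colourable_def)
  have len: "\<And>i. length (s i) = p" and seq: "\<And>i. i \<in> {1..n} \<Longrightarrow> block_act (torus_word n) s i = ipow shift (\<sigma> i) (s i)"
    and total: "sum \<sigma> {1..n} = - 1"
    using s writhe by (auto simp: blocks.colouring_def \<kappa>'_def)
  \<comment> \<open>Blocks made of reflections whose lines lie in \<open>W\<close>. With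
    \<open>W = UNIV\<close> the condition says that the new entries are still reflections; with
    \<open>W\<close> the span of the new vectors it bounds the old ones.\<close>
  define lines where "lines W = {xs. length xs = p \<and> set xs \<subseteq> elt ` {z \<in> reflections. fst z \<in> W}}" for W
  have lines: "blocks.subrack (lines W)" if "subspace W" for W
    unfolding lines_def
  proof (rule block_subrack)
    note sub = subrack_line_in[OF that, unfolded rack.subrack_def]
    fix a b assume "a \<in> elt ` {z \<in> reflections. fst z \<in> W}" "b \<in> elt ` {z \<in> reflections. fst z \<in> W}"
    then obtain y z where yz: "y \<in> {z \<in> reflections. fst z \<in> W}" "z \<in> {z \<in> reflections. fst z \<in> W}"
      "a = elt y" "b = elt z"
      by blast
    then have "reflect_op y z \<in> {z \<in> reflections. fst z \<in> W}" "reflect_opi y z \<in> {z \<in> reflections. fst z \<in> W}"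
      using sub by blast+
    from this[THEN imageI, of elt] show "group_conj a b \<in> elt ` {z \<in> reflections. fst z \<in> W}"
      "group_conj (- a) b \<in> elt ` {z \<in> reflections. fst z \<in> W}"
      using yz elt_op[of y z] by simp_all
  qed
  have "block p t ` {1..n} \<subseteq> lines UNIV"
    using xR by (auto simp: lines_def block_def t_def)
  then have "s ` {1..n} \<subseteq> lines UNIV"
    using sub lines[of UNIV] by simp
  then have "set (s i) \<subseteq> elt ` reflections" if "i \<in> {1..n}" for i
    using subsetD[OF _ imageI[OF that]] by (fastforce simp: lines_def)
  then have "s i ! k \<in> elt ` reflections" if "i \<in> {1..n}" "k < p" for i k
    using that len by (metis nth_mem subsetD)
  then have "\<forall>ik\<in>{1..n} \<times> {..<p}. \<exists>z. z \<in> reflections \<and> s (fst ik) ! snd ik = elt z"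
    by fastforce
  from bchoice[OF this] obtain y' where y': "\<forall>ik\<in>{1..n} \<times> {..<p}. y' ik \<in> reflections \<and> s (fst ik) ! snd ik = elt (y' ik)"
    by blast
  define y where "y i k = y' (i, k)" for i k
  have y: "y i k \<in> reflections" "s i ! k = elt (y i k)" if "i \<in> {1..n}" "k < p" for i k
    using y' that by (auto simp: y_def)
  define E where "E = {fst (y i k) | i k. i \<in> {1..n} \<and> k < p}"
  have "dim E < n * p"
    unfolding E_def
  proof (rule torus_cable_degenerate[OF p n len _ _ _ seq total])
    fix i a assume "i \<in> {1..n}" "a \<in> set (s i)"
    then obtain k where "k < p" "a = elt (y i k)" "y i k \<in> reflections"
      using y len by (metis in_set_conv_nth)
    then show "lin_op (app a)"
      using lin_op_reflect by (simp add: app_elt)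
  qed (use y displaces_elt displacement_elt in auto)
  moreover have "fst (x q) \<in> span E" if q: "q \<in> {1..n * p}" for q
  proof -
    have "s i \<in> lines (span E)" if i: "i \<in> {1..n}" for i
    proof -
      have "a \<in> elt ` {z \<in> reflections. fst z \<in> span E}" if a: "a \<in> set (s i)" for a
      proof -
        obtain k where k: "k < p" "a = s i ! k"
          using a len[of i] by (auto simp: in_set_conv_nth)
        then have "fst (y i k) \<in> span E"
          using i by (intro span_base) (auto simp: E_def)
        then show ?thesis
          using y[OF i k(1)] k(2) by auto
      qed
      then show ?thesis
        using len by (auto simp: lines_def)
    qed
    then have "block p t ` {1..n} \<subseteq> lines (span E)"
      using sub[OF lines[OF subspace_span]] by blast
    moreover define j where "j = Suc ((q - 1) div p)"
    have "(q - 1) div p < n"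
      using q p by (intro less_mult_imp_div_less) auto
    then have "j \<in> {1..n}"
      by (simp add: j_def)
    ultimately have "block p t j \<in> lines (span E)"
      by blast
    moreover have "t q \<in> set (block p t j)"
    proof -
      have "q = (j - 1) * p + 1 + (q - 1) mod p"
        using q by (simp add: j_def)
      moreover have "(q - 1) mod p < p"
        using p by simp
      ultimately show ?thesis
        unfolding block_def by (auto intro!: image_eqI[of _ _ "(q - 1) mod p"])
    qed
    ultimately obtain z where z: "z \<in> reflections" "fst z \<in> span E" "elt (x q) = elt z"
      by (auto simp: lines_def t_def)
    have "span {fst z} \<subseteq> span E"
      using z(2) by (simp add: span_minimal)
    then show ?thesis
      using elt_line[OF xR z(1,3)] by blast
  qed
  moreover have "finite E"
  proof -
    have "E = (\<lambda>(i, k). fst (y i k)) ` ({1..n} \<times> {..<p})"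
      by (force simp: E_def)
    then show ?thesis
      by simp
  qed
  ultimately show ?thesis
    using dim_le_dim_finite[of "(\<lambda>i. fst (x i)) ` {1..n * p}" E] by (auto simp: image_subset_iff)
qed

text \<open>A rank of at least \<open>n * p\<close> would give a colouring of the satellite spanning
  that dimension. Its \<open>m * p\<close> strands then leave only \<open>m = n\<close>, where both
  the writhe and the degeneracy result apply.\<close>

lemma augmentation_rank_satellite:
  assumes n: "2 \<le> n" and p: "2 \<le> p" and a: "is_braid (m, wa)" "m \<le> n"
    and equiv_a: "equivclp markov_move (n, torus_word n) (m, wa)"
    and b: "is_braid (nb, wb)"
    and equiv_b: "equivclp markov_move (nb, wb) (m * p, cable_word p wa @ sigma_run 1 (p - 1))"
    and e: "e \<in> augmentations (nb, wb)" "e mu \<noteq> 1"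
  shows "augmentation_rank (nb, wb) e < n * p"
proof (rule ccontr)
  assume large: "\<not> ?thesis"
  interpret augmentation nb wb e
    using b e(1) by unfold_locales
  obtain \<theta> where theta: "exp \<theta> = e mu"
    using complex_exp_surj[OF mu_nonzero] .
  let ?C = "vec_fun nb ` set (cols (map_mat e (matA nb)))"
  have "map_mat e (matA nb) \<in> carrier_mat nb nb"
    using square_carriers(1) by simp
  then have rank: "n * p \<le> cvec.dim ?C"
    using large rank_le_dim[of "map_mat e (matA nb)" nb nb] by (simp add: augmentation_rank_def)
  interpret pair: vector_space_pair cscale cscale
    by unfold_locales
  obtain \<pi> where pi: "range \<pi> \<subseteq> cvec.span ?C" "Vector_Spaces.linear cscale cscale \<pi>"
    "\<And>v. v \<in> cvec.span ?C \<Longrightarrow> \<pi> v = v"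
    using pair.linear_exists_left_inverse_on[of id "cvec.span ?C"] cvec.linear_id by auto
  interpret augmentation_space nb wb e \<pi> \<theta>
  proof unfold_locales
    show "exp \<theta> \<noteq> 1" "exp \<theta> = e mu"
      using theta e(2) by simp_all
    show "cvec.lin_op \<pi>"
      using pi(2) by (simp add: cvec.lin_op_def Vector_Spaces.linear_iff)
    show "\<pi> v \<in> cvec.span ?C" "v \<in> cvec.span ?C \<Longrightarrow> \<pi> v = v" for v
      using pi by auto
  qed
  obtain \<kappa> \<tau> where "rack.colouring (nb, wb) \<kappa> point \<tau>"
    using augmentation_colouring by blast
  then have "rack.colourable (nb, wb) \<kappa> (\<lambda>N. point ` {1..nb} \<subseteq> N)"
    unfolding rack.colourable_def by (intro exI conjI) auto
  then have "rack.colourable (m * p, cable_word p wa @ sigma_run 1 (p - 1)) \<kappa> (\<lambda>N. point ` {1..nb} \<subseteq> N)"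
    using rack.colourable_markov[OF equiv_b] by blast
  then obtain x \<sigma> where x: "rack.colouring (m * p, cable_word p wa @ sigma_run 1 (p - 1)) \<kappa> x \<sigma>"
    and sub: "\<And>N. rack.subrack N \<Longrightarrow> x ` {1..m * p} \<subseteq> N \<longleftrightarrow> point ` {1..nb} \<subseteq> N"
    by (auto simp: rack.colourable_def)
  let ?X = "(\<lambda>i. fst (x i)) ` {1..m * p}"
  have "rack.subrack {z \<in> reflections. fst z \<in> cvec.span ?X}"
    by (rule subrack_line_in) simp
  moreover have "x ` {1..m * p} \<subseteq> {z \<in> reflections. fst z \<in> cvec.span ?X}"
    using x by (auto simp: rack.colouring_def intro: cvec.span_base)
  ultimately have "point ` {1..nb} \<subseteq> {z \<in> reflections. fst z \<in> cvec.span ?X}"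
    using sub by blast
  then have "(\<lambda>i. fst (point i)) ` {1..nb} \<subseteq> cvec.span ?X"
    by blast
  then have "?C \<subseteq> cvec.span ?X"
    unfolding point_vectors .
  then have "cvec.dim ?C \<le> cvec.dim ?X"
    by (rule cvec.dim_le_dim_finite) simp
  then have full: "n * p \<le> cvec.dim ?X"
    using rank by simp
  also have "\<dots> \<le> card ?X"
    by (rule cvec.dim_le_card') simp
  also have "\<dots> \<le> m * p"
    using card_image_le[of "{1..m * p}" "\<lambda>i. fst (x i)"] by simp
  finally have "n \<le> m"
    using p by simp
  then have m: "m = n"
    using a(2) by simp
  have "cvec.dim ?X < m * p"
  proof (rule satellite_degenerate[OF _ p a(1)])
    show "1 \<le> m"
      using n m by simp
    show "equivclp markov_move (m, wa) (m, torus_word m)"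
      using equiv_a m by (simp add: equivclp_sym)
    show "writhe wa = writhe (torus_word m)"
      using writhe_minimal[OF n, of wa] a equiv_a m by simp
    show "rack.colouring (m * p, cable_word p wa @ sigma_run 1 (p - 1)) \<kappa> x \<sigma>"
      by (rule x)
  qed
  then show False
    using full m by simp
qed

lemma braid_closure_eq: "braid_closure b = braid_closure c \<Longrightarrow> equivclp markov_move b c"
proof -
  assume "braid_closure b = braid_closure c"
  moreover have "c \<in> braid_closure c"
    by (simp add: braid_closure_def)
  ultimately have "c \<in> braid_closure b"
    by simp
  then show ?thesis
    by (simp add: braid_closure_def)
qed

theorem theorem1p4:
  fixes p n :: nat and K :: link
  assumes "1 < p" and "1 < n"
    and "iterated_torus [n, p] [int n + 1, 1] K"
  shows "ar K < enat (n * p)"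
proof -
  obtain a K1 where a: "iterated_torus [n] [int n + 1] K1" "is_minimal_index a K1"
    and K: "K = satellite_link a (torus_braid p 1)"
    using assms(3) by (cases rule: iterated_torus.cases) auto
  obtain a0 K0 where a0: "iterated_torus [] [] K0" "is_minimal_index a0 K0"
    and K1: "K1 = satellite_link a0 (torus_braid n (int n + 1))"
    using a(1) by (cases rule: iterated_torus.cases) auto
  have K0: "K0 = braid_closure (1, [])"
    using a0(1) by (cases rule: iterated_torus.cases) auto
  have "is_braid (1, [])"
    by (simp add: is_braid_def)
  then have "fst a0 \<le> 1" "is_braid a0"
    using a0(2) K0 by (auto simp: is_minimal_index_def)
  \<comment> \<open>On one strand there are no generators, so the minimal braid of the unknot is the
    empty word.\<close>
  then have "a0 = (1, [])"
    by (cases a0; cases "snd a0") (auto simp: is_braid_def)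
  moreover have "nat (int n + 1) = Suc n"
    by simp
  ultimately have K1': "K1 = braid_closure (n, torus_word n)"
    by (simp add: K1 satellite_link_def torus_braid_def power_word_def cable_word_def)
  obtain m wa where a_eq: "a = (m, wa)"
    by fastforce
  have a': "is_braid (m, wa)" "braid_closure (m, wa) = K1" "m \<le> n"
    using a(2) K1' is_braid_torus_word[of n] assms(2) by (auto simp: is_minimal_index_def a_eq)
  have K': "K = braid_closure (m * p, cable_word p wa @ sigma_run 1 (p - 1))"
    by (simp add: K a_eq satellite_link_def torus_braid_def power_word_def)
  \<comment> \<open>A supremum of strictly bounded values need not be strictly bounded, so the
    integer bound is lowered by one first.\<close>
  have "ar K \<le> enat (n * p - 1)"
    unfolding ar_def
  proof (rule Sup_least, clarsimp)
    fix nb wb e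
    assume "is_braid (nb, wb)" "K = braid_closure (nb, wb)" "e \<in> augmentations (nb, wb)" "e mu \<noteq> 1"
    then show "augmentation_rank (nb, wb) e \<le> n * p - Suc 0"
      using augmentation_rank_satellite[of n p m wa nb wb e] assms(1,2) a' K'
        braid_closure_eq[of "(n, torus_word n)" "(m, wa)"]
        braid_closure_eq[of "(nb, wb)" "(m * p, cable_word p wa @ sigma_run 1 (p - 1))"] K1'
      by simp
  qed
  also have "\<dots> < enat (n * p)"
    using assms(1,2) by simp
  finally show ?thesis .
qed

end
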